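(* Let $S$ be a signature of first-order functional logic, let $T\subseteq\mathrm{Expr}_\pi$ be a set of formulas of $S$ and let $\varphi\in\mathrm{Expr}_\pi$. If $T\models\varphi$ (i.e. every functional-logic structure $M$ of signature $S$ with $M\models T$ satisfies $M\models\varphi$), then $T\vdash\varphi$ in the calculus of functional logic.
   Context: **Signatures.** A signature of first-order functional logic is a tuple $S=(\mathrm{SRT},\mathrm{SOP},\mathrm{VSRT},\mathrm{VAR},\mathrm{sig})$, where $\mathrm{SRT}$ is a set of sorts, $\mathrm{VSRT}\subseteq\mathrm{SRT}$ (sorts having variables and quantifiers), $\mathrm{SOP}$ is a set of symbolic operations, $\mathrm{VAR}$ is a set of variables, $\mathrm{SOP}\cap\mathrm{VAR}=\emptyset$, and $\mathrm{SOP}\cup\mathrm{VAR}$ can be well-ordered. The map $\mathrm{sig}$ assigns to each $op\in\mathrm{SOP}\cup\mathrm{VAR}$ a triple $(\gamma,\vec\alpha,(\vec\beta_1,\dots,\vec\beta_m))$ with $m\ge 0$, $\gamma\in\mathrm{SRT}$, $\vec\alpha=(\alpha_1,\dots,\alpha_m)\in\mathrm{SRT}^m$, and each $\vec\beta_i=(\beta_{i1},\dots,\beta_{ir_i})$ a finite (possibly empty) sequence in $\mathrm{VSRT}$. Every variable has $m=0$ and $\gamma\in\mathrm{VSRT}$; for $\alpha\in\mathrm{VSRT}$ the set $\mathrm{VAR}_\alpha$ of variables of sort $\alpha$ is enumerable. There is a distinguished sort $\pi\in\mathrm{SRT}$ (formulas) and distinguished elements of $\mathrm{SOP}$: $\top,\bot$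 with sig $(\pi,\langle\rangle,\langle\rangle)$; $\neg$ with one argument of sort $\pi$, result $\pi$, no binding; $\to,\wedge,\vee,\leftrightarrow$ with two arguments of sort $\pi$, result $\pi$, no binding; for each $\alpha\in\mathrm{VSRT}$, $\forall^\alpha,\exists^\alpha$ with sig $(\pi,(\pi),((\alpha)))$; for each $\alpha\in\mathrm{SRT}$, $=^\alpha$ with two arguments of sort $\alpha$, result $\pi$, no binding. The symbol $=^\pi$ is identified with $\leftrightarrow$. **Expressions.** The sets $\mathrm{Expr}_\gamma$ ($\gamma\in\mathrm{SRT}$) are defined inductively: if $\mathrm{sig}(op)=(\gamma,\vec\alpha,(\vec\beta_i)_{i\le m})$, then for $m=0$ the string $op$ is in $\mathrm{Expr}_\gamma$; for $m>0$ (so $op\in\mathrm{SOP}$), $op(A_1,\dots,A_m)\in\mathrm{Expr}_\gamma$, where $A_i$ is $a_i$ if $r_i=0$ and $(v_{i1},\dots,v_{ir_i}):a_i$ if $r_i>0$, with $a_i\in\mathrm{Expr}_{\alpha_i}$ and $\vec v_i=(v_{i1},\dots,v_{ir_i})$ pairwise distinct variables, $v_{ij}\in\mathrm{VAR}_{\beta_{ij}}$. Formulas are elements of $\mathrm{Expr}_\pi$. For $\vec\sigma=(\sigma_1,\dots,\sigma_\ell)$: $\mathrm{VAR}_{\vec\sigma}=\prod_i\mathrm{VAR}_{\sigma_i}$, $\mathrm{Expr}_{\vec\sigma}=\prod_i\mathrm{Expr}_{\sigma_i}$. $\{\vec a\}$ is the set of components of $\vec a$; juxtaposition of sequences is concatenation.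 $\forall x\,\varphi$ stands for $\forall^\xi((x):\varphi)$ for $x\in\mathrm{VAR}_\xi$ (likewise $\exists$), $\forall\vec z$ for $\forall z_1\cdots\forall z_\ell$, and $a=b$ for $=^\gamma(a,b)$ if $a,b\in\mathrm{Expr}_\gamma$. **Variables and substitution.** Free and bound variables: $\mathrm{fv}(op)=\{op\}\cap\mathrm{VAR}$, $\mathrm{gv}(op)=\emptyset$ if $m=0$; for $e=op(A_1,\dots,A_m)$: $\mathrm{fv}(e)=\bigcup_i(\mathrm{fv}(a_i)\setminus\{\vec v_i\})$, $\mathrm{gv}(e)=\bigcup_i(\mathrm{gv}(a_i)\cup\{\vec v_i\})$. For a finite sequence $\vec u$ of variables, $\mathrm{Expr}_\gamma[\vec u]=\{e\in\mathrm{Expr}_\gamma:\mathrm{fv}(e)\subseteq\{\vec u\}\}$; $\mathrm{Expr}_\gamma[]$ is the set of closed expressions. For $\vec x\in\mathrm{VAR}_{\vec\sigma}$, $\vec d\in\mathrm{Expr}_{\vec\sigma}$ the simultaneous substitution $e[\vec x\gets\vec d]$ is: for $m=0$, $op[\vec x\gets\vec d]=d_k$ with $k$ the largest index such that $x_k=op$ if $op\in\{\vec x\}$, and $=op$ otherwise; for $m>0$, replace every $a_i$ in $e$ by $a_i[\vec x\,\vec v_i\gets\vec d\,\vec v_i]$, leaving $op$ and the $\vec v_i$ unchanged. $\varphi^x_a$ means $\varphi[x\gets a]$ (sequences of length 1). Substitutability: $\mathrm{Subb}(d,x,e)$ holds iff for all $i\le m$: $x\in\{\vec v_i\}$ or ($\mathrm{Subb}(d,x,a_i)$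 and $\mathrm{fv}(d)\cap\{\vec v_i\}=\emptyset$). **Calculus.** Axioms: propositional tautologies; $\forall x\varphi\to\varphi^x_a$ and $\varphi^x_a\to\exists x\varphi$ provided $\mathrm{Subb}(a,x,\varphi)$; $\forall x(\psi\to\varphi)\to(\psi\to\forall x\varphi)$ and $\forall x(\varphi\to\psi)\to(\exists x\varphi\to\psi)$ provided $x\notin\mathrm{fv}(\psi)$; (I1) $a=a$; (I2) $\forall\vec z\,(b_1[\vec x\gets\vec z]=b_2[\vec y\gets\vec z])\to op(\Delta,B_1,\Gamma)=op(\Delta,B_2,\Gamma)$, where $op\in\mathrm{SOP}$, $b_1,b_2\in\mathrm{Expr}_{\alpha_i}$, $\vec x,\vec y,\vec z\in\mathrm{VAR}_{\vec\beta_i}$, $B_1,B_2$ (the $i$-th arguments) are $(\vec x):b_1$, $(\vec y):b_2$ if $r_i>0$ and $b_1,b_2$ if $r_i=0$, $\Delta,\Gamma$ are the (identical) remaining arguments, possibly empty, and $\{\vec z\}\cap(\mathrm{fv}(b_1)\cup\mathrm{fv}(b_2))=\emptyset$. Rules: modus ponens and generalization ($\varphi\mapsto\forall x\varphi$). $T\vdash\varphi$ means $\varphi$ is derivable when the formulas of $T$ are added as axioms. **Structures.** A (functional-logic normal) structure $M$ of signature $S$ assigns: to each $\alpha\in\mathrm{SRT}$ a nonempty set $M_\alpha$ (put $M_{\vec\sigma}=\prod_iM_{\sigma_i}$); to each $\gamma\in\mathrm{SRT}$ and $\vec\sigma\in\mathrm{VSRT}^\ell$ a set $M_\gamma^{\vec\sigma}$,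 with $M_\gamma^{\langle\rangle}=M_\gamma$ and $M_\gamma^{\vec\sigma}\subseteq\{f: M_{\vec\sigma}\to M_\gamma\}$ if $\ell>0$; to each $op\in\mathrm{SOP}$ with $\mathrm{sig}(op)=(\gamma,\vec\alpha,(\vec\beta_i)_{i\le m})$ an element $M(op)\in M_\gamma$ if $m=0$ and a function $M(op):\prod_{i\le m}M_{\alpha_i}^{\vec\beta_i}\to M_\gamma$ if $m>0$; such that: - (constants, projections; $\ell>0$) for $w\in M_\gamma$ the constant function $M_{\vec\sigma}\to M_\gamma$ with value $w$ is in $M_\gamma^{\vec\sigma}$; each projection $M_{\vec\sigma}\to M_{\sigma_j}$ is in $M_{\sigma_j}^{\vec\sigma}$; - (partial fixing) if $g\in M_\gamma^{\vec\sigma\vec\varrho}$ and $\vec x\in M_{\vec\sigma}$ then $g_{\vec x}:\vec r\mapsto g(\vec x\,\vec r)$ is in $M_\gamma^{\vec\varrho}$ (for $\vec\varrho$ empty, $g_{\vec x}$ is the value $g(\vec x)$); - (composition) if $m>0$, $\ell>0$, $g_i\in M_{\alpha_i}^{\vec\sigma\vec\beta_i}$ for all $i\le m$, and $h_i=g_i$ if $r_i=0$, $h_i(\vec y)=(g_i)_{\vec y}$ if $r_i>0$, then $\vec y\mapsto M(op)(h_1(\vec y),\dots,h_m(\vec y))$ is in $M_\gamma^{\vec\sigma}$; - $M_\pi=\{M(\bot),M(\top)\}=\{0,1\}$ is a two-element set, $M(\bot)=0$, $M(\top)=1$, and $M(\neg),M(\wedge),M(\vee),M(\to),M(\leftrightarrow)$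 are the usual Boolean operations; $M(\forall^\alpha)(\theta)=1$ iff $\theta(x)=1$ for all $x\in M_\alpha$, and $M(\exists^\alpha)(\theta)=1$ iff $\theta(x)=1$ for some $x\in M_\alpha$ ($\theta\in M_\pi^{(\alpha)}$), the value being $0$ otherwise; $M(=^\alpha)(x,y)=1$ if $x=y$ and $0$ otherwise. **Interpretation.** For $e\in\mathrm{Expr}_\gamma[\vec u]$, $\vec u\in\mathrm{VAR}_{\vec\sigma}$ of length $\ell$, $e_M(\vec u)$ is: for $\ell=0$: $M(op)$ if $m=0$, and $M(op)\big((a_i)_M(\vec v_i)\big)_{i\le m}$ if $m>0$. For $\ell>0$ it is the function $M_{\vec\sigma}\to M_\gamma$ given by: if $m=0$ and $e\in\mathrm{VAR}$, the projection to coordinate $k$, $k$ largest with $u_k=e$; if $m=0$ and $e\in\mathrm{SOP}$, the constant function $M(e)$; if $m>0$, $\vec x\mapsto M(op)(h_1(\vec x),\dots,h_m(\vec x))$ with $h_i(\vec x)=(a_i)_M(\vec u)(\vec x)$ if $r_i=0$, and $h_i(\vec x)=\big(\vec y\mapsto (a_i)_M(\vec u\,\vec v_i)(\vec x\,\vec y)\big)$, $\vec y\in M_{\vec\beta_i}$, if $r_i>0$. **Satisfaction.** $M\models\varphi$ iff for every finite sequence $\vec u\in\mathrm{VAR}_{\vec\sigma}$ with $\mathrm{fv}(\varphi)\subseteq\{\vec u\}$ and every $\vec x\in M_{\vec\sigma}$, $\varphi_M(\vec u)(\vec x)=1$ (for $\vec u$ empty: $\varphi_M()=1$). $M\models T$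 iff $M\models\varphi$ for all $\varphi\in T$. *)

theory Defs
  imports Main "HOL-Library.FuncSet" "HOL-Library.Countable_Set"
begin

section \<open>Signatures\<close>

record ('srt, 's) signature =
  SRT :: "'srt set"
  VSRT :: "'srt set"
  SOP :: "'s set"
  VAR :: "'s set"
  sig :: "'s \<Rightarrow> 'srt \<times> 'srt list \<times> 'srt list list"
  form_sort :: 'srt
  top_sym :: 's
  bot_sym :: 's
  neg_sym :: 's
  imp_sym :: 's
  con_sym :: 's
  dis_sym :: 's
  iff_sym :: 's
  all_sym :: "'srt \<Rightarrow> 's"
  ex_sym :: "'srt \<Rightarrow> 's"
  eq_sym :: "'srt \<Rightarrow> 's"

abbreviation sort_of :: "('srt, 's) signature \<Rightarrow> 's \<Rightarrow> 'srt" where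
  "sort_of S x \<equiv> fst (sig S x)"

definition vars :: "('srt, 's) signature \<Rightarrow> 'srt \<Rightarrow> 's set" where
  "vars S \<alpha> = {x \<in> VAR S. sort_of S x = \<alpha>}"

definition var_seqs :: "('srt, 's) signature \<Rightarrow> 'srt list \<Rightarrow> 's list set" where
  "var_seqs S \<sigma>s = {vs. list_all2 (\<lambda>x \<alpha>. x \<in> vars S \<alpha>) vs \<sigma>s}"

text \<open>The logical symbols are pairwise distinct, except that equality at the sort of formulas is
  the biconditional. Only the inequalities that do not already follow from the prescribed values
  of \<^term>\<open>sig\<close> are listed.\<close>

definition is_signature :: "('srt, 's) signature \<Rightarrow> bool" where
  "is_signature S \<longleftrightarrow>
     VSRT S \<subseteq> SRT S \<and> form_sort S \<in> SRT S \<and>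
     SOP S \<inter> VAR S = {} \<and>
     (\<exists>r. well_order_on (SOP S \<union> VAR S) r) \<and>
     (\<forall>f \<in> SOP S \<union> VAR S. \<forall>\<gamma> \<alpha>s \<beta>ss. sig S f = (\<gamma>, \<alpha>s, \<beta>ss) \<longrightarrow>
        \<gamma> \<in> SRT S \<and> set \<alpha>s \<subseteq> SRT S \<and> length \<beta>ss = length \<alpha>s \<and>
        (\<forall>\<beta>s \<in> set \<beta>ss. set \<beta>s \<subseteq> VSRT S)) \<and>
     (\<forall>x \<in> VAR S. \<exists>\<gamma> \<in> VSRT S. sig S x = (\<gamma>, [], [])) \<and>
     (\<forall>\<alpha> \<in> VSRT S. countable (vars S \<alpha>) \<and> infinite (vars S \<alpha>)) \<and>
     (\<forall>f \<in> {top_sym S, bot_sym S}. f \<in> SOP S \<and> sig S f = (form_sort S, [], [])) \<and>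
     (neg_sym S \<in> SOP S \<and> sig S (neg_sym S) = (form_sort S, [form_sort S], [[]])) \<and>
     (\<forall>f \<in> {imp_sym S, con_sym S, dis_sym S, iff_sym S}.
        f \<in> SOP S \<and> sig S f = (form_sort S, [form_sort S, form_sort S], [[], []])) \<and>
     (\<forall>\<alpha> \<in> VSRT S. \<forall>f \<in> {all_sym S \<alpha>, ex_sym S \<alpha>}.
        f \<in> SOP S \<and> sig S f = (form_sort S, [form_sort S], [[\<alpha>]])) \<and>
     (\<forall>\<alpha> \<in> SRT S. eq_sym S \<alpha> \<in> SOP S \<and> sig S (eq_sym S \<alpha>) = (form_sort S, [\<alpha>, \<alpha>], [[], []])) \<and>
     eq_sym S (form_sort S) = iff_sym S \<and>
     top_sym S \<noteq> bot_sym S \<and>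
     distinct [imp_sym S, con_sym S, dis_sym S, iff_sym S] \<and>
     (\<forall>\<alpha> \<in> VSRT S. all_sym S \<alpha> \<noteq> ex_sym S \<alpha>)"


section \<open>Expressions\<close>

text \<open>\<open>Op f [(vs\<^sub>1, a\<^sub>1), \<dots>]\<close> stands for \<open>f(A\<^sub>1, \<dots>)\<close> with \<open>A\<^sub>i\<close> being \<open>(vs\<^sub>i) : a\<^sub>i\<close>, or just \<open>a\<^sub>i\<close> if
  \<open>vs\<^sub>i = []\<close>. Variables and constants are of the form \<open>Op f []\<close>.\<close>

datatype 's expr = Op 's "('s list \<times> 's expr) list"

inductive_set Expr :: "('srt, 's) signature \<Rightarrow> ('srt \<times> 's expr) set"
  for S :: "('srt, 's) signature" where
  OpI: "\<lbrakk> f \<in> SOP S \<union> VAR S; sig S f = (\<gamma>, \<alpha>s, \<beta>ss); length args = length \<alpha>s;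
     \<forall>i < length \<alpha>s. fst (args ! i) \<in> var_seqs S (\<beta>ss ! i) \<and> distinct (fst (args ! i)) \<and>
       (\<alpha>s ! i, snd (args ! i)) \<in> Expr S \<rbrakk>
   \<Longrightarrow> (\<gamma>, Op f args) \<in> Expr S"

definition Exprs :: "('srt, 's) signature \<Rightarrow> 'srt \<Rightarrow> 's expr set" where
  "Exprs S \<gamma> = {e. (\<gamma>, e) \<in> Expr S}"

abbreviation Formulas :: "('srt, 's) signature \<Rightarrow> 's expr set" where
  "Formulas S \<equiv> Exprs S (form_sort S)"

abbreviation Var :: "'s \<Rightarrow> 's expr" where "Var x \<equiv> Op x []"

definition Top :: "('srt, 's) signature \<Rightarrow> 's expr" where
  "Top S = Op (top_sym S) []"
definition Bot :: "('srt, 's) signature \<Rightarrow> 's expr" where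
  "Bot S = Op (bot_sym S) []"
definition Neg :: "('srt, 's) signature \<Rightarrow> 's expr \<Rightarrow> 's expr" where
  "Neg S a = Op (neg_sym S) [([], a)]"
definition Imp :: "('srt, 's) signature \<Rightarrow> 's expr \<Rightarrow> 's expr \<Rightarrow> 's expr" where
  "Imp S a b = Op (imp_sym S) [([], a), ([], b)]"
definition Con :: "('srt, 's) signature \<Rightarrow> 's expr \<Rightarrow> 's expr \<Rightarrow> 's expr" where
  "Con S a b = Op (con_sym S) [([], a), ([], b)]"
definition Dis :: "('srt, 's) signature \<Rightarrow> 's expr \<Rightarrow> 's expr \<Rightarrow> 's expr" where
  "Dis S a b = Op (dis_sym S) [([], a), ([], b)]"
definition Iff :: "('srt, 's) signature \<Rightarrow> 's expr \<Rightarrow> 's expr \<Rightarrow> 's expr" where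
  "Iff S a b = Op (iff_sym S) [([], a), ([], b)]"
definition Forall :: "('srt, 's) signature \<Rightarrow> 's \<Rightarrow> 's expr \<Rightarrow> 's expr" where
  "Forall S x a = Op (all_sym S (sort_of S x)) [([x], a)]"
definition Exists :: "('srt, 's) signature \<Rightarrow> 's \<Rightarrow> 's expr \<Rightarrow> 's expr" where
  "Exists S x a = Op (ex_sym S (sort_of S x)) [([x], a)]"
definition Foralls :: "('srt, 's) signature \<Rightarrow> 's list \<Rightarrow> 's expr \<Rightarrow> 's expr" where
  "Foralls S xs a = foldr (Forall S) xs a"
definition Eq :: "('srt, 's) signature \<Rightarrow> 'srt \<Rightarrow> 's expr \<Rightarrow> 's expr \<Rightarrow> 's expr" where
  "Eq S \<gamma> a b = Op (eq_sym S \<gamma>) [([], a), ([], b)]"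

lemma size_arg [termination_simp]:
  "(vs, a) \<in> set args \<Longrightarrow> size a < Suc (size_list (size_prod (\<lambda>_. 0) size) args)"
  by (induction args) auto

fun fv :: "('srt, 's) signature \<Rightarrow> 's expr \<Rightarrow> 's set" where
  "fv S (Op f args) =
     (if args = [] then {f} \<inter> VAR S else (\<Union>(vs, a) \<in> set args. fv S a - set vs))"

text \<open>Since \<^const>\<open>map_of\<close> returns the first match, the reversal makes the largest index with
  \<open>xs ! k = x\<close> count.\<close>

definition last_assoc :: "'s list \<Rightarrow> 'b list \<Rightarrow> 's \<Rightarrow> 'b option" where
  "last_assoc xs ds x = map_of (rev (zip xs ds)) x"

fun subst :: "'s list \<Rightarrow> 's expr list \<Rightarrow> 's expr \<Rightarrow> 's expr" where
  "subst xs ds (Op f args) =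
     (if args = [] then (case last_assoc xs ds f of Some d \<Rightarrow> d | None \<Rightarrow> Op f [])
      else Op f (map (\<lambda>(vs, a). (vs, subst (xs @ vs) (ds @ map Var vs) a)) args))"

fun Subb :: "('srt, 's) signature \<Rightarrow> 's expr \<Rightarrow> 's \<Rightarrow> 's expr \<Rightarrow> bool" where
  "Subb S d x (Op f args) \<longleftrightarrow>
     (\<forall>(vs, a) \<in> set args. x \<in> set vs \<or> (Subb S d x a \<and> fv S d \<inter> set vs = {}))"


section \<open>Calculus\<close>

definition boolean_valuation :: "('srt, 's) signature \<Rightarrow> ('s expr \<Rightarrow> bool) \<Rightarrow> bool" where
  "boolean_valuation S v \<longleftrightarrow>
     v (Top S) \<and> \<not> v (Bot S) \<and>
     (\<forall>a \<in> Formulas S. v (Neg S a) = (\<not> v a)) \<and>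
     (\<forall>a \<in> Formulas S. \<forall>b \<in> Formulas S.
        v (Imp S a b) = (v a \<longrightarrow> v b) \<and> v (Con S a b) = (v a \<and> v b) \<and>
        v (Dis S a b) = (v a \<or> v b) \<and> v (Iff S a b) = (v a \<longleftrightarrow> v b))"

definition tautology :: "('srt, 's) signature \<Rightarrow> 's expr \<Rightarrow> bool" where
  "tautology S \<phi> \<longleftrightarrow> \<phi> \<in> Formulas S \<and> (\<forall>v. boolean_valuation S v \<longrightarrow> v \<phi>)"

text \<open>In \<open>I2\<close> the membership conditions on the two compound expressions entail that \<open>b\<^sub>1\<close>, \<open>b\<^sub>2\<close> have
  the argument sort \<open>\<alpha>s ! length \<Delta>\<close>, and that \<open>xs\<close>, \<open>ys\<close> are sequences of distinct variables
  of the sorts \<open>\<beta>ss ! length \<Delta>\<close>. The side condition on \<open>zs\<close> is the only one imposed: \<open>zs\<close> need not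
  be distinct, and bound occurrences of its members in \<open>b\<^sub>1\<close>, \<open>b\<^sub>2\<close> are not excluded.\<close>

inductive_set axioms :: "('srt, 's) signature \<Rightarrow> 's expr set"
  for S :: "('srt, 's) signature" where
  Taut: "tautology S \<phi> \<Longrightarrow> \<phi> \<in> axioms S"
| AllE: "\<lbrakk> x \<in> vars S \<xi>; a \<in> Exprs S \<xi>; \<phi> \<in> Formulas S; Subb S a x \<phi> \<rbrakk>
    \<Longrightarrow> Imp S (Forall S x \<phi>) (subst [x] [a] \<phi>) \<in> axioms S"
| ExI: "\<lbrakk> x \<in> vars S \<xi>; a \<in> Exprs S \<xi>; \<phi> \<in> Formulas S; Subb S a x \<phi> \<rbrakk>
    \<Longrightarrow> Imp S (subst [x] [a] \<phi>) (Exists S x \<phi>) \<in> axioms S"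
| AllI: "\<lbrakk> x \<in> VAR S; \<phi> \<in> Formulas S; \<psi> \<in> Formulas S; x \<notin> fv S \<psi> \<rbrakk>
    \<Longrightarrow> Imp S (Forall S x (Imp S \<psi> \<phi>)) (Imp S \<psi> (Forall S x \<phi>)) \<in> axioms S"
| ExE: "\<lbrakk> x \<in> VAR S; \<phi> \<in> Formulas S; \<psi> \<in> Formulas S; x \<notin> fv S \<psi> \<rbrakk>
    \<Longrightarrow> Imp S (Forall S x (Imp S \<phi> \<psi>)) (Imp S (Exists S x \<phi>) \<psi>) \<in> axioms S"
| I1: "\<lbrakk> \<gamma> \<in> SRT S; a \<in> Exprs S \<gamma> \<rbrakk> \<Longrightarrow> Eq S \<gamma> a a \<in> axioms S"
| I2: "\<lbrakk> f \<in> SOP S; sig S f = (\<gamma>, \<alpha>s, \<beta>ss);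
      Op f (\<Delta> @ (xs, b\<^sub>1) # \<Gamma>) \<in> Exprs S \<gamma>; Op f (\<Delta> @ (ys, b\<^sub>2) # \<Gamma>) \<in> Exprs S \<gamma>;
      zs \<in> var_seqs S (\<beta>ss ! length \<Delta>); set zs \<inter> (fv S b\<^sub>1 \<union> fv S b\<^sub>2) = {} \<rbrakk>
    \<Longrightarrow> Imp S
          (Foralls S zs (Eq S (\<alpha>s ! length \<Delta>)
             (subst xs (map Var zs) b\<^sub>1) (subst ys (map Var zs) b\<^sub>2)))
          (Eq S \<gamma> (Op f (\<Delta> @ (xs, b\<^sub>1) # \<Gamma>)) (Op f (\<Delta> @ (ys, b\<^sub>2) # \<Gamma>))) \<in> axioms S"

inductive derivable :: "('srt, 's) signature \<Rightarrow> 's expr set \<Rightarrow> 's expr \<Rightarrow> bool"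
  for S :: "('srt, 's) signature" and T :: "'s expr set" where
  Axiom: "\<phi> \<in> axioms S \<Longrightarrow> derivable S T \<phi>"
| Assumption: "\<phi> \<in> T \<Longrightarrow> derivable S T \<phi>"
| ModusPonens: "\<lbrakk> derivable S T \<phi>; derivable S T (Imp S \<phi> \<psi>) \<rbrakk> \<Longrightarrow> derivable S T \<psi>"
| Generalization: "\<lbrakk> derivable S T \<phi>; x \<in> VAR S \<rbrakk> \<Longrightarrow> derivable S T (Forall S x \<phi>)"


section \<open>Structures\<close>

text \<open>Sequences are lists, and a function on \<open>M\<^bsub>\<sigma>\<^esub>\<close> is a function on lists that is \<^const>\<open>undefined\<close>
  outside \<open>M\<^bsub>\<sigma>\<^esub>\<close> (\<^term>\<open>extensional\<close>). An element \<open>w\<close> of a domain is identified with the function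
  of zero arguments \<open>const w\<close>, so that the arguments of an operation all have the same type. The
  values of \<^term>\<open>fun_dom M \<gamma> \<sigma>s\<close> and \<^term>\<open>op_int M f hs\<close> at arguments that are not
  well-sorted are irrelevant.\<close>

record ('srt, 's, 'u) struct =
  dom_of :: "'srt \<Rightarrow> 'u set"
  fun_dom :: "'srt \<Rightarrow> 'srt list \<Rightarrow> ('u list \<Rightarrow> 'u) set"
  op_int :: "'s \<Rightarrow> ('u list \<Rightarrow> 'u) list \<Rightarrow> 'u"

definition seqs :: "('srt, 's, 'u) struct \<Rightarrow> 'srt list \<Rightarrow> 'u list set" where
  "seqs M \<sigma>s = {xs. list_all2 (\<lambda>x \<alpha>. x \<in> dom_of M \<alpha>) xs \<sigma>s}"

definition const :: "'u \<Rightarrow> 'u list \<Rightarrow> 'u" where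
  "const w = (\<lambda>_ \<in> {[]}. w)"

definition arg_seqs ::
  "('srt, 's, 'u) struct \<Rightarrow> 'srt list \<Rightarrow> 'srt list list \<Rightarrow> ('u list \<Rightarrow> 'u) list set" where
  "arg_seqs M \<alpha>s \<beta>ss =
     {hs. length hs = length \<alpha>s \<and> (\<forall>i < length \<alpha>s. hs ! i \<in> fun_dom M (\<alpha>s ! i) (\<beta>ss ! i))}"

definition truth :: "('srt, 's) signature \<Rightarrow> ('srt, 's, 'u) struct \<Rightarrow> bool \<Rightarrow> 'u" where
  "truth S M p = (if p then op_int M (top_sym S) [] else op_int M (bot_sym S) [])"

definition is_structure :: "('srt, 's) signature \<Rightarrow> ('srt, 's, 'u) struct \<Rightarrow> bool" where
  "is_structure S M \<longleftrightarrow>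
     (\<forall>\<alpha> \<in> SRT S. dom_of M \<alpha> \<noteq> {}) \<and>
     (\<forall>\<gamma> \<in> SRT S. fun_dom M \<gamma> [] = const ` dom_of M \<gamma>) \<and>
     (\<forall>\<gamma> \<in> SRT S. \<forall>\<sigma>s \<in> lists (VSRT S). \<sigma>s \<noteq> [] \<longrightarrow>
        fun_dom M \<gamma> \<sigma>s \<subseteq> seqs M \<sigma>s \<rightarrow>\<^sub>E dom_of M \<gamma>) \<and>
     (\<forall>f \<in> SOP S. \<forall>\<gamma> \<alpha>s \<beta>ss. sig S f = (\<gamma>, \<alpha>s, \<beta>ss) \<longrightarrow>
        op_int M f \<in> arg_seqs M \<alpha>s \<beta>ss \<rightarrow> dom_of M \<gamma>) \<and>
     \<comment> \<open>constants\<close>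
     (\<forall>\<gamma> \<in> SRT S. \<forall>\<sigma>s \<in> lists (VSRT S). \<sigma>s \<noteq> [] \<longrightarrow>
        (\<forall>w \<in> dom_of M \<gamma>. (\<lambda>_ \<in> seqs M \<sigma>s. w) \<in> fun_dom M \<gamma> \<sigma>s)) \<and>
     \<comment> \<open>projections\<close>
     (\<forall>\<sigma>s \<in> lists (VSRT S). \<forall>j < length \<sigma>s.
        (\<lambda>xs \<in> seqs M \<sigma>s. xs ! j) \<in> fun_dom M (\<sigma>s ! j) \<sigma>s) \<and>
     \<comment> \<open>partial fixing\<close>
     (\<forall>\<gamma> \<in> SRT S. \<forall>\<sigma>s \<in> lists (VSRT S). \<forall>\<rho>s \<in> lists (VSRT S).
        \<forall>g \<in> fun_dom M \<gamma> (\<sigma>s @ \<rho>s). \<forall>xs \<in> seqs M \<sigma>s.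
          (\<lambda>rs \<in> seqs M \<rho>s. g (xs @ rs)) \<in> fun_dom M \<gamma> \<rho>s) \<and>
     \<comment> \<open>composition\<close>
     (\<forall>f \<in> SOP S. \<forall>\<gamma> \<alpha>s \<beta>ss. sig S f = (\<gamma>, \<alpha>s, \<beta>ss) \<longrightarrow> \<alpha>s \<noteq> [] \<longrightarrow>
        (\<forall>\<sigma>s \<in> lists (VSRT S). \<sigma>s \<noteq> [] \<longrightarrow>
          (\<forall>gs \<in> arg_seqs M \<alpha>s (map (\<lambda>\<beta>s. \<sigma>s @ \<beta>s) \<beta>ss).
            (\<lambda>ys \<in> seqs M \<sigma>s.
               op_int M f (map2 (\<lambda>g \<beta>s. \<lambda>rs \<in> seqs M \<beta>s. g (ys @ rs)) gs \<beta>ss))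
            \<in> fun_dom M \<gamma> \<sigma>s))) \<and>
     \<comment> \<open>logical symbols\<close>
     truth S M False \<noteq> truth S M True \<and>
     dom_of M (form_sort S) = {truth S M False, truth S M True} \<and>
     (\<forall>p. op_int M (neg_sym S) [const (truth S M p)] = truth S M (\<not> p)) \<and>
     (\<forall>p q. op_int M (con_sym S) [const (truth S M p), const (truth S M q)] = truth S M (p \<and> q)) \<and>
     (\<forall>p q. op_int M (dis_sym S) [const (truth S M p), const (truth S M q)] = truth S M (p \<or> q)) \<and>
     (\<forall>p q. op_int M (imp_sym S) [const (truth S M p), const (truth S M q)] = truth S M (p \<longrightarrow> q)) \<and>
     (\<forall>p q. op_int M (iff_sym S) [const (truth S M p), const (truth S M q)] = truth S M (p \<longleftrightarrow> q)) \<and>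
     (\<forall>\<alpha> \<in> VSRT S. \<forall>\<theta> \<in> fun_dom M (form_sort S) [\<alpha>].
        op_int M (all_sym S \<alpha>) [\<theta>] = truth S M (\<forall>x \<in> dom_of M \<alpha>. \<theta> [x] = truth S M True) \<and>
        op_int M (ex_sym S \<alpha>) [\<theta>] = truth S M (\<exists>x \<in> dom_of M \<alpha>. \<theta> [x] = truth S M True)) \<and>
     (\<forall>\<alpha> \<in> SRT S. \<forall>x \<in> dom_of M \<alpha>. \<forall>y \<in> dom_of M \<alpha>.
        op_int M (eq_sym S \<alpha>) [const x, const y] = truth S M (x = y))"

text \<open>\<open>interp S M us e\<close> is \<open>e\<^sub>M(us)\<close>, for \<open>us\<close> containing the free variables of \<open>e\<close>.\<close>

fun interp ::
  "('srt, 's) signature \<Rightarrow> ('srt, 's, 'u) struct \<Rightarrow> 's list \<Rightarrow> 's expr \<Rightarrow> 'u list \<Rightarrow> 'u" where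
  "interp S M us (Op f args) =
     (\<lambda>xs \<in> seqs M (map (sort_of S) us).
        if args = [] \<and> f \<in> VAR S then the (last_assoc us xs f)
        else op_int M f
          (map (\<lambda>(vs, a). \<lambda>ys \<in> seqs M (map (sort_of S) vs). interp S M (us @ vs) a (xs @ ys)) args))"

definition satisfies ::
  "('srt, 's) signature \<Rightarrow> ('srt, 's, 'u) struct \<Rightarrow> 's expr \<Rightarrow> bool" where
  "satisfies S M \<phi> \<longleftrightarrow>
     (\<forall>us \<in> lists (VAR S). fv S \<phi> \<subseteq> set us \<longrightarrow>
        (\<forall>xs \<in> seqs M (map (sort_of S) us). interp S M us \<phi> xs = truth S M True))"

end

(* Henkin's construction. The language gets a constant for every existential formula in one free
   variable, including those containing such constants. Adding the axioms "if some x satisfies phi,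
   then its witness does" is conservative: in a derivation, the largest witness constant used occurs
   in no other assumption, so it can be replaced by a fresh variable and its axiom eliminated. A
   maximal consistent extension yields a model of closed expressions modulo provable equality, the
   function spaces being the functions that expressions induce by substitution of closed expressions.
   An operation with bound variables is well defined on these functions by axiom I2: if two
   expressions induce the same function, then the universal closure of their equality is derivable,
   because a counterexample would be witnessed by closed expressions. *)

theory Submission
  imports Defs
begin

section \<open>Variables and substitution\<close>

text \<open>Generalization is unrestricted and \<open>T\<close> may contain open formulas, so the
  deduction theorem holds for closed hypotheses only. Completeness is therefore asked of closed
  formulas, and \<open>\<phi>\<close> is replaced by its universal closure. \<open>subst\<close>
  looks up every leaf symbol by name, constants included. A change of language that turns a constant
  into a variable can thus disturb substitutions and cause captures. All such changes are instances
  of one notion of renaming, and every derivation comes with a finite set of variables that the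
  images of constants have to avoid. Sorts outside \<open>VSRT S\<close> may have no expressions at
  all, although their domains must be nonempty. In the term model such a sort gets one filler
  element, and an operation with an argument of such a sort is constant. Sorts with variables are
  never empty, because \<open>\<exists>x \<top>\<close> has a witness. The universe
  \<open>'u\<close> is given in advance, so expressions, with witness constants nested in them to
  any depth, are coded into it by a pairing function; this is where its infinity enters.\<close>

lemma expr_induct [case_names Op]:
  "(\<And>f args. (\<And>vs a. (vs, a) \<in> set args \<Longrightarrow> P a) \<Longrightarrow> P (Op f args)) \<Longrightarrow> P e"
  by (rule expr.induct) (metis snds.intros snd_conv)

text \<open>Unlike \<^const>\<open>fv\<close>, \<open>frs\<close> also collects the constants, since \<^const>\<open>subst\<close> looks up every
  leaf symbol.\<close>

fun frs :: "'s expr \<Rightarrow> 's set" where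
  "frs (Op f args) = (if args = [] then {f} else (\<Union>(vs, a) \<in> set args. frs a - set vs))"

fun gv :: "'s expr \<Rightarrow> 's set" where
  "gv (Op f args) = (\<Union>(vs, a) \<in> set args. set vs \<union> gv a)"

text \<open>\<open>subst\<close> extends both of its lists at every binder. With an assignment on
  symbols instead, substitutions can be compared and composed pointwise on the symbols in
  \<open>frs\<close>.\<close>

fun fsub :: "('s \<Rightarrow> 's expr) \<Rightarrow> 's expr \<Rightarrow> 's expr" where
  "fsub \<sigma> (Op f args) =
     (if args = [] then \<sigma> f
      else Op f (map (\<lambda>(vs, a). (vs, fsub (\<lambda>x. if x \<in> set vs then Var x else \<sigma> x) a)) args))"

definition bind :: "'s list \<Rightarrow> 's expr list \<Rightarrow> 's \<Rightarrow> 's expr" where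
  "bind xs ds x = (case last_assoc xs ds x of Some d \<Rightarrow> d | None \<Rightarrow> Var x)"

lemma fv_eq_frs: "fv S e = frs e \<inter> VAR S"
proof (induction e rule: expr_induct)
  case (Op f args)
  show ?case
  proof (cases "args = []")
    case False
    have "(\<Union>(vs, a) \<in> set args. fv S a - set vs) = (\<Union>(vs, a) \<in> set args. (frs a - set vs) \<inter> VAR S)"
      by (rule SUP_cong) (auto simp: Op)
    then show ?thesis using False by auto
  qed simp
qed

lemma set_expr_Op: "set_expr (Op f args) = insert f (\<Union>(vs, a) \<in> set args. set vs \<union> set_expr a)"
  by fastforce

lemma frs_subset_set_expr: "frs e \<subseteq> set_expr e"
  by (induction e rule: expr_induct) (fastforce simp: set_expr_Op simp del: expr.set split: if_splits)

lemma gv_subset_set_expr: "gv e \<subseteq> set_expr e"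
  by (induction e rule: expr_induct) (fastforce simp: set_expr_Op simp del: expr.set)

lemma finite_set_expr [simp]: "finite (set_expr e)"
  by (induction e rule: expr_induct) (auto simp: set_expr_Op simp del: expr.set)

section \<open>Lookup in a list substitution, and substitution along an assignment\<close>

lemma last_assoc_append:
  "length xs = length ds \<Longrightarrow> length vs = length es \<Longrightarrow>
   last_assoc (xs @ vs) (ds @ es) x =
     (case last_assoc vs es x of Some d \<Rightarrow> Some d | None \<Rightarrow> last_assoc xs ds x)"
  by (simp add: last_assoc_def map_add_def split: option.splits)

lemma last_assoc_None_iff: "length xs = length ds \<Longrightarrow> last_assoc xs ds x = None \<longleftrightarrow> x \<notin> set xs"
  using set_map[of fst "zip xs ds"] by (simp add: last_assoc_def map_of_eq_None_iff)

lemma last_assoc_SomeD: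
  assumes "last_assoc xs ds x = Some d" "length xs = length ds"
  shows "\<exists>k < length xs. xs ! k = x \<and> ds ! k = d"
proof -
  have "(x, d) \<in> set (zip xs ds)"
    using map_of_SomeD[OF assms(1)[unfolded last_assoc_def]] by simp
  then show ?thesis using assms(2) by (auto simp: set_zip)
qed

lemma last_assoc_map: "last_assoc xs (map g ds) x = map_option g (last_assoc xs ds x)"
proof -
  have "rev (zip xs (map g ds)) = map (\<lambda>(k, v). (k, g v)) (rev (zip xs ds))"
    unfolding zip_map2 rev_map by simp
  then show ?thesis unfolding last_assoc_def by (simp only: map_of_map comp_def)
qed

lemma last_assoc_map_self: "last_assoc vs (map g vs) x = (if x \<in> set vs then Some (g x) else None)"
  by (induction vs rule: rev_induct)
    (auto simp: last_assoc_append, auto simp: last_assoc_def)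

lemma last_assoc_nth:
  assumes "distinct xs" "length xs = length ds" "k < length xs"
  shows "last_assoc xs ds (xs ! k) = Some (ds ! k)"
proof -
  obtain d where d: "last_assoc xs ds (xs ! k) = Some d"
    using last_assoc_None_iff[of xs ds "xs ! k"] assms by (cases "last_assoc xs ds (xs ! k)") auto
  with last_assoc_SomeD[OF d] assms show ?thesis by (metis nth_eq_iff_index_eq)
qed

lemma bind_notin: "length xs = length ds \<Longrightarrow> x \<notin> set xs \<Longrightarrow> bind xs ds x = Var x"
  using last_assoc_None_iff[of xs ds x] by (simp add: bind_def)

text \<open>The position that counts depends on \<open>xs\<close> and \<open>x\<close> alone, so one
  index serves several replacement lists. It is found by looking \<open>x\<close> up among the
  indices themselves, of which any other list \<open>ds\<close> is the image under
  \<open>(!) ds\<close>.\<close>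

lemma bind_index:
  assumes "x \<in> set xs"
  obtains k where "k < length xs" "xs ! k = x" "\<And>ds. length ds = length xs \<Longrightarrow> bind xs ds x = ds ! k"
proof -
  obtain k where k: "last_assoc xs [0..<length xs] x = Some k"
    using assms last_assoc_None_iff[of xs "[0..<length xs]" x] by fastforce
  have "k < length xs" "xs ! k = x" using last_assoc_SomeD[OF k] by auto
  moreover have "bind xs ds x = ds ! k" if "length ds = length xs" for ds
  proof -
    have "bind xs (map ((!) ds) [0..<length xs]) x = ds ! k"
      unfolding bind_def last_assoc_map k by simp
    moreover have "map ((!) ds) [0..<length xs] = ds" using that by (metis map_nth)
    ultimately show ?thesis by simp
  qed
  ultimately show ?thesis using that by blast
qed

lemma bind_in: "length xs = length ds \<Longrightarrow> x \<in> set xs \<Longrightarrow> \<exists>k < length xs. xs ! k = x \<and> bind xs ds x = ds ! k"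
  by (metis bind_index)

lemma bind_append:
  "length xs = length ds \<Longrightarrow> length vs = length es \<Longrightarrow>
   bind (xs @ vs) (ds @ es) x = (if x \<in> set vs then bind vs es x else bind xs ds x)"
  using last_assoc_None_iff[of vs es x] by (auto simp: bind_def last_assoc_append split: option.splits)

lemma bind_map: "bind vs (map g vs) x = (if x \<in> set vs then g x else Var x)"
  by (simp add: bind_def last_assoc_map_self)

lemma bind_nth: "distinct xs \<Longrightarrow> length xs = length ds \<Longrightarrow> k < length xs \<Longrightarrow> bind xs ds (xs ! k) = ds ! k"
  by (simp add: bind_def last_assoc_nth)

lemma bind_single [simp]: "bind [x] [d] y = (if y = x then d else Var y)"
  by (simp add: bind_def last_assoc_def)

lemma subst_eq_fsub: "length xs = length ds \<Longrightarrow> subst xs ds e = fsub (bind xs ds) e"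
proof (induction e arbitrary: xs ds rule: expr_induct)
  case (Op f args)
  have "subst (xs @ vs) (ds @ map Var vs) a = fsub (\<lambda>x. if x \<in> set vs then Var x else bind xs ds x) a"
    if "(vs, a) \<in> set args" for vs a
    using Op.IH[OF that, of "xs @ vs" "ds @ map Var vs"] Op.prems
    by (simp add: bind_append bind_map[of _ Var] cong: if_cong)
  then show ?case by (cases "args = []") (auto simp: bind_def[of xs ds f])
qed

lemma fsub_cong: "(\<And>x. x \<in> frs e \<Longrightarrow> \<sigma> x = \<tau> x) \<Longrightarrow> fsub \<sigma> e = fsub \<tau> e"
proof (induction e arbitrary: \<sigma> \<tau> rule: expr_induct)
  case (Op f args)
  have "fsub (\<lambda>x. if x \<in> set vs then Var x else \<sigma> x) a = fsub (\<lambda>x. if x \<in> set vs then Var x else \<tau> x) a"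
    if "(vs, a) \<in> set args" for vs a
  proof (rule Op.IH[OF that])
    fix x assume "x \<in> frs a"
    then have "x \<notin> set vs \<Longrightarrow> x \<in> frs (Op f args)" using that by auto
    then show "(if x \<in> set vs then Var x else \<sigma> x) = (if x \<in> set vs then Var x else \<tau> x)"
      using Op.prems by simp
  qed
  then show ?case using Op.prems by auto
qed

lemma fsub_Var [simp]: "fsub Var e = e"
  by (induction e rule: expr_induct) (auto intro!: map_idI)

lemma fsub_id: "(\<And>x. x \<in> frs e \<Longrightarrow> \<sigma> x = Var x) \<Longrightarrow> fsub \<sigma> e = e"
  using fsub_cong[of e \<sigma> Var] by simp

text \<open>Below a binder the second assignment is blocked on the bound variables; an inserted
  expression free of these symbols does not notice. A symbol left in place may be bound elsewhere in
  \<open>e\<close>, which accommodates everything outside the domain of a list substitution.\<close>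

lemma fsub_fsub:
  assumes "\<And>x. x \<in> frs e \<Longrightarrow> \<sigma> x = Var x \<or> frs (\<sigma> x) \<inter> gv e = {}"
  shows "fsub \<tau> (fsub \<sigma> e) = fsub (\<lambda>x. fsub \<tau> (\<sigma> x)) e"
  using assms
proof (induction e arbitrary: \<sigma> \<tau> rule: expr_induct)
  case (Op f args)
  have "fsub (\<lambda>x. if x \<in> set vs then Var x else \<tau> x) (fsub (\<lambda>x. if x \<in> set vs then Var x else \<sigma> x) a)
      = fsub (\<lambda>x. if x \<in> set vs then Var x else fsub \<tau> (\<sigma> x)) a"
    if m: "(vs, a) \<in> set args" for vs a
  proof -
    have *: "\<sigma> x = Var x \<or> frs (\<sigma> x) \<inter> (set vs \<union> gv a) = {}" if "x \<in> frs a - set vs" for x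
    proof -
      have "x \<in> frs (Op f args)" "set vs \<union> gv a \<subseteq> gv (Op f args)" using that m by auto
      then show ?thesis using Op.prems[of x] by blast
    qed
    have "fsub (\<lambda>x. if x \<in> set vs then Var x else \<tau> x) (fsub (\<lambda>x. if x \<in> set vs then Var x else \<sigma> x) a)
      = fsub (\<lambda>x. fsub (\<lambda>x. if x \<in> set vs then Var x else \<tau> x) (if x \<in> set vs then Var x else \<sigma> x)) a"
      by (rule Op.IH[OF m]) (use * in auto)
    also have "\<dots> = fsub (\<lambda>x. if x \<in> set vs then Var x else fsub \<tau> (\<sigma> x)) a"
    proof (rule fsub_cong)
      fix x assume x: "x \<in> frs a"
      show "fsub (\<lambda>x. if x \<in> set vs then Var x else \<tau> x) (if x \<in> set vs then Var x else \<sigma> x) =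
        (if x \<in> set vs then Var x else fsub \<tau> (\<sigma> x))"
        using *[of x] x by (auto intro!: fsub_cong)
    qed
    finally show ?thesis .
  qed
  then show ?case by auto
qed

lemma frs_fsub: "frs (fsub \<sigma> e) \<subseteq> (\<Union>x \<in> frs e. frs (\<sigma> x))"
proof (induction e arbitrary: \<sigma> rule: expr_induct)
  case (Op f args)
  have "frs (fsub (\<lambda>x. if x \<in> set vs then Var x else \<sigma> x) a) - set vs \<subseteq> (\<Union>x \<in> frs (Op f args). frs (\<sigma> x))"
    if m: "(vs, a) \<in> set args" for vs a
  proof
    fix y assume "y \<in> frs (fsub (\<lambda>x. if x \<in> set vs then Var x else \<sigma> x) a) - set vs"
    then obtain x where "x \<in> frs a" "y \<in> frs (if x \<in> set vs then Var x else \<sigma> x)" "y \<notin> set vs"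
      using Op.IH[OF m] by blast
    then have "x \<in> frs a - set vs" "y \<in> frs (\<sigma> x)" by (auto split: if_splits)
    then show "y \<in> (\<Union>x \<in> frs (Op f args). frs (\<sigma> x))" using m by auto
  qed
  note * = this
  show ?case
  proof (cases "args = []")
    case False
    then have "frs (fsub \<sigma> (Op f args)) =
        (\<Union>(vs, a) \<in> set args. frs (fsub (\<lambda>x. if x \<in> set vs then Var x else \<sigma> x) a) - set vs)"
      by (simp add: split_beta)
    also have "\<dots> \<subseteq> (\<Union>x \<in> frs (Op f args). frs (\<sigma> x))"
      by (rule UN_least) (use * in \<open>simp add: split_beta del: frs.simps UN_simps\<close>)
    finally show ?thesis .
  qed simp
qed

lemma subst_subst:
  assumes "length xs = length ds" "length ys = length es"
    and "\<And>x. x \<in> frs e \<Longrightarrow> bind xs ds x = Var x \<or> frs (bind xs ds x) \<inter> gv e = {}"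
  shows "subst ys es (subst xs ds e) = fsub (\<lambda>x. fsub (bind ys es) (bind xs ds x)) e"
  using assms by (simp add: subst_eq_fsub fsub_fsub)

lemma subst_same [simp]: "subst vs (map Var vs) e = e"
  by (simp add: subst_eq_fsub fsub_id bind_map)

lemma subst_Nil [simp]: "subst [] [] e = e"
  using subst_same[of "[]" e] by simp

lemma subst_Op:
  "args \<noteq> [] \<Longrightarrow> subst xs ds (Op f args) =
     Op f (map (\<lambda>(vs, a). (vs, subst (xs @ vs) (ds @ map Var vs) a)) args)"
  by simp

declare subst.simps [simp del] fsub.simps [simp del]

lemma Subb_closed: "fv S d = {} \<Longrightarrow> Subb S d x e"
  by (induction e rule: expr_induct) auto

lemma Subb_self: "Subb S (Var x) x e"
  by (induction e rule: expr_induct) auto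


section \<open>Well-formed expressions\<close>

definition args_ok :: "('srt, 's) signature \<Rightarrow> 'srt list \<Rightarrow> 'srt list list \<Rightarrow> ('s list \<times> 's expr) list \<Rightarrow> bool" where
  "args_ok S \<alpha>s \<beta>ss args \<longleftrightarrow> length args = length \<alpha>s \<and>
     (\<forall>i < length \<alpha>s. fst (args ! i) \<in> var_seqs S (\<beta>ss ! i) \<and> distinct (fst (args ! i)) \<and>
       snd (args ! i) \<in> Exprs S (\<alpha>s ! i))"

lemma Op_in_Exprs_iff:
  "Op f args \<in> Exprs S \<gamma> \<longleftrightarrow> f \<in> SOP S \<union> VAR S \<and> fst (sig S f) = \<gamma> \<and>
     args_ok S (fst (snd (sig S f))) (snd (snd (sig S f))) args"
proof
  assume "Op f args \<in> Exprs S \<gamma>"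
  then have "(\<gamma>, Op f args) \<in> Expr S" by (simp add: Exprs_def)
  then show "f \<in> SOP S \<union> VAR S \<and> fst (sig S f) = \<gamma> \<and>
     args_ok S (fst (snd (sig S f))) (snd (snd (sig S f))) args"
    by cases (auto simp: args_ok_def Exprs_def)
next
  assume "f \<in> SOP S \<union> VAR S \<and> fst (sig S f) = \<gamma> \<and>
     args_ok S (fst (snd (sig S f))) (snd (snd (sig S f))) args"
  then show "Op f args \<in> Exprs S \<gamma>"
    unfolding Exprs_def mem_Collect_eq
    by (intro Expr.OpI[of f S \<gamma> "fst (snd (sig S f))" "snd (snd (sig S f))"]) (auto simp: args_ok_def Exprs_def)
qed

lemma var_seqs_conv_map: "vs \<in> var_seqs S \<sigma>s \<longleftrightarrow> set vs \<subseteq> VAR S \<and> map (sort_of S) vs = \<sigma>s"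
  by (induction vs arbitrary: \<sigma>s) (auto simp: var_seqs_def vars_def list_all2_Cons1)

definition closed :: "('srt, 's) signature \<Rightarrow> 'srt \<Rightarrow> 's expr set" where
  "closed S \<gamma> = {e \<in> Exprs S \<gamma>. fv S e = {}}"

definition closeds :: "('srt, 's) signature \<Rightarrow> 's list \<Rightarrow> 's expr list \<Rightarrow> bool" where
  "closeds S vs ts \<longleftrightarrow> list_all2 (\<lambda>x t. t \<in> closed S (sort_of S x)) vs ts"

section \<open>Signatures, sorts and well-formed formulas\<close>

locale sgn =
  fixes S :: "('srt, 's) signature"
  assumes sgn: "is_signature S"
begin

abbreviation F where "F \<equiv> Formulas S"
abbreviation \<pi> where "\<pi> \<equiv> form_sort S"

lemma sig_wf:
  assumes "f \<in> SOP S \<union> VAR S" "sig S f = (\<gamma>, \<alpha>s, \<beta>ss)"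
  shows "\<gamma> \<in> SRT S" "set \<alpha>s \<subseteq> SRT S" "length \<beta>ss = length \<alpha>s" "\<And>\<beta>s. \<beta>s \<in> set \<beta>ss \<Longrightarrow> set \<beta>s \<subseteq> VSRT S"
  using sgn assms unfolding is_signature_def by blast+

lemma VSRT_SRT: "VSRT S \<subseteq> SRT S" and \<pi>_SRT: "\<pi> \<in> SRT S" and disj: "SOP S \<inter> VAR S = {}"
  using sgn unfolding is_signature_def by blast+

lemma sig_VAR: "x \<in> VAR S \<Longrightarrow> sort_of S x \<in> VSRT S \<and> snd (sig S x) = ([], [])"
  using sgn unfolding is_signature_def by force

lemma infinite_vars: "\<alpha> \<in> VSRT S \<Longrightarrow> infinite (vars S \<alpha>)"
  using sgn unfolding is_signature_def by blast

lemma sym_sigs: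
  "top_sym S \<in> SOP S" "sig S (top_sym S) = (\<pi>, [], [])"
  "bot_sym S \<in> SOP S" "sig S (bot_sym S) = (\<pi>, [], [])"
  "neg_sym S \<in> SOP S" "sig S (neg_sym S) = (\<pi>, [\<pi>], [[]])"
  "imp_sym S \<in> SOP S" "sig S (imp_sym S) = (\<pi>, [\<pi>, \<pi>], [[], []])"
  "con_sym S \<in> SOP S" "sig S (con_sym S) = (\<pi>, [\<pi>, \<pi>], [[], []])"
  "dis_sym S \<in> SOP S" "sig S (dis_sym S) = (\<pi>, [\<pi>, \<pi>], [[], []])"
  "iff_sym S \<in> SOP S" "sig S (iff_sym S) = (\<pi>, [\<pi>, \<pi>], [[], []])"
  "\<alpha> \<in> VSRT S \<Longrightarrow> all_sym S \<alpha> \<in> SOP S" "\<alpha> \<in> VSRT S \<Longrightarrow> sig S (all_sym S \<alpha>) = (\<pi>, [\<pi>], [[\<alpha>]])"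
  "\<alpha> \<in> VSRT S \<Longrightarrow> ex_sym S \<alpha> \<in> SOP S" "\<alpha> \<in> VSRT S \<Longrightarrow> sig S (ex_sym S \<alpha>) = (\<pi>, [\<pi>], [[\<alpha>]])"
  "\<gamma> \<in> SRT S \<Longrightarrow> eq_sym S \<gamma> \<in> SOP S" "\<gamma> \<in> SRT S \<Longrightarrow> sig S (eq_sym S \<gamma>) = (\<pi>, [\<gamma>, \<gamma>], [[], []])"
  "eq_sym S \<pi> = iff_sym S"
  using sgn unfolding is_signature_def by auto

lemma Eq_form [simp]: "Eq S \<pi> a b = Iff S a b"
  by (simp add: Eq_def Iff_def sym_sigs)

lemma F_intros [simp, intro]:
  "Top S \<in> F" "Bot S \<in> F"
  "a \<in> F \<Longrightarrow> Neg S a \<in> F"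
  "a \<in> F \<Longrightarrow> b \<in> F \<Longrightarrow> Imp S a b \<in> F"
  "a \<in> F \<Longrightarrow> b \<in> F \<Longrightarrow> Con S a b \<in> F"
  "a \<in> F \<Longrightarrow> b \<in> F \<Longrightarrow> Dis S a b \<in> F"
  "a \<in> F \<Longrightarrow> b \<in> F \<Longrightarrow> Iff S a b \<in> F"
  "x \<in> VAR S \<Longrightarrow> a \<in> F \<Longrightarrow> Forall S x a \<in> F"
  "x \<in> VAR S \<Longrightarrow> a \<in> F \<Longrightarrow> Exists S x a \<in> F"
  "\<gamma> \<in> SRT S \<Longrightarrow> c \<in> Exprs S \<gamma> \<Longrightarrow> d \<in> Exprs S \<gamma> \<Longrightarrow> Eq S \<gamma> c d \<in> F"
  unfolding Top_def Bot_def Neg_def Imp_def Con_def Dis_def Iff_def Forall_def Exists_def Eq_def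
  by (auto simp: Op_in_Exprs_iff sym_sigs args_ok_def var_seqs_conv_map nth_Cons sig_VAR split: nat.splits)

lemma Foralls_F [simp, intro]: "set xs \<subseteq> VAR S \<Longrightarrow> a \<in> F \<Longrightarrow> Foralls S xs a \<in> F"
  unfolding Foralls_def by (induction xs) auto

lemma Imp_FD: "Imp S a b \<in> F \<Longrightarrow> a \<in> F \<and> b \<in> F"
  unfolding Imp_def by (fastforce simp: Op_in_Exprs_iff sym_sigs args_ok_def less_Suc_eq)

lemma fv_simps [simp]:
  "fv S (Top S) = {}" "fv S (Bot S) = {}" "fv S (Neg S a) = fv S a"
  "fv S (Imp S a b) = fv S a \<union> fv S b" "fv S (Con S a b) = fv S a \<union> fv S b"
  "fv S (Dis S a b) = fv S a \<union> fv S b" "fv S (Iff S a b) = fv S a \<union> fv S b"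
  "fv S (Forall S x a) = fv S a - {x}" "fv S (Exists S x a) = fv S a - {x}"
  "fv S (Eq S \<gamma> c d) = fv S c \<union> fv S d"
  using disj sym_sigs(1,3) unfolding Top_def Bot_def Neg_def Imp_def Con_def Dis_def Iff_def Forall_def Exists_def Eq_def
  by auto

lemma fv_Foralls [simp]: "fv S (Foralls S xs a) = fv S a - set xs"
  unfolding Foralls_def by (induction xs) auto

lemma Expr_SRT: "e \<in> Exprs S \<gamma> \<Longrightarrow> \<gamma> \<in> SRT S"
  by (cases e) (metis Op_in_Exprs_iff prod.collapse sig_wf(1))

lemma Var_Exprs [simp]: "x \<in> VAR S \<Longrightarrow> Var x \<in> Exprs S \<gamma> \<longleftrightarrow> \<gamma> = sort_of S x"
  by (auto simp: Op_in_Exprs_iff args_ok_def sig_VAR)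

lemma arg_Exprs:
  assumes "Op f args \<in> Exprs S \<gamma>" "(vs, a) \<in> set args"
  shows "set vs \<subseteq> VAR S" "distinct vs" "\<exists>\<alpha>. a \<in> Exprs S \<alpha>" "f \<in> SOP S"
proof -
  obtain i where i: "i < length args" "args ! i = (vs, a)" using assms(2) by (auto simp: in_set_conv_nth)
  have "args_ok S (fst (snd (sig S f))) (snd (snd (sig S f))) args" "f \<in> SOP S \<union> VAR S"
    using assms(1) by (auto simp: Op_in_Exprs_iff)
  then show "set vs \<subseteq> VAR S" "distinct vs" "\<exists>\<alpha>. a \<in> Exprs S \<alpha>"
  proof -
    assume ok: "args_ok S (fst (snd (sig S f))) (snd (snd (sig S f))) args"
    then have "i < length (fst (snd (sig S f)))" using i by (simp add: args_ok_def)
    then have "fst (args ! i) \<in> var_seqs S (snd (snd (sig S f)) ! i) \<and> distinct (fst (args ! i)) \<and>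
      snd (args ! i) \<in> Exprs S (fst (snd (sig S f)) ! i)"
      using ok unfolding args_ok_def by blast
    then show "set vs \<subseteq> VAR S" "distinct vs" "\<exists>\<alpha>. a \<in> Exprs S \<alpha>" by (auto simp: var_seqs_conv_map i(2))
  qed
  show "f \<in> SOP S" using \<open>f \<in> SOP S \<union> VAR S\<close> \<open>args_ok _ _ _ _\<close> sig_VAR[of f] i(1)
    by (auto simp: args_ok_def)
qed

lemma gv_VAR: "e \<in> Exprs S \<gamma> \<Longrightarrow> gv e \<subseteq> VAR S"
proof (induction e arbitrary: \<gamma> rule: expr_induct)
  case (Op f args)
  have "set vs \<union> gv a \<subseteq> VAR S" if m: "(vs, a) \<in> set args" for vs a
    using arg_Exprs(1,3)[OF Op.prems m] Op.IH[OF m] by blast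
  then show ?case by (auto simp: UN_subset_iff)
qed

lemma set_expr_syms: "e \<in> Exprs S \<gamma> \<Longrightarrow> set_expr e \<subseteq> SOP S \<union> VAR S"
proof (induction e arbitrary: \<gamma> rule: expr_induct)
  case (Op f args)
  have "f \<in> SOP S \<union> VAR S" using Op.prems by (simp add: Op_in_Exprs_iff)
  moreover have "set vs \<subseteq> VAR S \<and> set_expr a \<subseteq> SOP S \<union> VAR S" if "(vs, a) \<in> set args" for vs a
    using arg_Exprs(1,3)[OF Op.prems that] Op.IH[OF that] by blast
  ultimately show ?case unfolding set_expr_Op by blast
qed

lemma fsub_Exprs:
  assumes "e \<in> Exprs S \<gamma>" "\<And>x. x \<in> VAR S \<Longrightarrow> \<sigma> x \<in> Exprs S (sort_of S x)" "\<And>f. f \<in> SOP S \<Longrightarrow> \<sigma> f = Var f"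
  shows "fsub \<sigma> e \<in> Exprs S \<gamma>"
  using assms
proof (induction e arbitrary: \<gamma> \<sigma> rule: expr_induct)
  case (Op f args)
  show ?case
  proof (cases "args = []")
    case True
    then show ?thesis using Op.prems by (cases "f \<in> VAR S") (auto simp: fsub.simps Op_in_Exprs_iff)
  next
    case False
    have *: "fsub (\<lambda>x. if x \<in> set vs then Var x else \<sigma> x) a \<in> Exprs S \<alpha>"
      if m: "(vs, a) \<in> set args" and "a \<in> Exprs S \<alpha>" for vs a \<alpha>
      by (rule Op.IH[OF m]) (use that Op.prems arg_Exprs(1)[OF Op.prems(1) m] in auto)
    show ?thesis using Op.prems(1) False
      by (auto simp: fsub.simps Op_in_Exprs_iff args_ok_def split_beta nth_mem intro!: *)
  qed
qed

lemma subst_Exprs: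
  assumes "e \<in> Exprs S \<gamma>" "list_all2 (\<lambda>x t. x \<in> VAR S \<and> t \<in> Exprs S (sort_of S x)) xs ts"
  shows "subst xs ts e \<in> Exprs S \<gamma>"
proof -
  have l: "length xs = length ts" using assms(2) by (rule list_all2_lengthD)
  show ?thesis unfolding subst_eq_fsub[OF l]
  proof (rule fsub_Exprs[OF assms(1)])
    fix x assume "x \<in> VAR S"
    then show "bind xs ts x \<in> Exprs S (sort_of S x)"
      using bind_in[OF l, of x] bind_notin[OF l, of x] assms(2)
      by (cases "x \<in> set xs") (auto simp: list_all2_conv_all_nth)
  next
    fix f assume "f \<in> SOP S"
    then have "f \<notin> set xs" using disj assms(2) by (fastforce simp: list_all2_conv_all_nth in_set_conv_nth)
    then show "bind xs ts f = Var f" by (rule bind_notin[OF l])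
  qed
qed

lemma fv_subst:
  assumes "length xs = length ts"
  shows "fv S (subst xs ts e) \<subseteq> (fv S e - set xs) \<union> (\<Union>t \<in> set ts. fv S t) \<union> {x \<in> fv S e. x \<in> set xs \<and> Var x \<in> set ts}"
proof
  fix y assume "y \<in> fv S (subst xs ts e)"
  then obtain x where x: "x \<in> frs e" "y \<in> frs (bind xs ts x)" "y \<in> VAR S"
    using frs_fsub[of "bind xs ts" e] by (auto simp: fv_eq_frs subst_eq_fsub[OF assms])
  show "y \<in> (fv S e - set xs) \<union> (\<Union>t \<in> set ts. fv S t) \<union> {x \<in> fv S e. x \<in> set xs \<and> Var x \<in> set ts}"
  proof (cases "x \<in> set xs")
    case True
    then obtain k where "k < length xs" "bind xs ts x = ts ! k" using bind_in[OF assms] by blast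
    then have "bind xs ts x \<in> set ts" using assms by simp
    then show ?thesis using x by (auto simp: fv_eq_frs)
  next
    case False
    then show ?thesis using x bind_notin[OF assms False] by (auto simp: fv_eq_frs)
  qed
qed

section \<open>Instances by closed expressions, and composition of substitutions\<close>

lemma closeds_length: "closeds S vs ts \<Longrightarrow> length vs = length ts"
  by (auto simp: closeds_def dest: list_all2_lengthD)

lemma closeds_append: "length vs = length ts \<Longrightarrow> closeds S (vs @ ws) (ts @ rs) \<longleftrightarrow> closeds S vs ts \<and> closeds S ws rs"
  by (simp add: closeds_def list_all2_append)

lemma closeds_Cons: "closeds S (v # vs) ts \<longleftrightarrow> (\<exists>t ts'. ts = t # ts' \<and> t \<in> closed S (sort_of S v) \<and> closeds S vs ts')"
  by (auto simp: closeds_def list_all2_Cons1)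

lemma closeds_Nil [simp]: "closeds S [] ts \<longleftrightarrow> ts = []"
  by (auto simp: closeds_def)

lemma closed_Exprs: "e \<in> closed S \<gamma> \<Longrightarrow> e \<in> Exprs S \<gamma>" and closed_fv: "e \<in> closed S \<gamma> \<Longrightarrow> fv S e = {}"
  by (auto simp: closed_def)

lemma closeds_Exprs:
  "closeds S vs ts \<Longrightarrow> set vs \<subseteq> VAR S \<Longrightarrow> list_all2 (\<lambda>x t. x \<in> VAR S \<and> t \<in> Exprs S (sort_of S x)) vs ts"
  unfolding closeds_def by (erule list.rel_mono_strong) (auto simp: closed_def)

lemma bind_closeds: "closeds S vs ts \<Longrightarrow> bind vs ts x = Var x \<or> fv S (bind vs ts x) = {}"
proof (cases "x \<in> set vs")
  case True
  assume c: "closeds S vs ts"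
  then obtain k where "k < length vs" "bind vs ts x = ts ! k"
    using bind_in[OF closeds_length[OF c] True] by blast
  then show ?thesis using c unfolding closeds_def by (metis closed_fv list_all2_nthD)
qed (simp add: bind_notin closeds_length)

lemma subst_closed: "fv S e = {} \<Longrightarrow> set xs \<subseteq> VAR S \<Longrightarrow> length xs = length ts \<Longrightarrow> subst xs ts e = e"
  by (auto simp: subst_eq_fsub fv_eq_frs intro!: fsub_id bind_notin)

lemma subst_closeds:
  assumes "closeds S vs ts" "e \<in> Exprs S \<gamma>" "set vs \<subseteq> VAR S" "fv S e \<subseteq> set vs"
  shows "subst vs ts e \<in> closed S \<gamma>"
proof -
  have l: "length vs = length ts" using assms(1) by (rule closeds_length)
  have c: "fv S t = {}" if "t \<in> set ts" for t
    using assms(1) that unfolding closeds_def by (metis closed_fv in_set_conv_nth list_all2_nthD2)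
  have "Var x \<notin> set ts" if "x \<in> set vs" for x
    using c[of "Var x"] that assms(3) by auto
  then have "fv S (subst vs ts e) = {}" using fv_subst[OF l, of e] c assms(4) by fastforce
  then show ?thesis using subst_Exprs[OF assms(2) closeds_Exprs[OF assms(1,3)]] by (simp add: closed_def)
qed

text \<open>The \<open>ts\<close> are closed, so \<open>vs\<close> cannot capture them and the
  second substitution cannot change them. A variable in both \<open>us\<close> and \<open>vs\<close>
  is left to \<open>rs\<close>, since the last match counts. This is used wherever an argument with
  bound variables is evaluated.\<close>

lemma subst_under_binder:
  assumes "closeds S us ts" "a \<in> Exprs S \<gamma>" "set vs \<subseteq> VAR S" "length vs = length rs"
  shows "subst vs rs (subst (us @ vs) (ts @ map Var vs) a) = subst (us @ vs) (ts @ rs) a"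
proof -
  have l: "length us = length ts" using assms(1) by (rule closeds_length)
  have "subst vs rs (subst (us @ vs) (ts @ map Var vs) a) =
      fsub (\<lambda>x. fsub (bind vs rs) (bind (us @ vs) (ts @ map Var vs) x)) a"
  proof (rule subst_subst)
    fix x assume "x \<in> frs a"
    show "bind (us @ vs) (ts @ map Var vs) x = Var x \<or> frs (bind (us @ vs) (ts @ map Var vs) x) \<inter> gv a = {}"
      using bind_closeds[OF assms(1), of x] gv_VAR[OF assms(2)]
      by (auto simp: bind_append l bind_map[of _ Var] fv_eq_frs)
  qed (use l assms in auto)
  also have "\<dots> = fsub (bind (us @ vs) (ts @ rs)) a"
  proof (rule fsub_cong)
    fix x
    have "fsub (bind vs rs) (bind us ts x) = bind us ts x" if "x \<notin> set vs"
      using bind_closeds[OF assms(1), of x] subst_closed[of "bind us ts x" vs rs] assms that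
      by (auto simp: subst_eq_fsub fsub.simps bind_notin)
    then show "fsub (bind vs rs) (bind (us @ vs) (ts @ map Var vs) x) = bind (us @ vs) (ts @ rs) x"
      using l assms(4) by (auto simp: bind_append bind_map[of _ Var] fsub.simps)
  qed
  finally show ?thesis using l assms(4) by (simp add: subst_eq_fsub)
qed

text \<open>The lists are joined in reverse order: a variable in both is already replaced by the
  inner substitution, and the last match counts.\<close>

lemma subst_append:
  assumes "closeds S xs ts" "a \<in> Exprs S \<gamma>" "set ys \<subseteq> VAR S" "length ys = length rs"
  shows "subst ys rs (subst xs ts a) = subst (ys @ xs) (rs @ ts) a"
proof -
  have l: "length xs = length ts" using assms(1) by (rule closeds_length)
  have "subst ys rs (subst xs ts a) = fsub (\<lambda>x. fsub (bind ys rs) (bind xs ts x)) a"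
  proof (rule subst_subst)
    fix x assume "x \<in> frs a"
    show "bind xs ts x = Var x \<or> frs (bind xs ts x) \<inter> gv a = {}"
      using bind_closeds[OF assms(1), of x] gv_VAR[OF assms(2)] by (auto simp: fv_eq_frs)
  qed (use l assms in auto)
  also have "\<dots> = fsub (bind (ys @ xs) (rs @ ts)) a"
  proof (rule fsub_cong)
    fix x
    have "fsub (bind ys rs) (bind xs ts x) = bind xs ts x" if x: "x \<in> set xs"
    proof -
      obtain k where k: "k < length xs" "bind xs ts x = ts ! k" using bind_in[OF l x] by blast
      then have "fv S (bind xs ts x) = {}"
        using assms(1) unfolding closeds_def by (metis closed_fv list_all2_nthD)
      then show ?thesis using subst_closed[of _ ys rs] assms(3,4) by (simp add: subst_eq_fsub)
    qed
    then show "fsub (bind ys rs) (bind xs ts x) = bind (ys @ xs) (rs @ ts) x"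
      using l assms(4) by (auto simp: bind_append fsub.simps bind_notin[of xs])
  qed
  finally show ?thesis using l assms(4) by (simp add: subst_eq_fsub)
qed

text \<open>Distinctness sends each \<open>zs ! k\<close> to exactly \<open>ts ! k\<close>;
  freshness excludes capture and collisions with symbols left in place. Repetitions in
  \<open>xs\<close> are harmless, as both sides pick the same index.\<close>

lemma subst_rename:
  assumes "length xs = length zs" "length zs = length ts" "distinct zs" "set zs \<inter> (frs a \<union> gv a) = {}"
  shows "subst zs ts (subst xs (map Var zs) a) = subst xs ts a"
proof -
  have *: "fsub (bind zs ts) (bind xs (map Var zs) x) = bind xs ts x \<and>
     (bind xs (map Var zs) x = Var x \<or> frs (bind xs (map Var zs) x) \<inter> gv a = {})" if "x \<in> frs a" for x
  proof (cases "x \<in> set xs")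
    case True
    then obtain k where kl: "k < length xs" and k: "\<And>ds. length ds = length xs \<Longrightarrow> bind xs ds x = ds ! k"
      using bind_index[OF True] by metis
    have "bind xs (map Var zs) x = Var (zs ! k)" "bind xs ts x = ts ! k"
      using k[of "map Var zs"] k[of ts] assms(1,2) kl by simp_all
    moreover have "zs ! k \<in> set zs" using assms(1) kl by simp
    then have "zs ! k \<notin> gv a" using assms(4) by blast
    ultimately show ?thesis using assms kl by (simp add: fsub.simps bind_nth)
  next
    case False
    have "x \<notin> set zs" using that assms(4) by blast
    then show ?thesis using False assms(1,2) by (simp add: bind_notin fsub.simps)
  qed
  have "subst zs ts (subst xs (map Var zs) a) = fsub (\<lambda>x. fsub (bind zs ts) (bind xs (map Var zs) x)) a"
    by (rule subst_subst) (use assms * in auto)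
  also have "\<dots> = fsub (bind xs ts) a" by (rule fsub_cong) (use * in auto)
  finally show ?thesis using assms by (simp add: subst_eq_fsub)
qed

lemma fresh_vars:
  assumes "set \<sigma>s \<subseteq> VSRT S" "finite X"
  shows "\<exists>vs. vs \<in> var_seqs S \<sigma>s \<and> distinct vs \<and> set vs \<inter> X = {}"
  using assms
proof (induction \<sigma>s arbitrary: X)
  case Nil
  then show ?case by (intro exI[of _ "[]"]) (simp add: var_seqs_def)
next
  case (Cons \<sigma> \<sigma>s)
  obtain v where v: "v \<in> vars S \<sigma>" "v \<notin> X"
    using Cons.prems infinite_imp_nonempty[OF Diff_infinite_finite[OF Cons.prems(2) infinite_vars[of \<sigma>]]] by auto
  obtain vs where "vs \<in> var_seqs S \<sigma>s \<and> distinct vs \<and> set vs \<inter> insert v X = {}"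
    using Cons.IH[of "insert v X"] Cons.prems by fastforce
  then show ?case using v by (intro exI[of _ "v # vs"]) (auto simp: var_seqs_def)
qed

end

section \<open>The calculus\<close>

lemma args_ok_middle:
  assumes "args_ok S \<alpha>s \<beta>ss (\<Delta> @ (xs, b) # \<Gamma>)"
  shows "length \<Delta> < length \<alpha>s" "xs \<in> var_seqs S (\<beta>ss ! length \<Delta>)" "distinct xs" "b \<in> Exprs S (\<alpha>s ! length \<Delta>)"
proof -
  have "length \<Delta> < length (\<Delta> @ (xs, b) # \<Gamma>)" "(\<Delta> @ (xs, b) # \<Gamma>) ! length \<Delta> = (xs, b)" by simp_all
  then show "length \<Delta> < length \<alpha>s" "xs \<in> var_seqs S (\<beta>ss ! length \<Delta>)" "distinct xs" "b \<in> Exprs S (\<alpha>s ! length \<Delta>)"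
    using assms unfolding args_ok_def by (metis fst_conv snd_conv)+
qed

lemma derivable_mono: "derivable S \<Gamma> \<phi> \<Longrightarrow> \<Gamma> \<subseteq> \<Delta> \<Longrightarrow> derivable S \<Delta> \<phi>"
  by (induction rule: derivable.induct) (auto intro: derivable.intros)

lemma derivable_finite: "derivable S \<Gamma> \<phi> \<Longrightarrow> \<exists>\<Delta> \<subseteq> \<Gamma>. finite \<Delta> \<and> derivable S \<Delta> \<phi>"
proof (induction rule: derivable.induct)
  case (Assumption \<phi>)
  then show ?case by (intro exI[of _ "{\<phi>}"]) (auto intro: derivable.intros)
next
  case (ModusPonens \<phi> \<psi>)
  then obtain \<Delta>1 \<Delta>2 where "\<Delta>1 \<subseteq> \<Gamma>" "\<Delta>2 \<subseteq> \<Gamma>" "finite \<Delta>1" "finite \<Delta>2"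
    "derivable S \<Delta>1 \<phi>" "derivable S \<Delta>2 (Imp S \<phi> \<psi>)" by blast
  then show ?case
    by (intro exI[of _ "\<Delta>1 \<union> \<Delta>2"]) (auto intro: derivable.ModusPonens derivable_mono)
qed (blast intro: derivable.intros)+

context sgn
begin

lemma subst_vars_Exprs:
  assumes "e \<in> Exprs S \<gamma>" "xs \<in> var_seqs S \<sigma>s" "zs \<in> var_seqs S \<sigma>s"
  shows "subst xs (map Var zs) e \<in> Exprs S \<gamma>"
  using assms by (intro subst_Exprs) (auto simp: var_seqs_def vars_def list_all2_conv_all_nth)

lemma axioms_F: "\<phi> \<in> axioms S \<Longrightarrow> \<phi> \<in> F"
proof (induction rule: axioms.induct)
  case (I2 f \<gamma> \<alpha>s \<beta>ss \<Delta> xs b1 \<Gamma> ys b2 zs)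
  have 1: "args_ok S \<alpha>s \<beta>ss (\<Delta> @ (xs, b1) # \<Gamma>)" and 2: "args_ok S \<alpha>s \<beta>ss (\<Delta> @ (ys, b2) # \<Gamma>)"
    using I2 by (auto simp: Op_in_Exprs_iff)
  have "\<alpha>s ! length \<Delta> \<in> SRT S" using args_ok_middle(4)[OF 1] by (rule Expr_SRT)
  then have "Eq S (\<alpha>s ! length \<Delta>) (subst xs (map Var zs) b1) (subst ys (map Var zs) b2) \<in> F"
    using subst_vars_Exprs args_ok_middle[OF 1] args_ok_middle[OF 2] I2.hyps(5) by blast
  moreover have "set zs \<subseteq> VAR S" using I2.hyps(5) by (simp add: var_seqs_conv_map)
  moreover have "\<gamma> \<in> SRT S" using I2.hyps(3) by (rule Expr_SRT)
  ultimately show ?case using I2 by auto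
next
  case (AllE x \<xi> a \<phi>)
  then have "subst [x] [a] \<phi> \<in> F" by (intro subst_Exprs) (auto simp: vars_def)
  then show ?case using AllE by (auto simp: vars_def)
next
  case (ExI x \<xi> a \<phi>)
  then have "subst [x] [a] \<phi> \<in> F" by (intro subst_Exprs) (auto simp: vars_def)
  then show ?case using ExI by (auto simp: vars_def)
qed (auto simp: tautology_def)

lemma derivable_F: "derivable S \<Gamma> \<phi> \<Longrightarrow> \<Gamma> \<subseteq> F \<Longrightarrow> \<phi> \<in> F"
  by (induction rule: derivable.induct) (use axioms_F Imp_FD in blast)+

section \<open>Propositional reasoning and the deduction theorem\<close>

lemma prop0:
  "\<phi> \<in> F \<Longrightarrow> (\<And>v. boolean_valuation S v \<Longrightarrow> v \<phi>) \<Longrightarrow> derivable S \<Gamma> \<phi>"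
  by (rule derivable.Axiom, rule axioms.Taut) (unfold tautology_def, blast)

text \<open>As all tautologies are axioms, propositional inferences can be checked on Boolean
  valuations, here from one premise and in \<open>prop2\<close> from two.\<close>

lemma prop1:
  assumes "derivable S \<Gamma> a" "a \<in> F" "b \<in> F" "\<And>v. boolean_valuation S v \<Longrightarrow> v a \<Longrightarrow> v b"
  shows "derivable S \<Gamma> b"
proof (rule derivable.ModusPonens[OF assms(1)], rule prop0)
  show "Imp S a b \<in> F" using assms(2,3) by blast
  fix v assume v: "boolean_valuation S v"
  then have "v (Imp S a b) = (v a \<longrightarrow> v b)" using assms(2,3) unfolding boolean_valuation_def by blast
  then show "v (Imp S a b)" using assms(4)[OF v] by simp
qed

lemma prop2:
  assumes "derivable S \<Gamma> a" "derivable S \<Gamma> b" "a \<in> F" "b \<in> F" "c \<in> F"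
    and "\<And>v. boolean_valuation S v \<Longrightarrow> v a \<Longrightarrow> v b \<Longrightarrow> v c"
  shows "derivable S \<Gamma> c"
proof (rule derivable.ModusPonens[OF assms(2)], rule prop1[OF assms(1,3)])
  show "Imp S b c \<in> F" using assms(4,5) by blast
  fix v assume v: "boolean_valuation S v" "v a"
  then have "v (Imp S b c) = (v b \<longrightarrow> v c)" using assms(4,5) unfolding boolean_valuation_def by blast
  then show "v (Imp S b c)" using assms(6)[OF v] by simp
qed

text \<open>Closedness of \<open>\<psi>\<close> serves the generalization rule: no variable is free
  in \<open>\<psi>\<close>, so \<open>AllI\<close> always moves the quantifier past it.\<close>

lemma deduction:
  assumes "derivable S (insert \<psi> \<Gamma>) \<chi>" "\<Gamma> \<subseteq> F" "\<psi> \<in> F" "fv S \<psi> = {}"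
  shows "derivable S \<Gamma> (Imp S \<psi> \<chi>)"
  using assms(1)
proof (induction rule: derivable.induct)
  case (Axiom \<phi>)
  then show ?case
    using axioms_F[OF Axiom] assms(3)
    by (intro prop1[OF derivable.Axiom[OF Axiom]]) (auto simp: boolean_valuation_def)
next
  case (Assumption \<phi>)
  show ?case
  proof (cases "\<phi> = \<psi>")
    case True
    then show ?thesis using assms(3) by (intro prop0) (auto simp: boolean_valuation_def)
  next
    case False
    then have "\<phi> \<in> \<Gamma>" "\<phi> \<in> F" using Assumption assms(2) by auto
    then show ?thesis using assms(3)
      by (intro prop1[OF derivable.Assumption]) (auto simp: boolean_valuation_def)
  qed
next
  case (ModusPonens \<phi> \<chi>)
  have "Imp S \<phi> \<chi> \<in> F" using derivable_F[OF ModusPonens.hyps(2)] assms(2,3) by auto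
  then have F: "\<phi> \<in> F" "\<chi> \<in> F" using Imp_FD by blast+
  show ?case
    by (rule prop2[OF ModusPonens.IH]) (use assms(3) F in \<open>auto simp: boolean_valuation_def\<close>)
next
  case (Generalization \<phi> x)
  have "\<phi> \<in> F" using derivable_F[OF Generalization.hyps(1)] assms(2,3) by auto
  show ?case
    by (rule derivable.ModusPonens[OF derivable.Generalization[OF Generalization.IH Generalization.hyps(2)]],
        rule derivable.Axiom, rule axioms.AllI) (use Generalization.hyps(2) assms \<open>\<phi> \<in> F\<close> in auto)
qed

section \<open>Instantiation, universal closure and change of bound variables\<close>

lemma derivable_subst_closed:
  assumes "derivable S \<Gamma> \<phi>" "\<phi> \<in> F" "x \<in> VAR S" "t \<in> closed S (sort_of S x)"
  shows "derivable S \<Gamma> (subst [x] [t] \<phi>)"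
  by (rule derivable.ModusPonens[OF derivable.Generalization[OF assms(1,3)]], rule derivable.Axiom,
      rule axioms.AllE[of x S "sort_of S x"])
    (use assms in \<open>auto simp: vars_def closed_def intro: Subb_closed\<close>)

text \<open>Instantiation starts from the last variable. As the inserted expressions are closed, the
  single substitutions merge into the simultaneous one, and of repeated variables the last wins on
  both sides.\<close>

lemma derivable_subst_closeds:
  assumes "derivable S \<Gamma> \<phi>" "\<phi> \<in> F" "set xs \<subseteq> VAR S" "closeds S xs ts"
  shows "derivable S \<Gamma> (subst xs ts \<phi>)"
  using assms
proof (induction xs arbitrary: \<phi> ts rule: rev_induct)
  case (snoc x xs)
  then obtain ts' t where ts: "ts = ts' @ [t]" using closeds_length by (cases ts rule: rev_cases) fastforce+
  have l: "length xs = length ts'" using snoc.prems(4) closeds_length[of "xs @ [x]" ts] ts by simp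
  have c: "closeds S xs ts'" "closeds S [x] [t]" using snoc.prems(4) l by (auto simp: ts closeds_append)
  have "derivable S \<Gamma> (subst xs ts' (subst [x] [t] \<phi>))"
  proof (rule snoc.IH)
    show "derivable S \<Gamma> (subst [x] [t] \<phi>)"
      using snoc.prems c by (intro derivable_subst_closed) (auto simp: closeds_Cons)
    show "subst [x] [t] \<phi> \<in> F" using snoc.prems c by (intro subst_Exprs) (auto simp: closeds_Cons closed_def)
  qed (use snoc.prems c in auto)
  then show ?case using subst_append[OF c(2) snoc.prems(2)] snoc.prems(3) l by (simp add: ts)
qed (auto simp: closeds_def)

lemma derivable_Foralls: "derivable S \<Gamma> \<phi> \<Longrightarrow> set xs \<subseteq> VAR S \<Longrightarrow> derivable S \<Gamma> (Foralls S xs \<phi>)"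
  unfolding Foralls_def by (induction xs) (auto intro: derivable.Generalization)

lemma derivable_Foralls_elim:
  assumes "derivable S \<Gamma> (Foralls S xs \<phi>)" "set xs \<subseteq> VAR S" "\<phi> \<in> F"
  shows "derivable S \<Gamma> \<phi>"
  using assms(1,2)
proof (induction xs)
  case (Cons x xs)
  let ?\<phi> = "Foralls S xs \<phi>"
  have "Imp S (Forall S x ?\<phi>) (subst [x] [Var x] ?\<phi>) \<in> axioms S"
    using Cons.prems assms(3) by (intro axioms.AllE[of _ _ "sort_of S x"]) (auto simp: vars_def Subb_self)
  then have "Imp S (Forall S x ?\<phi>) ?\<phi> \<in> axioms S" using subst_same[of "[x]"] by simp
  then have "derivable S \<Gamma> ?\<phi>"
    using Cons.prems by (auto simp: Foralls_def intro: derivable.intros)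
  then show ?case using Cons by simp
qed (simp add: Foralls_def)

lemma derivable_Exists_imp:
  assumes "derivable S \<Gamma> (Imp S \<phi> \<psi>)" "\<phi> \<in> F" "\<psi> \<in> F" "x \<in> VAR S" "x \<notin> fv S \<psi>"
  shows "derivable S \<Gamma> (Imp S (Exists S x \<phi>) \<psi>)"
  by (rule derivable.ModusPonens[OF derivable.Generalization[OF assms(1,4)]], rule derivable.Axiom,
      rule axioms.ExE) (use assms in auto)

text \<open>The axiom \<open>\<phi>(x) \<rightarrow> \<exists>y \<phi>(y)\<close> is not available when \<open>x\<close> is also bound in \<open>\<phi>\<close>, as \<^const>\<open>Subb\<close> then fails.
  Renaming bound variables therefore goes through \<open>I2\<close> for the quantifier.\<close>

lemma derivable_Exists_rename:
  assumes "\<phi> \<in> F" "x \<in> VAR S" "y \<in> vars S (sort_of S x)" "y \<notin> set_expr \<phi>"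
  shows "derivable S \<Gamma> (Iff S (Exists S x \<phi>) (Exists S y (subst [x] [Var y] \<phi>)))"
proof -
  have x: "sort_of S x \<in> VSRT S" using sig_VAR assms(2) by blast
  \<comment> \<open>\<open>I2\<close> wants a variable that is free in neither body, and
    \<open>y\<close> can be free in \<open>?b\<close>; hence a third variable.\<close>
  obtain z where z: "z \<in> vars S (sort_of S x)" "z \<notin> set_expr \<phi> \<union> {x, y}"
    using infinite_imp_nonempty[OF Diff_infinite_finite[OF _ infinite_vars[OF x]], of "set_expr \<phi> \<union> {x, y}"] by auto
  let ?b = "subst [x] [Var y] \<phi>"
  let ?a = "subst [x] [Var z] \<phi>"
  have y: "y \<in> VAR S" "sort_of S y = sort_of S x" and z': "z \<in> VAR S" "sort_of S z = sort_of S x"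
    using assms z by (auto simp: vars_def)
  have b: "?b \<in> F" using assms y by (intro subst_Exprs) auto
  have a: "?a \<in> F" using assms z' by (intro subst_Exprs) auto
  have eq: "subst [y] [Var z] ?b = ?a"
    using subst_rename[of "[x]" "[y]" "[Var z]" \<phi>] assms(4) gv_subset_set_expr[of \<phi>] frs_subset_set_expr[of \<phi>]
    by auto
  have "fv S ?b \<subseteq> fv S \<phi> \<union> {y}" using fv_subst[of "[x]" "[Var y]" \<phi>] y by auto
  then have zf: "z \<notin> fv S \<phi> \<union> fv S ?b" using z frs_subset_set_expr[of \<phi>] by (auto simp: fv_eq_frs)
  have 1: "derivable S \<Gamma> (Iff S ?a ?a)" using a by (intro prop0) (auto simp: boolean_valuation_def)
  \<comment> \<open>Renamed to \<open>z\<close>, both bodies become \<open>?a\<close>, so the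
    premise of this instance is a generalized tautology. The lists have the literal shape of
    \<open>I2\<close>, with no further arguments on either side.\<close>
  have "Imp S (Foralls S [z] (Eq S ([\<pi>] ! length ([] :: ('s list \<times> 's expr) list)) (subst [x] (map Var [z]) \<phi>) (subst [y] (map Var [z]) ?b)))
     (Eq S \<pi> (Op (ex_sym S (sort_of S x)) ([] @ ([x], \<phi>) # [])) (Op (ex_sym S (sort_of S x)) ([] @ ([y], ?b) # [])))
     \<in> axioms S"
  proof (rule axioms.I2[where \<beta>ss = "[[sort_of S x]]"])
    show "Op (ex_sym S (sort_of S x)) ([] @ [([x], \<phi>)]) \<in> F" using F_intros(9)[OF assms(2,1)] by (simp add: Exists_def)
    show "Op (ex_sym S (sort_of S x)) ([] @ [([y], ?b)]) \<in> F" using F_intros(9)[OF y(1) b] by (simp add: Exists_def y)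
  qed (use x zf z z' in \<open>auto simp: sym_sigs var_seqs_def\<close>)
  then have "Imp S (Forall S z (Iff S ?a ?a)) (Iff S (Exists S x \<phi>) (Exists S y ?b)) \<in> axioms S"
    by (simp add: eq Foralls_def Exists_def y)
  then show ?thesis using derivable.Generalization[OF 1 z'(1)] by (auto intro: derivable.intros)
qed

end


section \<open>Renaming symbols in derivations\<close>

lemma map_expr_Op: "map_expr \<rho> (Op f args) = Op (\<rho> f) (map (\<lambda>(vs, a). (map \<rho> vs, map_expr \<rho> a)) args)"
  by (simp add: map_prod_def case_prod_unfold)

declare expr.map [simp del]

lemma last_assoc_map_key:
  assumes "length xs = length ds" "\<And>x. x \<in> set xs \<Longrightarrow> \<rho> f = \<rho> x \<Longrightarrow> f = x"
  shows "last_assoc (map \<rho> xs) ds (\<rho> f) = last_assoc xs ds f"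
  using assms
proof (induction xs arbitrary: ds rule: rev_induct)
  case (snoc x xs)
  then obtain ds' d where ds: "ds = ds' @ [d]" by (cases ds rule: rev_cases) auto
  have "last_assoc (map \<rho> xs) ds' (\<rho> f) = last_assoc xs ds' f"
    by (rule snoc.IH) (use snoc.prems in \<open>auto simp: ds\<close>)
  moreover have "\<rho> f = \<rho> x \<longleftrightarrow> f = x" using snoc.prems(2)[of x] by auto
  moreover have "length xs = length ds'" using snoc.prems(1) by (simp add: ds)
  ultimately show ?case by (simp add: ds last_assoc_def)
qed (simp add: last_assoc_def)

text \<open>One notion for three maps: the inclusion into the extended language, the replacement of
  a witness constant by a fresh variable, and the return to the original language. Hence operations
  may become variables, and injectivity is required on variables only.\<close>

locale renaming = A: sgn S1 + B: sgn S2
  for S1 :: "('srt, 'a) signature" and S2 :: "('srt, 'b) signature" +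
  fixes \<rho> :: "'a \<Rightarrow> 'b"
  assumes sorts: "SRT S2 = SRT S1" "VSRT S2 = VSRT S1" "form_sort S2 = form_sort S1"
    and sig_\<rho>: "f \<in> SOP S1 \<union> VAR S1 \<Longrightarrow> sig S2 (\<rho> f) = sig S1 f"
    and VAR_\<rho>: "x \<in> VAR S1 \<Longrightarrow> \<rho> x \<in> VAR S2"
    and SOP_\<rho>: "f \<in> SOP S1 \<Longrightarrow> \<rho> f \<in> SOP S2 \<union> VAR S2"
    and inj_\<rho>: "inj_on \<rho> (VAR S1)"
    and syms_\<rho>: "\<rho> (top_sym S1) = top_sym S2" "\<rho> (bot_sym S1) = bot_sym S2"
      "\<rho> (neg_sym S1) = neg_sym S2" "\<rho> (imp_sym S1) = imp_sym S2" "\<rho> (con_sym S1) = con_sym S2"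
      "\<rho> (dis_sym S1) = dis_sym S2" "\<rho> (iff_sym S1) = iff_sym S2"
      "\<alpha> \<in> VSRT S1 \<Longrightarrow> \<rho> (all_sym S1 \<alpha>) = all_sym S2 \<alpha>" "\<alpha> \<in> VSRT S1 \<Longrightarrow> \<rho> (ex_sym S1 \<alpha>) = ex_sym S2 \<alpha>"
      "\<alpha> \<in> SRT S1 \<Longrightarrow> \<rho> (eq_sym S1 \<alpha>) = eq_sym S2 \<alpha>"
begin

abbreviation R where "R \<equiv> map_expr \<rho>"

lemma sort_of_\<rho>: "x \<in> VAR S1 \<Longrightarrow> sort_of S2 (\<rho> x) = sort_of S1 x"
  by (simp add: sig_\<rho>)

lemma var_seqs_\<rho>: "vs \<in> var_seqs S1 \<sigma>s \<Longrightarrow> map \<rho> vs \<in> var_seqs S2 \<sigma>s"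
  using VAR_\<rho> sort_of_\<rho> by (auto simp: var_seqs_conv_map subset_iff)

lemma R_Exprs: "e \<in> Exprs S1 \<gamma> \<Longrightarrow> R e \<in> Exprs S2 \<gamma>"
proof (induction e arbitrary: \<gamma> rule: expr_induct)
  case (Op f args)
  have f: "f \<in> SOP S1 \<union> VAR S1" "sort_of S1 f = \<gamma>"
    and ok: "args_ok S1 (fst (snd (sig S1 f))) (snd (snd (sig S1 f))) args"
    using Op.prems by (auto simp: Op_in_Exprs_iff)
  have "args_ok S2 (fst (snd (sig S1 f))) (snd (snd (sig S1 f))) (map (\<lambda>(vs, a). (map \<rho> vs, R a)) args)"
    unfolding args_ok_def
  proof (intro conjI allI impI)
    fix i assume i: "i < length (fst (snd (sig S1 f)))"
    obtain vs a where va: "args ! i = (vs, a)" by fastforce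
    have l: "i < length args" using i ok by (simp add: args_ok_def)
    then have m: "(vs, a) \<in> set args" using va by (metis nth_mem)
    have "fst (args ! i) \<in> var_seqs S1 (snd (snd (sig S1 f)) ! i) \<and> distinct (fst (args ! i)) \<and>
        snd (args ! i) \<in> Exprs S1 (fst (snd (sig S1 f)) ! i)"
      using ok i unfolding args_ok_def by blast
    then have ok_i: "vs \<in> var_seqs S1 (snd (snd (sig S1 f)) ! i)" "distinct vs" "a \<in> Exprs S1 (fst (snd (sig S1 f)) ! i)"
      by (simp_all add: va)
    have "inj_on \<rho> (set vs)" using ok_i(1) inj_\<rho> by (auto simp: var_seqs_conv_map intro: inj_on_subset)
    then show "fst (map (\<lambda>(vs, a). (map \<rho> vs, R a)) args ! i) \<in> var_seqs S2 (snd (snd (sig S1 f)) ! i)"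
      "distinct (fst (map (\<lambda>(vs, a). (map \<rho> vs, R a)) args ! i))"
      "snd (map (\<lambda>(vs, a). (map \<rho> vs, R a)) args ! i) \<in> Exprs S2 (fst (snd (sig S1 f)) ! i)"
      using ok_i var_seqs_\<rho> Op.IH[OF m] l va by (simp_all add: distinct_map)
  qed (use ok in \<open>simp add: args_ok_def\<close>)
  then show ?case using f sig_\<rho>[OF f(1)] VAR_\<rho> SOP_\<rho> by (auto simp: Op_in_Exprs_iff map_expr_Op)
qed

lemma R_simps:
  "R (Top S1) = Top S2" "R (Bot S1) = Bot S2" "R (Neg S1 a) = Neg S2 (R a)"
  "R (Imp S1 a b) = Imp S2 (R a) (R b)" "R (Con S1 a b) = Con S2 (R a) (R b)"
  "R (Dis S1 a b) = Dis S2 (R a) (R b)" "R (Iff S1 a b) = Iff S2 (R a) (R b)"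
  "x \<in> VAR S1 \<Longrightarrow> R (Forall S1 x a) = Forall S2 (\<rho> x) (R a)"
  "x \<in> VAR S1 \<Longrightarrow> R (Exists S1 x a) = Exists S2 (\<rho> x) (R a)"
  "\<gamma> \<in> SRT S1 \<Longrightarrow> R (Eq S1 \<gamma> a b) = Eq S2 \<gamma> (R a) (R b)"
  unfolding Top_def Bot_def Neg_def Imp_def Con_def Dis_def Iff_def Forall_def Exists_def Eq_def
  by (simp_all add: map_expr_Op syms_\<rho> sort_of_\<rho> A.sig_VAR)

lemma R_Foralls: "set xs \<subseteq> VAR S1 \<Longrightarrow> R (Foralls S1 xs a) = Foralls S2 (map \<rho> xs) (R a)"
  unfolding Foralls_def by (induction xs) (auto simp: R_simps)

text \<open>\<open>R\<close> commutes with the connectives, so a Boolean valuation of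
  \<open>S2\<close> composed with \<open>R\<close> is one of \<open>S1\<close>.\<close>

lemma R_tautology: "tautology S1 \<phi> \<Longrightarrow> tautology S2 (R \<phi>)"
proof -
  assume t: "tautology S1 \<phi>"
  have "v (R \<phi>)" if v: "boolean_valuation S2 v" for v
  proof -
    have "boolean_valuation S1 (\<lambda>e. v (R e))"
      using v unfolding boolean_valuation_def R_simps sorts(3)[symmetric]
      using R_Exprs[of _ "form_sort S1"] sorts(3) by simp
    then show ?thesis using t unfolding tautology_def by blast
  qed
  then show ?thesis using t R_Exprs[of \<phi> "form_sort S1"] by (auto simp: tautology_def sorts)
qed

text \<open>Only an inclusion, because an operation may be mapped to a variable that is bound around
  it.\<close>

lemma frs_R: "frs (R e) \<subseteq> \<rho> ` frs e"
proof (induction e rule: expr_induct)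
  case (Op f args)
  have *: "frs (R a) - set (map \<rho> vs) \<subseteq> \<rho> ` (frs a - set vs)" if "(vs, a) \<in> set args" for vs a
    using Op[OF that] by auto
  show ?case
  proof (cases "args = []")
    case False
    then have "frs (R (Op f args)) = (\<Union>(vs, a) \<in> set args. frs (R a) - set (map \<rho> vs))"
      by (simp add: map_expr_Op split_beta)
    also have "\<dots> \<subseteq> (\<Union>(vs, a) \<in> set args. \<rho> ` (frs a - set vs))"
      by (rule UN_mono) (use * in auto)
    also have "\<dots> = \<rho> ` frs (Op f args)" using False by (simp add: image_UN split_beta)
    finally show ?thesis .
  qed (simp add: map_expr_Op)
qed

end

text \<open>Variables cannot collide with each other under a renaming, so the only danger is an
  operation landing on the image of a variable in \<open>V\<close>. In use, \<open>V\<close> holds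
  the variables that are bound or substituted for.\<close>

definition avoids :: "('srt, 'a) signature \<Rightarrow> ('a \<Rightarrow> 'b) \<Rightarrow> 'a set \<Rightarrow> bool" where
  "avoids S \<rho> V \<longleftrightarrow> V \<subseteq> VAR S \<and> (\<forall>x \<in> V. \<forall>f \<in> SOP S. \<rho> f \<noteq> \<rho> x)"

lemma avoids_Un: "avoids S \<rho> (V \<union> W) \<longleftrightarrow> avoids S \<rho> V \<and> avoids S \<rho> W"
  by (auto simp: avoids_def)

context renaming
begin

lemma no_collision: "avoids S1 \<rho> V \<Longrightarrow> x \<in> V \<Longrightarrow> f \<in> SOP S1 \<union> VAR S1 \<Longrightarrow> \<rho> f = \<rho> x \<Longrightarrow> f = x"
  using inj_\<rho> unfolding avoids_def by (metis Un_iff inj_onD subsetD)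

lemma fv_R:
  assumes "avoids S1 \<rho> V" "e \<in> Exprs S1 \<gamma>" "x \<in> V" "\<rho> x \<in> fv S2 (R e)"
  shows "x \<in> fv S1 e"
proof -
  obtain f where f: "f \<in> frs e" "\<rho> f = \<rho> x" using assms(4) frs_R[of e] by (auto simp: fv_eq_frs)
  then have "f \<in> SOP S1 \<union> VAR S1" using A.set_expr_syms[OF assms(2)] frs_subset_set_expr[of e] by blast
  then have "f = x" using no_collision assms f by blast
  then show ?thesis using f assms by (auto simp: fv_eq_frs avoids_def)
qed

text \<open>A constant mapped to a variable of \<open>map \<rho> xs\<close> would be replaced on the
  right but not on the left. Below a binder the list grows by the bound variables, hence the
  condition on \<open>gv e\<close>.\<close>

lemma R_subst:
  assumes "avoids S1 \<rho> V" "set xs \<subseteq> V" "length xs = length ds" "e \<in> Exprs S1 \<gamma>" "gv e \<subseteq> V"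
  shows "R (subst xs ds e) = subst (map \<rho> xs) (map R ds) (R e)"
  using assms(2-)
proof (induction e arbitrary: xs ds \<gamma> rule: expr_induct)
  case (Op f args)
  show ?case
  proof (cases "args = []")
    case True
    have f: "f \<in> SOP S1 \<union> VAR S1" using Op.prems by (simp add: Op_in_Exprs_iff)
    have "last_assoc (map \<rho> xs) (map R ds) (\<rho> f) = map_option R (last_assoc xs ds f)"
      using last_assoc_map_key[of xs "map R ds" \<rho> f] no_collision[OF assms(1) _ f] Op.prems(1,2)
      by (simp add: last_assoc_map subset_iff)
    then show ?thesis using True by (simp add: subst.simps map_expr_Op split: option.splits)
  next
    case False
    have "R (subst (xs @ vs) (ds @ map Var vs) a) =
        subst (map \<rho> xs @ map \<rho> vs) (map R ds @ map Var (map \<rho> vs)) (R a)"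
      if m: "(vs, a) \<in> set args" for vs a
    proof -
      obtain \<alpha> where \<alpha>: "a \<in> Exprs S1 \<alpha>" using A.arg_Exprs(3)[OF Op.prems(3) m] by blast
      have "gv a \<union> set vs \<subseteq> V" using m Op.prems(4) by fastforce
      then show ?thesis
        using Op.IH[OF m, of "xs @ vs" "ds @ map Var vs", OF _ _ \<alpha>] Op.prems
        by (simp add: comp_def map_expr_Op)
    qed
    then show ?thesis using False by (auto simp: subst_Op map_expr_Op)
  qed
qed

text \<open>Images of constants may add free variables to \<open>R d\<close>; avoiding the bound
  variables of \<open>e\<close> keeps these from being captured.\<close>

lemma Subb_R:
  assumes "avoids S1 \<rho> V" "d \<in> Exprs S1 \<delta>" "e \<in> Exprs S1 \<gamma>" "gv e \<subseteq> V" "Subb S1 d x e"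
  shows "Subb S2 (R d) (\<rho> x) (R e)"
  using assms(3-)
proof (induction e arbitrary: \<gamma> rule: expr_induct)
  case (Op f args)
  have "\<rho> x \<in> \<rho> ` set vs \<or> (Subb S2 (R d) (\<rho> x) (R a) \<and> fv S2 (R d) \<inter> \<rho> ` set vs = {})"
    if m: "(vs, a) \<in> set args" for vs a
  proof (cases "x \<in> set vs")
    case False
    obtain \<alpha> where \<alpha>: "a \<in> Exprs S1 \<alpha>" using A.arg_Exprs(3)[OF Op.prems(1) m] by blast
    have gv: "gv a \<union> set vs \<subseteq> V" using m Op.prems(2) by fastforce
    have S: "Subb S1 d x a" "fv S1 d \<inter> set vs = {}" using Op.prems(3) m False by auto
    have "Subb S2 (R d) (\<rho> x) (R a)" using Op.IH[OF m \<alpha>] gv S by blast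
    moreover have "fv S2 (R d) \<inter> \<rho> ` set vs = {}" using fv_R[OF assms(1,2)] gv S(2) by blast
    ultimately show ?thesis by blast
  qed simp
  note * = this
  show ?case unfolding map_expr_Op by (auto dest: *) (use * in blast)
qed

lemma VAR_seq: "zs \<in> var_seqs S1 \<sigma>s \<Longrightarrow> set zs \<subseteq> VAR S1"
  by (simp add: var_seqs_conv_map)

lemma I2_R:
  assumes av: "avoids S1 \<rho> (set zs \<union> set xs \<union> set ys \<union> gv b1 \<union> gv b2)"
    and h: "f \<in> SOP S1" "sig S1 f = (\<gamma>, \<alpha>s, \<beta>ss)"
      "Op f (\<Delta> @ (xs, b1) # \<Gamma>) \<in> Exprs S1 \<gamma>" "Op f (\<Delta> @ (ys, b2) # \<Gamma>) \<in> Exprs S1 \<gamma>"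
      "zs \<in> var_seqs S1 (\<beta>ss ! length \<Delta>)" "set zs \<inter> (fv S1 b1 \<union> fv S1 b2) = {}"
  shows "R (Imp S1
          (Foralls S1 zs (Eq S1 (\<alpha>s ! length \<Delta>)
             (subst xs (map Var zs) b1) (subst ys (map Var zs) b2)))
          (Eq S1 \<gamma> (Op f (\<Delta> @ (xs, b1) # \<Gamma>)) (Op f (\<Delta> @ (ys, b2) # \<Gamma>)))) \<in> axioms S2"
proof -
  let ?A = "map (\<lambda>(vs, a). (map \<rho> vs, R a))"
  have 1: "args_ok S1 \<alpha>s \<beta>ss (\<Delta> @ (xs, b1) # \<Gamma>)" and 2: "args_ok S1 \<alpha>s \<beta>ss (\<Delta> @ (ys, b2) # \<Gamma>)"
    using h by (auto simp: Op_in_Exprs_iff)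
  note b1 = args_ok_middle[OF 1] and b2 = args_ok_middle[OF 2]
  have len: "length xs = length zs" "length ys = length zs"
    using b1(2) b2(2) h(5) by (auto simp: var_seqs_def dest!: list_all2_lengthD)
  have s1: "R (subst xs (map Var zs) b1) = subst (map \<rho> xs) (map Var (map \<rho> zs)) (R b1)"
    using R_subst[OF av, of xs "map Var zs" b1] b1(4) len by (simp add: comp_def map_expr_Op le_supI1)
  have s2: "R (subst ys (map Var zs) b2) = subst (map \<rho> ys) (map Var (map \<rho> zs)) (R b2)"
    using R_subst[OF av, of ys "map Var zs" b2] b2(4) len by (simp add: comp_def map_expr_Op le_supI1)
  have srt: "\<alpha>s ! length \<Delta> \<in> SRT S1" "\<gamma> \<in> SRT S1" using A.Expr_SRT b1(4) h(3) by blast+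
  \<comment> \<open>\<open>f\<close> has at least one argument and its image has the same signature,
    so the image is not a variable.\<close>
  have f: "\<rho> f \<in> SOP S2"
    using SOP_\<rho>[OF h(1)] B.sig_VAR[of "\<rho> f"] sig_\<rho>[of f] h(1,2) b1(1) by auto
  have "Imp S2
          (Foralls S2 (map \<rho> zs) (Eq S2 (\<alpha>s ! length (?A \<Delta>))
             (subst (map \<rho> xs) (map Var (map \<rho> zs)) (R b1)) (subst (map \<rho> ys) (map Var (map \<rho> zs)) (R b2))))
          (Eq S2 \<gamma> (Op (\<rho> f) (?A \<Delta> @ (map \<rho> xs, R b1) # ?A \<Gamma>)) (Op (\<rho> f) (?A \<Delta> @ (map \<rho> ys, R b2) # ?A \<Gamma>)))
        \<in> axioms S2"
  proof (rule axioms.I2)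
    show "sig S2 (\<rho> f) = (\<gamma>, \<alpha>s, \<beta>ss)" using sig_\<rho> h by simp
    show "Op (\<rho> f) (?A \<Delta> @ (map \<rho> xs, R b1) # ?A \<Gamma>) \<in> Exprs S2 \<gamma>"
      "Op (\<rho> f) (?A \<Delta> @ (map \<rho> ys, R b2) # ?A \<Gamma>) \<in> Exprs S2 \<gamma>"
      using R_Exprs[OF h(3)] R_Exprs[OF h(4)] by (simp_all add: map_expr_Op)
    show "map \<rho> zs \<in> var_seqs S2 (\<beta>ss ! length (?A \<Delta>))" using var_seqs_\<rho> h(5) by simp
    show "set (map \<rho> zs) \<inter> (fv S2 (R b1) \<union> fv S2 (R b2)) = {}"
      using fv_R[OF av b1(4)] fv_R[OF av b2(4)] h(6) by auto
  qed (rule f)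
  then show ?thesis
    using srt VAR_seq[OF h(5)] by (simp add: R_simps R_Foralls s1 s2 map_expr_Op)
qed

end

text \<open>The critical variables are those that the axiom quantifies, substitutes for or binds
  inside. They are fixed before \<open>\<rho>\<close>, so that later the targets of constants can be
  chosen outside of them.\<close>

lemma renaming_axiom:
  assumes "\<phi> \<in> axioms S1"
  shows "\<exists>V. finite V \<and> V \<subseteq> VAR S1 \<and> (\<forall>\<rho>. renaming S1 S2 \<rho> \<longrightarrow> avoids S1 \<rho> V \<longrightarrow> map_expr \<rho> \<phi> \<in> axioms S2)"
  using assms
proof cases
  case Taut
  then show ?thesis using renaming.R_tautology axioms.Taut by (intro exI[of _ "{}"]) blast
next
  case (AllE x \<xi> a \<psi>)
  let ?V = "VAR S1 \<inter> ({x} \<union> gv \<psi>)"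
  show ?thesis
  proof (intro exI[of _ ?V] conjI allI impI)
    show "finite ?V" using finite_subset[OF gv_subset_set_expr finite_set_expr] by blast
    fix \<rho> assume r: "renaming S1 S2 \<rho>" and av: "avoids S1 \<rho> ?V"
    interpret renaming S1 S2 \<rho> by (rule r)
    have x: "x \<in> VAR S1" "sort_of S1 x = \<xi>" using AllE by (auto simp: vars_def)
    have gv: "gv \<psi> \<subseteq> ?V" using A.gv_VAR AllE(4) by blast
    have "R (subst [x] [a] \<psi>) = subst [\<rho> x] [R a] (R \<psi>)"
      using R_subst[OF av _ _ AllE(4) gv, of "[x]" "[a]"] x by simp
    moreover have "Subb S2 (R a) (\<rho> x) (R \<psi>)" by (rule Subb_R[OF av AllE(3,4) gv AllE(5)])
    moreover have "\<rho> x \<in> vars S2 \<xi>" using x VAR_\<rho> sort_of_\<rho> by (simp add: vars_def)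
    ultimately show "map_expr \<rho> \<phi> \<in> axioms S2"
      using AllE R_Exprs x axioms.AllE[of "\<rho> x" S2 \<xi> "R a" "R \<psi>"] by (simp add: R_simps sorts)
  qed simp
next
  case (ExI x \<xi> a \<psi>)
  let ?V = "VAR S1 \<inter> ({x} \<union> gv \<psi>)"
  show ?thesis
  proof (intro exI[of _ ?V] conjI allI impI)
    show "finite ?V" using finite_subset[OF gv_subset_set_expr finite_set_expr] by blast
    fix \<rho> assume r: "renaming S1 S2 \<rho>" and av: "avoids S1 \<rho> ?V"
    interpret renaming S1 S2 \<rho> by (rule r)
    have x: "x \<in> VAR S1" "sort_of S1 x = \<xi>" using ExI by (auto simp: vars_def)
    have gv: "gv \<psi> \<subseteq> ?V" using A.gv_VAR ExI(4) by blast
    have "R (subst [x] [a] \<psi>) = subst [\<rho> x] [R a] (R \<psi>)"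
      using R_subst[OF av _ _ ExI(4) gv, of "[x]" "[a]"] x by simp
    moreover have "Subb S2 (R a) (\<rho> x) (R \<psi>)" by (rule Subb_R[OF av ExI(3,4) gv ExI(5)])
    moreover have "\<rho> x \<in> vars S2 \<xi>" using x VAR_\<rho> sort_of_\<rho> by (simp add: vars_def)
    ultimately show "map_expr \<rho> \<phi> \<in> axioms S2"
      using ExI R_Exprs x axioms.ExI[of "\<rho> x" S2 \<xi> "R a" "R \<psi>"] by (simp add: R_simps sorts)
  qed simp
next
  case (AllI x \<chi> \<psi>)
  show ?thesis
  proof (intro exI[of _ "{x}"] conjI allI impI)
    fix \<rho> assume r: "renaming S1 S2 \<rho>" and av: "avoids S1 \<rho> {x}"
    interpret renaming S1 S2 \<rho> by (rule r)
    show "map_expr \<rho> \<phi> \<in> axioms S2"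
      using AllI R_Exprs VAR_\<rho> fv_R[OF av AllI(4), of x] axioms.AllI[of "\<rho> x" S2 "R \<chi>" "R \<psi>"]
      by (auto simp: R_simps sorts)
  qed (use AllI in auto)
next
  case (ExE x \<chi> \<psi>)
  show ?thesis
  proof (intro exI[of _ "{x}"] conjI allI impI)
    fix \<rho> assume r: "renaming S1 S2 \<rho>" and av: "avoids S1 \<rho> {x}"
    interpret renaming S1 S2 \<rho> by (rule r)
    show "map_expr \<rho> \<phi> \<in> axioms S2"
      using ExE R_Exprs VAR_\<rho> fv_R[OF av ExE(4), of x] axioms.ExE[of "\<rho> x" S2 "R \<chi>" "R \<psi>"]
      by (auto simp: R_simps sorts)
  qed (use ExE in auto)
next
  case (I1 \<gamma> a)
  have "map_expr \<rho> \<phi> \<in> axioms S2" if "renaming S1 S2 \<rho>" for \<rho>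
  proof -
    interpret renaming S1 S2 \<rho> by (rule that)
    show ?thesis using I1 R_Exprs axioms.I1[of \<gamma> S2 "R a"] by (simp add: R_simps sorts)
  qed
  then show ?thesis by (intro exI[of _ "{}"]) simp
next
  case (I2 f \<gamma> \<alpha>s \<beta>ss \<Delta> xs b1 \<Gamma> ys b2 zs)
  let ?W = "set zs \<union> set xs \<union> set ys \<union> gv b1 \<union> gv b2"
  let ?V = "VAR S1 \<inter> ?W"
  show ?thesis
  proof (intro exI[of _ ?V] conjI allI impI)
    show "finite ?V" using finite_subset[OF gv_subset_set_expr finite_set_expr] by blast
    fix \<rho> assume r: "renaming S1 S2 \<rho>" and av: "avoids S1 \<rho> ?V"
    interpret renaming S1 S2 \<rho> by (rule r)
    have 1: "args_ok S1 \<alpha>s \<beta>ss (\<Delta> @ (xs, b1) # \<Gamma>)" and 2: "args_ok S1 \<alpha>s \<beta>ss (\<Delta> @ (ys, b2) # \<Gamma>)"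
      using I2 by (auto simp: Op_in_Exprs_iff)
    have "?W \<subseteq> VAR S1"
      using VAR_seq[OF I2(6)] VAR_seq[OF args_ok_middle(2)[OF 1]] VAR_seq[OF args_ok_middle(2)[OF 2]]
        A.gv_VAR[OF args_ok_middle(4)[OF 1]] A.gv_VAR[OF args_ok_middle(4)[OF 2]] by blast
    then have "?V = ?W" by blast
    then show "map_expr \<rho> \<phi> \<in> axioms S2" using I2_R[OF _ I2(2-7)] av I2(1) by simp
  qed simp
qed

text \<open>A derivation uses finitely many axioms, and \<open>V\<close> collects their critical
  variables. Generalization contributes none: it has no side condition, so a constant may even
  become the generalized variable.\<close>

lemma renaming_derivable:
  assumes "derivable S1 \<Gamma> \<phi>"
  shows "\<exists>V. finite V \<and> V \<subseteq> VAR S1 \<and>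
    (\<forall>\<rho>. renaming S1 S2 \<rho> \<longrightarrow> avoids S1 \<rho> V \<longrightarrow> derivable S2 (map_expr \<rho> ` \<Gamma>) (map_expr \<rho> \<phi>))"
    (is "\<exists>V. ?P V \<phi>")
  using assms
proof (induction rule: derivable.induct)
  case (Axiom \<phi>)
  obtain V where V: "finite V" "V \<subseteq> VAR S1"
    "\<forall>\<rho>. renaming S1 S2 \<rho> \<longrightarrow> avoids S1 \<rho> V \<longrightarrow> map_expr \<rho> \<phi> \<in> axioms S2"
    using renaming_axiom[OF Axiom, of S2] by (elim exE conjE)
  then have "?P V \<phi>" using derivable.Axiom[of _ S2] by simp
  then show ?case ..
next
  case (Assumption \<phi>)
  then show ?case by (intro exI[of _ "{}"]) (auto intro: derivable.Assumption)
next
  case (ModusPonens \<phi> \<psi>)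
  then obtain V W where V: "?P V \<phi>" and W: "?P W (Imp S1 \<phi> \<psi>)" by (elim exE)
  have "derivable S2 (map_expr \<rho> ` \<Gamma>) (map_expr \<rho> \<psi>)" if r: "renaming S1 S2 \<rho>" and "avoids S1 \<rho> (V \<union> W)" for \<rho>
  proof -
    have av: "avoids S1 \<rho> V" "avoids S1 \<rho> W" using that(2) by (simp_all add: avoids_Un)
    have "derivable S2 (map_expr \<rho> ` \<Gamma>) (map_expr \<rho> \<phi>)" using V r av by simp
    moreover have "derivable S2 (map_expr \<rho> ` \<Gamma>) (map_expr \<rho> (Imp S1 \<phi> \<psi>))" using W r av by simp
    ultimately show ?thesis unfolding renaming.R_simps(4)[OF r] by (rule derivable.ModusPonens)
  qed
  then have "?P (V \<union> W) \<psi>" using V W by simp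
  then show ?case ..
next
  case (Generalization \<phi> x)
  then obtain V where V: "?P V \<phi>" by (elim exE)
  have "derivable S2 (map_expr \<rho> ` \<Gamma>) (map_expr \<rho> (Forall S1 x \<phi>))" if r: "renaming S1 S2 \<rho>" and "avoids S1 \<rho> V" for \<rho>
  proof -
    have "derivable S2 (map_expr \<rho> ` \<Gamma>) (map_expr \<rho> \<phi>)" using V that by simp
    then show ?thesis unfolding renaming.R_simps(8)[OF r Generalization.hyps(2)]
      by (rule derivable.Generalization) (rule renaming.VAR_\<rho>[OF r Generalization.hyps(2)])
  qed
  then have "?P V (Forall S1 x \<phi>)" using V by simp
  then show ?case ..
qed


section \<open>Witness constants\<close>

text \<open>\<open>Wit x \<phi>\<close> is the witness for \<open>\<exists>x \<phi>\<close>. It contains \<open>\<phi>\<close>, so that it is larger than every symbol of \<open>\<phi>\<close>;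
  this replaces the usual tower of extensions of the language.\<close>

datatype 's hsym = Base 's | Wit 's "'s hsym expr"

text \<open>Well-formedness of the formula inside a witness constant would refer back to the
  signature being defined. The condition only asks that the symbols of \<open>S\<close> in it, at
  any depth, belong to the language; the coding of expressions depends on this.\<close>

definition hext :: "('srt, 's) signature \<Rightarrow> ('srt, 's hsym) signature" where
  "hext S = \<lparr> SRT = SRT S, VSRT = VSRT S,
     SOP = Base ` SOP S \<union> {c. \<exists>x \<phi>. c = Wit x \<phi> \<and> x \<in> VAR S \<and> set_hsym c \<subseteq> SOP S \<union> VAR S},
     VAR = Base ` VAR S,
     sig = (\<lambda>s. case s of Base f \<Rightarrow> sig S f | Wit x \<phi> \<Rightarrow> (sort_of S x, [], [])),
     form_sort = form_sort S,
     top_sym = Base (top_sym S), bot_sym = Base (bot_sym S), neg_sym = Base (neg_sym S),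
     imp_sym = Base (imp_sym S), con_sym = Base (con_sym S), dis_sym = Base (dis_sym S),
     iff_sym = Base (iff_sym S), all_sym = (\<lambda>\<alpha>. Base (all_sym S \<alpha>)),
     ex_sym = (\<lambda>\<alpha>. Base (ex_sym S \<alpha>)), eq_sym = (\<lambda>\<alpha>. Base (eq_sym S \<alpha>)) \<rparr>"

definition witness_axiom :: "('srt, 's) signature \<Rightarrow> 's \<Rightarrow> 's hsym expr \<Rightarrow> 's hsym expr" where
  "witness_axiom S x \<phi> =
     Imp (hext S) (Exists (hext S) (Base x) \<phi>) (subst [Base x] [Op (Wit x \<phi>) []] \<phi>)"

lemma size_symbol: "s \<in> set_expr e \<Longrightarrow> size s \<le> size_expr size e"
proof (induction e rule: expr_induct)
  case (Op f args)
  have *: "size_prod (size_list size) (size_expr size) p \<le> size_list (size_prod (size_list size) (size_expr size)) args"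
    if "p \<in> set args" for p
    using size_list_estimation'[OF that order_refl] .
  have "size s \<le> size_list (size_prod (size_list size) (size_expr size)) args"
    if p: "(vs, a) \<in> set args" and s: "s \<in> set vs \<union> set_expr a" for vs a
  proof (cases "s \<in> set vs")
    case True
    have "size s \<le> size_list size vs" using size_list_estimation'[OF True order_refl] .
    then show ?thesis using *[OF p] by simp
  next
    case False
    then show ?thesis using *[OF p] Op.IH[OF p] s by simp
  qed
  note * = this
  show ?case using Op.prems by (auto simp: set_expr_Op dest!: * intro: le_SucI trans_le_add2 simp del: expr.set)
qed

text \<open>In particular a witness constant occurs neither in its own formula nor in the formula of
  a witness of at most its size.\<close>

lemma Wit_fresh: "Wit x \<phi> \<in> set_expr \<psi> \<Longrightarrow> size (Wit x \<phi>) < size (Wit y \<psi>)"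
  using size_symbol[of "Wit x \<phi>" \<psi>] by simp

lemma set_expr_fsub: "set_expr (fsub \<sigma> e) \<subseteq> set_expr e \<union> (\<Union>x \<in> frs e. set_expr (\<sigma> x))"
proof (induction e arbitrary: \<sigma> rule: expr_induct)
  case (Op f args)
  show ?case
  proof (cases "args = []")
    case False
    have "set_expr (fsub (\<lambda>x. if x \<in> set vs then Var x else \<sigma> x) a)
        \<subseteq> set_expr (Op f args) \<union> (\<Union>x \<in> frs (Op f args). set_expr (\<sigma> x))"
      if m: "(vs, a) \<in> set args" for vs a
    proof
      fix s assume "s \<in> set_expr (fsub (\<lambda>x. if x \<in> set vs then Var x else \<sigma> x) a)"
      then consider "s \<in> set_expr a" | x where "x \<in> frs a" "s \<in> set_expr (if x \<in> set vs then Var x else \<sigma> x)"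
        using Op[OF m, of "\<lambda>x. if x \<in> set vs then Var x else \<sigma> x"] by blast
      then show "s \<in> set_expr (Op f args) \<union> (\<Union>x \<in> frs (Op f args). set_expr (\<sigma> x))"
      proof cases
        case 1
        then show ?thesis using m unfolding set_expr_Op by blast
      next
        case 2
        show ?thesis
        proof (cases "x \<in> set vs")
          case True
          then have "s = x" using 2 by simp
          then show ?thesis using True m unfolding set_expr_Op by blast
        next
          case False
          then have "x \<in> frs (Op f args)" using 2 m by auto
          then show ?thesis using 2 False by auto
        qed
      qed
    qed
    note * = this
    have "set_expr (fsub \<sigma> (Op f args)) = insert f (\<Union>(vs, a) \<in> set args. set vs \<union>
        set_expr (fsub (\<lambda>x. if x \<in> set vs then Var x else \<sigma> x) a))"
      using False by (simp add: fsub.simps set_expr_Op split_beta del: expr.set)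
    also have "\<dots> \<subseteq> set_expr (Op f args) \<union> (\<Union>x \<in> frs (Op f args). set_expr (\<sigma> x))"
    proof (intro insert_subsetI UN_least, goal_cases)
      case (2 p)
      have "set (fst p) \<subseteq> set_expr (Op f args)" using 2 unfolding set_expr_Op by auto
      then show ?case using *[of "fst p" "snd p"] 2 by (simp add: split_beta le_supI1 del: frs.simps expr.set)
    qed (simp add: set_expr_Op del: expr.set)
    finally show ?thesis .
  qed (auto simp: fsub.simps)
qed

context sgn
begin

abbreviation H where "H \<equiv> hext S"

lemma hext_simps [simp]:
  "SRT H = SRT S" "VSRT H = VSRT S" "VAR H = Base ` VAR S" "sig H (Base f) = sig S f"
  "sig H (Wit x \<phi>) = (sort_of S x, [], [])" "Base f \<in> SOP H \<longleftrightarrow> f \<in> SOP S"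
  by (auto simp: hext_def)

lemma hext_form: "form_sort H = \<pi>"
  by (simp add: hext_def)

lemma vars_hext: "vars H \<alpha> = Base ` vars S \<alpha>"
  by (auto simp: vars_def)

lemma hext_signature: "is_signature H"
proof -
  have "SOP H \<inter> VAR H = {}" using disj by (auto simp: hext_def)
  moreover have "\<exists>r. well_order_on (SOP H \<union> VAR H) r" by (rule well_order_on)
  moreover have "\<forall>f \<in> SOP H \<union> VAR H. \<forall>\<gamma> \<alpha>s \<beta>ss. sig H f = (\<gamma>, \<alpha>s, \<beta>ss) \<longrightarrow>
        \<gamma> \<in> SRT S \<and> set \<alpha>s \<subseteq> SRT S \<and> length \<beta>ss = length \<alpha>s \<and> (\<forall>\<beta>s \<in> set \<beta>ss. set \<beta>s \<subseteq> VSRT S)"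
  proof (intro ballI allI impI, goal_cases)
    case (1 f \<gamma> \<alpha>s \<beta>ss)
    show ?case
    proof (cases f)
      case (Base g)
      then show ?thesis using sig_wf[of g \<gamma> \<alpha>s \<beta>ss] 1 by auto
    next
      case (Wit x \<phi>)
      then have "x \<in> VAR S" using 1(1) by (auto simp: hext_def)
      then have "sort_of S x \<in> SRT S" using sig_VAR VSRT_SRT by blast
      then show ?thesis using 1(2) Wit by simp
    qed
  qed
  moreover have "\<forall>x \<in> VAR H. \<exists>\<gamma> \<in> VSRT S. sig H x = (\<gamma>, [], [])"
    using sig_VAR by (auto simp: prod_eq_iff)
  moreover have "\<forall>\<alpha> \<in> VSRT S. countable (vars H \<alpha>) \<and> infinite (vars H \<alpha>)"
    using sgn infinite_vars unfolding is_signature_def vars_hext by (simp add: finite_image_iff inj_on_def)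
  ultimately show ?thesis
    using sgn sym_sigs VSRT_SRT \<pi>_SRT unfolding is_signature_def hext_simps hext_form
    by (simp add: hext_def)
qed

end

section \<open>The extended language and the conservativity of witness axioms\<close>

locale sgn_ext = sgn S + H: sgn "hext S" for S :: "('srt, 's) signature"
begin

lemma renaming_Base: "renaming S H Base"
  by unfold_locales (auto simp: inj_on_def, auto simp: hext_def)

lemma Wit_closed: "x \<in> VAR S \<Longrightarrow> \<phi> \<in> H.F \<Longrightarrow> Op (Wit x \<phi>) [] \<in> closed H (sort_of S x)"
proof -
  assume x: "x \<in> VAR S" and \<phi>: "\<phi> \<in> H.F"
  have "set_hsym s \<subseteq> SOP S \<union> VAR S" if "s \<in> set_expr \<phi>" for s
    using H.set_expr_syms[OF \<phi>] that by (auto simp: hext_def)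
  then have "Wit x \<phi> \<in> SOP H" using x by (auto simp: hext_def)
  then show ?thesis using H.disj by (auto simp: closed_def Op_in_Exprs_iff args_ok_def)
qed

lemma witness_axiom_closed:
  assumes "x \<in> VAR S" "\<phi> \<in> H.F" "fv H \<phi> \<subseteq> {Base x}"
  shows "witness_axiom S x \<phi> \<in> closed H H.\<pi>"
proof -
  have "subst [Base x] [Op (Wit x \<phi>) []] \<phi> \<in> closed H H.\<pi>"
    using assms Wit_closed[of x \<phi>] by (intro H.subst_closeds) (auto simp: H.closeds_Cons)
  then show ?thesis using assms H.F_intros(4,9) by (auto simp: witness_axiom_def closed_def)
qed

text \<open>With \<open>E\<close> for \<open>\<exists>x \<phi>\<close>, the deduction theorem and
  the replacement of the constant by \<open>y\<close> yield
  \<open>(E \<longrightarrow> \<phi>(y)) \<longrightarrow> \<psi>\<close>. This implies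
  \<open>\<phi>(y) \<longrightarrow> \<psi>\<close>, hence \<open>E \<longrightarrow> \<psi>\<close>
  since \<open>y\<close> is not free in \<open>\<psi>\<close>; and it gives \<open>\<psi>\<close>
  directly when \<open>E\<close> fails.\<close>

lemma witness_elim:
  assumes d: "derivable H (insert (witness_axiom S x \<phi>) \<Delta>) \<psi>"
    and \<Delta>: "\<Delta> \<subseteq> H.F" and \<psi>: "\<psi> \<in> H.F" and x: "x \<in> VAR S" and \<phi>: "\<phi> \<in> H.F" "fv H \<phi> \<subseteq> {Base x}"
    and fresh: "\<And>\<delta>. \<delta> \<in> insert \<psi> \<Delta> \<Longrightarrow> Wit x \<phi> \<notin> set_expr \<delta>"
  shows "derivable H \<Delta> \<psi>"
proof -
  let ?c = "Wit x \<phi>"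
  let ?E = "Exists H (Base x) \<phi>"
  have wc: "witness_axiom S x \<phi> \<in> H.F" "fv H (witness_axiom S x \<phi>) = {}"
    using witness_axiom_closed[OF x \<phi>] by (auto simp: closed_def)
  have 1: "derivable H \<Delta> (Imp H (witness_axiom S x \<phi>) \<psi>)"
    using H.deduction[OF d \<Delta>] wc by simp
  obtain V where V: "finite V" "V \<subseteq> VAR H" and ren:
    "\<forall>\<rho>. renaming H H \<rho> \<longrightarrow> avoids H \<rho> V \<longrightarrow>
       derivable H (map_expr \<rho> ` \<Delta>) (map_expr \<rho> (Imp H (witness_axiom S x \<phi>) \<psi>))"
    using renaming_derivable[OF 1, of H] by (elim exE conjE)
  have xs: "sort_of S x \<in> VSRT S" using sig_VAR x by blast
  \<comment> \<open>Avoiding \<open>V\<close> preserves the derivation, avoiding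
    \<open>\<phi>\<close> permits the change of bound variable, and avoiding \<open>\<psi>\<close>
    permits the elimination of the existential quantifier. \<open>\<Delta>\<close> may contain
    \<open>y\<close>, as generalization is unrestricted.\<close>
  let ?X = "V \<union> {Base x} \<union> set_expr \<phi> \<union> set_expr \<psi>"
  obtain y where y: "y \<in> vars H (sort_of S x)" "y \<notin> ?X"
    using infinite_imp_nonempty[OF Diff_infinite_finite[OF _ H.infinite_vars], of ?X "sort_of S x"] V xs by auto
  have yV: "y \<in> VAR H" "sort_of H y = sort_of S x" using y by (auto simp: vars_def)
  define \<rho> where "\<rho> = (\<lambda>s. if s = ?c then y else s)"
  have c: "?c \<notin> VAR H" "\<And>f. ?c \<noteq> Base f" by auto
  have r: "renaming H H \<rho>"
  proof unfold_locales
    fix f assume "f \<in> SOP H \<union> VAR H"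
    then show "sig H (\<rho> f) = sig H f" using yV H.sig_VAR[OF yV(1)] by (auto simp: \<rho>_def prod_eq_iff)
  next
    show "inj_on \<rho> (VAR H)" using c by (auto simp: \<rho>_def inj_on_def)
  qed (use yV(1) c in \<open>auto simp: \<rho>_def hext_def\<close>)
  interpret R: renaming H H \<rho> by (rule r)
  have av: "avoids H \<rho> W" if "W \<subseteq> VAR H" "y \<notin> W" for W
    using that c H.disj by (auto simp: avoids_def \<rho>_def)
  have id: "map_expr \<rho> e = e" if "?c \<notin> set_expr e" for e
  proof -
    have "map_expr \<rho> e = map_expr id e" by (rule expr.map_cong0) (use that in \<open>auto simp: \<rho>_def\<close>)
    then show ?thesis by (simp add: expr.map_id)
  qed
  have c\<phi>: "?c \<notin> set_expr \<phi>" using Wit_fresh[of x \<phi> \<phi> x] by auto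
  let ?\<phi>' = "subst [Base x] [Var y] \<phi>"
  have "map_expr \<rho> (subst [Base x] [Op ?c []] \<phi>) = subst (map \<rho> [Base x]) (map (map_expr \<rho>) [Op ?c []]) (map_expr \<rho> \<phi>)"
  proof (rule R.R_subst[OF av _ _ \<phi>(1)])
    show "gv \<phi> \<union> {Base x} \<subseteq> VAR H" using H.gv_VAR[OF \<phi>(1)] x by auto
    show "y \<notin> gv \<phi> \<union> {Base x}" using y gv_subset_set_expr[of \<phi>] by auto
  qed auto
  then have sub: "map_expr \<rho> (subst [Base x] [Op ?c []] \<phi>) = ?\<phi>'"
    using id[OF c\<phi>] by (simp add: map_expr_Op \<rho>_def)
  have \<phi>': "?\<phi>' \<in> H.F" using \<phi>(1) x yV by (intro H.subst_Exprs) auto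
  have E: "?E \<in> H.F" using H.F_intros(9) \<phi>(1) x by auto
  have Ey: "Exists H y ?\<phi>' \<in> H.F" using H.F_intros(9)[OF yV(1) \<phi>'] .
  have "map_expr \<rho> ?E = ?E"
  proof -
    have "\<rho> (Base x) = Base x" by (simp add: \<rho>_def)
    then show ?thesis using x by (simp add: R.R_simps id[OF c\<phi>])
  qed
  then have wit: "map_expr \<rho> (witness_axiom S x \<phi>) = Imp H ?E ?\<phi>'"
    by (simp only: witness_axiom_def R.R_simps sub)
  have "map_expr \<rho> \<delta> = \<delta>" if "\<delta> \<in> insert \<psi> \<Delta>" for \<delta> using id[OF fresh[OF that]] .
  then have im: "map_expr \<rho> ` \<Delta> = \<Delta>" "map_expr \<rho> \<psi> = \<psi>" by force+
  have "avoids H \<rho> V" using av V y by blast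
  then have "derivable H (map_expr \<rho> ` \<Delta>) (map_expr \<rho> (Imp H (witness_axiom S x \<phi>) \<psi>))"
    using ren r by blast
  then have 2: "derivable H \<Delta> (Imp H (Imp H ?E ?\<phi>') \<psi>)" by (simp only: R.R_simps im wit)
  have 3: "derivable H \<Delta> (Imp H ?\<phi>' \<psi>)"
    by (rule H.prop1[OF 2]) (use E \<phi>' \<psi> in \<open>auto simp: boolean_valuation_def\<close>)
  have 4: "derivable H \<Delta> (Imp H (Exists H y ?\<phi>') \<psi>)"
    using y frs_subset_set_expr[of \<psi>] by (intro H.derivable_Exists_imp[OF 3 \<phi>' \<psi> yV(1)]) (auto simp: fv_eq_frs)
  have 5: "derivable H \<Delta> (Iff H ?E (Exists H y ?\<phi>'))"
    using y x \<phi>(1) by (intro H.derivable_Exists_rename) auto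
  have 6: "derivable H \<Delta> (Imp H ?E \<psi>)"
    by (rule H.prop2[OF 4 5]) (use E Ey \<psi> in \<open>auto simp: boolean_valuation_def\<close>)
  show ?thesis
    by (rule H.prop2[OF 2 6]) (use E \<phi>' \<psi> in \<open>auto simp: boolean_valuation_def\<close>)
qed

definition witness_pairs :: "('s \<times> 's hsym expr) set" where
  "witness_pairs = {(x, \<phi>). x \<in> VAR S \<and> \<phi> \<in> H.F \<and> fv H \<phi> \<subseteq> {Base x}}"

lemma set_expr_witness_axiom:
  "set_expr (witness_axiom S x \<phi>) \<subseteq> range Base \<union> set_expr \<phi> \<union> {Wit x \<phi>}"
proof -
  let ?\<sigma> = "bind [Base x] [Op (Wit x \<phi>) []]"
  have "(\<Union>z \<in> frs \<phi>. set_expr (?\<sigma> z)) \<subseteq> set_expr \<phi> \<union> {Wit x \<phi>}"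
    using frs_subset_set_expr[of \<phi>] by (auto split: if_splits)
  then have "set_expr (subst [Base x] [Op (Wit x \<phi>) []] \<phi>) \<subseteq> set_expr \<phi> \<union> {Wit x \<phi>}"
    using set_expr_fsub[of ?\<sigma> \<phi>] by (simp add: subst_eq_fsub) blast
  then show ?thesis
    by (auto simp: witness_axiom_def Imp_def Exists_def hext_def set_expr_Op simp del: expr.set)
qed

text \<open>The induction adds pairs by nondecreasing size, so a pair of maximal size is removed
  first. Ties are harmless: the symbols of \<open>\<chi>\<close> are strictly smaller than
  \<open>Wit z \<chi>\<close>, and a different pair gives a different constant.\<close>

lemma witnesses_elim:
  assumes "finite P" "P \<subseteq> witness_pairs" "derivable H (\<Gamma> \<union> (\<lambda>(x, \<phi>). witness_axiom S x \<phi>) ` P) \<psi>"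
    and "\<Gamma> \<subseteq> H.F" "\<psi> \<in> H.F" "\<And>\<delta>. \<delta> \<in> insert \<psi> \<Gamma> \<Longrightarrow> set_expr \<delta> \<subseteq> range Base"
  shows "derivable H \<Gamma> \<psi>"
  using assms(1-3)
proof (induction P rule: finite_ranking_induct[where f = "\<lambda>(x, \<phi>). size (Wit x \<phi>)"])
  case (insert p P)
  obtain x \<phi> where p: "p = (x, \<phi>)" by fastforce
  let ?\<Delta> = "\<Gamma> \<union> (\<lambda>(x, \<phi>). witness_axiom S x \<phi>) ` P"
  show ?case
  proof (cases "p \<in> P")
    case True
    then show ?thesis using insert by (simp add: insert_absorb)
  next
    case False
    have wp: "(x, \<phi>) \<in> witness_pairs" "P \<subseteq> witness_pairs" using insert.prems p by auto
    have "derivable H ?\<Delta> \<psi>"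
    proof (rule witness_elim)
      show "derivable H (Set.insert (witness_axiom S x \<phi>) ?\<Delta>) \<psi>" using insert.prems by (simp add: p)
      have "witness_axiom S z \<chi> \<in> H.F" if "(z, \<chi>) \<in> P" for z \<chi>
        using that wp(2) witness_axiom_closed[of z \<chi>] unfolding witness_pairs_def closed_def by blast
      then show "?\<Delta> \<subseteq> H.F" using assms(4) by auto
      show "x \<in> VAR S" "\<phi> \<in> H.F" "fv H \<phi> \<subseteq> {Base x}" using wp by (auto simp: witness_pairs_def)
      fix \<delta> assume "\<delta> \<in> Set.insert \<psi> ?\<Delta>"
      then consider "\<delta> \<in> Set.insert \<psi> \<Gamma>" | z \<chi> where "(z, \<chi>) \<in> P" "\<delta> = witness_axiom S z \<chi>" by auto
      then show "Wit x \<phi> \<notin> set_expr \<delta>"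
      proof cases
        case 1
        then show ?thesis using assms(6)[of \<delta>] by blast
      next
        case 2
        have "size (Wit z \<chi>) \<le> size (Wit x \<phi>)" using insert.hyps(2)[OF 2(1)] by (simp add: p)
        then have "Wit x \<phi> \<notin> set_expr \<chi>" using Wit_fresh[of x \<phi> \<chi> z] by linarith
        moreover have "Wit z \<chi> \<noteq> Wit x \<phi>" using False 2 p by auto
        ultimately show ?thesis using set_expr_witness_axiom[of z \<chi>] 2(2) by blast
      qed
    qed (rule assms(5))
    then show ?thesis using insert.IH wp(2) by blast
  qed
qed simp

text \<open>No assumption mentions a witness constant, so each can be read as a variable outside
  \<open>V\<close>. All constants with the same \<open>x\<close> share \<open>y x\<close>, since
  renamings may identify operations.\<close>

lemma hext_conservative:
  assumes "derivable H (map_expr Base ` \<Gamma>) (map_expr Base \<phi>)"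
  shows "derivable S \<Gamma> \<phi>"
proof -
  obtain V where V: "finite V" "V \<subseteq> VAR H" and ren:
    "\<forall>\<rho>. renaming H S \<rho> \<longrightarrow> avoids H \<rho> V \<longrightarrow>
       derivable S (map_expr \<rho> ` map_expr Base ` \<Gamma>) (map_expr \<rho> (map_expr Base \<phi>))"
    using renaming_derivable[OF assms, of S] by (elim exE conjE)
  have "\<exists>y. y \<in> vars S (sort_of S x) \<and> Base y \<notin> V" if "x \<in> VAR S" for x
  proof -
    have "infinite (vars H (sort_of S x) - V)"
      using V(1) H.infinite_vars[of "sort_of S x"] sig_VAR[OF that] by simp
    then have "vars H (sort_of S x) - V \<noteq> {}" by (rule infinite_imp_nonempty)
    then show ?thesis unfolding vars_hext by blast
  qed
  then obtain y where y: "\<And>x. x \<in> VAR S \<Longrightarrow> y x \<in> vars S (sort_of S x) \<and> Base (y x) \<notin> V" by metis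
  define \<rho> where "\<rho> = (\<lambda>s. case s of Base f \<Rightarrow> f | Wit x \<phi> \<Rightarrow> y x)"
  have yV: "y x \<in> VAR S" "sort_of S (y x) = sort_of S x" if "x \<in> VAR S" for x
    using y[OF that] by (auto simp: vars_def)
  have r: "renaming H S \<rho>"
  proof unfold_locales
    fix f assume f: "f \<in> SOP H \<union> VAR H"
    show "sig S (\<rho> f) = sig H f"
    proof (cases f)
      case (Wit x \<phi>)
      then have "x \<in> VAR S" using f by (auto simp: hext_def)
      then show ?thesis using yV[of x] sig_VAR[of "y x"] by (simp add: \<rho>_def Wit prod_eq_iff)
    qed (simp add: \<rho>_def)
  next
    fix f assume f: "f \<in> SOP H"
    then show "\<rho> f \<in> SOP S \<union> VAR S" using yV(1) by (auto simp: \<rho>_def hext_def)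
  qed (auto simp: \<rho>_def inj_on_def, auto simp: hext_def)
  have av: "avoids H \<rho> V"
    unfolding avoids_def
  proof (intro conjI ballI notI)
    fix v f assume v: "v \<in> V" and f: "f \<in> SOP H" and eq: "\<rho> f = \<rho> v"
    obtain v' where v': "v = Base v'" "v' \<in> VAR S" using v V(2) by auto
    show False
    proof (cases f)
      case (Base g)
      then show False using eq f v' disj by (auto simp: \<rho>_def)
    next
      case (Wit x \<phi>)
      then have "x \<in> VAR S" using f by (auto simp: hext_def)
      then show False using y[of x] eq v v' by (simp add: \<rho>_def Wit)
    qed
  qed (rule V(2))
  have "map_expr \<rho> (map_expr Base e) = e" for e
    by (simp add: expr.map_comp comp_def \<rho>_def expr.map_ident)
  then show ?thesis using ren[rule_format, OF r av] by (simp add: image_comp comp_def)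
qed

end

lemma (in sgn) sgn_ext: "sgn_ext S"
  by (simp add: sgn_ext_def sgn_axioms sgn.intro hext_signature)

section \<open>Complete theories with witnesses\<close>

text \<open>\<open>\<Gamma>\<close> may contain open formulas. These stand for their universal
  closures, and the negation of an open formula is stronger than that of its closure; so only closed
  formulas are required to be decided.\<close>

locale henkin = sgn S for S :: "('srt, 's) signature" +
  fixes \<Gamma> :: "'s expr set"
  assumes \<Gamma>_F: "\<Gamma> \<subseteq> F"
    and consistent: "\<not> derivable S \<Gamma> (Bot S)"
    and complete: "\<psi> \<in> closed S \<pi> \<Longrightarrow> derivable S \<Gamma> \<psi> \<or> derivable S \<Gamma> (Neg S \<psi>)"
    and henkin: "x \<in> VAR S \<Longrightarrow> \<phi> \<in> F \<Longrightarrow> fv S \<phi> \<subseteq> {x} \<Longrightarrow> derivable S \<Gamma> (Exists S x \<phi>) \<Longrightarrow>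
      \<exists>c \<in> closed S (sort_of S x). derivable S \<Gamma> (subst [x] [c] \<phi>)"
begin

abbreviation D where "D \<equiv> derivable S \<Gamma>"

lemma D_F: "D \<phi> \<Longrightarrow> \<phi> \<in> F"
  using derivable_F \<Gamma>_F by blast

lemma closed_F: "\<phi> \<in> closed S \<pi> \<Longrightarrow> \<phi> \<in> F"
  by (rule closed_Exprs)

section \<open>Derivability of closed formulas as a truth assignment\<close>

lemma D_Top: "D (Top S)"
  by (rule prop0) (auto simp: boolean_valuation_def)

lemma not_both:
  assumes "D a" "D (Neg S a)"
  shows False
proof -
  have a: "a \<in> F" using D_F assms(1) by blast
  have "D (Bot S)" by (rule prop2[OF assms]) (use a in \<open>auto simp: boolean_valuation_def\<close>)
  then show False using consistent by blast
qed

lemma D_Neg: "a \<in> closed S \<pi> \<Longrightarrow> D (Neg S a) \<longleftrightarrow> \<not> D a"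
  using complete not_both by blast

lemma D_Con: assumes "a \<in> closed S \<pi>" "b \<in> closed S \<pi>" shows "D (Con S a b) \<longleftrightarrow> D a \<and> D b"
proof -
  have F: "a \<in> F" "b \<in> F" using assms closed_F by auto
  have "D a" if "D (Con S a b)" by (rule prop1[OF that]) (use F in \<open>auto simp: boolean_valuation_def\<close>)
  moreover have "D b" if "D (Con S a b)" by (rule prop1[OF that]) (use F in \<open>auto simp: boolean_valuation_def\<close>)
  moreover have "D (Con S a b)" if "D a" "D b"
    by (rule prop2[OF that]) (use F in \<open>auto simp: boolean_valuation_def\<close>)
  ultimately show ?thesis by blast
qed

lemma D_Imp: assumes "a \<in> closed S \<pi>" "b \<in> closed S \<pi>" shows "D (Imp S a b) \<longleftrightarrow> (D a \<longrightarrow> D b)"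
proof -
  have F: "a \<in> F" "b \<in> F" using assms closed_F by auto
  have "D (Imp S a b)" if "D b" by (rule prop1[OF that]) (use F in \<open>auto simp: boolean_valuation_def\<close>)
  moreover have "D (Imp S a b)" if "D (Neg S a)" by (rule prop1[OF that]) (use F in \<open>auto simp: boolean_valuation_def\<close>)
  ultimately show ?thesis using derivable.ModusPonens D_Neg[OF assms(1)] by blast
qed

lemma D_Dis: assumes "a \<in> closed S \<pi>" "b \<in> closed S \<pi>" shows "D (Dis S a b) \<longleftrightarrow> D a \<or> D b"
proof -
  have F: "a \<in> F" "b \<in> F" using assms closed_F by auto
  have "D (Dis S a b)" if "D a" by (rule prop1[OF that]) (use F in \<open>auto simp: boolean_valuation_def\<close>)
  moreover have "D (Dis S a b)" if "D b" by (rule prop1[OF that]) (use F in \<open>auto simp: boolean_valuation_def\<close>)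
  moreover have "D b" if "D (Dis S a b)" "D (Neg S a)"
    by (rule prop2[OF that]) (use F in \<open>auto simp: boolean_valuation_def\<close>)
  ultimately show ?thesis using D_Neg[OF assms(1)] by blast
qed

lemma D_Iff: assumes "a \<in> closed S \<pi>" "b \<in> closed S \<pi>" shows "D (Iff S a b) \<longleftrightarrow> (D a \<longleftrightarrow> D b)"
proof -
  have F: "a \<in> F" "b \<in> F" using assms closed_F by auto
  have "D (Iff S a b)" if "D (Imp S a b)" "D (Imp S b a)"
    by (rule prop2[OF that]) (use F in \<open>auto simp: boolean_valuation_def\<close>)
  moreover have "D (Imp S a b)" if "D (Iff S a b)"
    by (rule prop1[OF that]) (use F in \<open>auto simp: boolean_valuation_def\<close>)
  moreover have "D (Imp S b a)" if "D (Iff S a b)"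
    by (rule prop1[OF that]) (use F in \<open>auto simp: boolean_valuation_def\<close>)
  ultimately show ?thesis using D_Imp assms by blast
qed

lemma D_ExI:
  assumes "x \<in> VAR S" "\<phi> \<in> F" "c \<in> Exprs S (sort_of S x)" "Subb S c x \<phi>" "D (subst [x] [c] \<phi>)"
  shows "D (Exists S x \<phi>)"
  by (rule derivable.ModusPonens[OF assms(5)], rule derivable.Axiom, rule axioms.ExI[of x S "sort_of S x"])
    (use assms in \<open>auto simp: vars_def\<close>)

text \<open>The sort has a variable, so \<open>\<exists>x \<top>\<close> is derivable, and its
  witness is a closed expression.\<close>

lemma closed_inhabited:
  assumes "\<alpha> \<in> VSRT S"
  shows "closed S \<alpha> \<noteq> {}"
proof -
  obtain x where x: "x \<in> VAR S" "sort_of S x = \<alpha>"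
    using infinite_imp_nonempty[OF infinite_vars[OF assms]] by (auto simp: vars_def)
  have "D (Exists S x (Top S))"
    using x subst_same[of "[x]" "Top S"] D_Top by (intro D_ExI[of x _ "Var x"]) (auto simp: Subb_self)
  then show ?thesis using henkin[of x "Top S"] x by auto
qed

lemma closeds_exist:
  assumes "set vs \<subseteq> VAR S"
  shows "\<exists>ts. closeds S vs ts"
proof -
  have "\<forall>x \<in> set vs. \<exists>t. t \<in> closed S (sort_of S x)"
    using assms closed_inhabited sig_VAR by blast
  then obtain t where "\<forall>x \<in> set vs. t x \<in> closed S (sort_of S x)" by metis
  then have "closeds S vs (map t vs)" by (auto simp: closeds_def list_all2_map2 intro!: list.rel_refl_strong)
  then show ?thesis ..
qed

text \<open>Its free variables have sorts with closed expressions, which can be substituted. So a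
  sort without closed expressions has no expressions whatsoever.\<close>

lemma closed_inhabitedI:
  assumes "e \<in> Exprs S \<gamma>"
  shows "closed S \<gamma> \<noteq> {}"
proof -
  have "finite (fv S e)" using frs_subset_set_expr[of e] by (auto simp: fv_eq_frs intro: finite_subset)
  then obtain vs where vs: "set vs = fv S e" using finite_list by blast
  then have V: "set vs \<subseteq> VAR S" by (auto simp: fv_eq_frs)
  obtain ts where "closeds S vs ts" using closeds_exist[OF V] by blast
  then have "subst vs ts e \<in> closed S \<gamma>" using subst_closeds assms V vs by blast
  then show ?thesis by blast
qed

lemma subst_Neg: "subst xs ds (Neg S a) = Neg S (subst xs ds a)"
  by (simp add: Neg_def subst_Op)

lemma subst_Eq: "subst xs ds (Eq S \<gamma> a b) = Eq S \<gamma> (subst xs ds a) (subst xs ds b)"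
  by (simp add: Eq_def subst_Op)

lemma subst_Foralls:
  assumes "z \<notin> set zs"
  shows "subst [z] [c] (Foralls S zs a) = Foralls S zs (subst [z] [c] a)"
  using assms
proof (induction zs)
  case (Cons x zs)
  let ?a = "Foralls S zs a"
  have "subst [z, x] [c, Var x] ?a = subst [z] [c] ?a"
    using Cons.prems bind_append[of "[z]" "[c]" "[x]" "[Var x]"]
    by (auto simp: subst_eq_fsub intro!: fsub_cong)
  then have "subst [z] [c] (Forall S x ?a) = Forall S x (subst [z] [c] ?a)"
    by (simp add: Forall_def subst_Op)
  then show ?case using Cons by (simp add: Foralls_def)
qed (simp add: Foralls_def)

text \<open>\<open>\<exists>x \<not>\<phi>\<close> can have no witness, so its negation is
  derivable. The instance of \<open>ExI\<close> at \<open>x\<close> itself then gives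
  \<open>\<phi>\<close> with \<open>x\<close> free, ready for generalization.\<close>

lemma D_Forall:
  assumes "x \<in> VAR S" "\<phi> \<in> F" "fv S \<phi> \<subseteq> {x}"
    and "\<And>c. c \<in> closed S (sort_of S x) \<Longrightarrow> D (subst [x] [c] \<phi>)"
  shows "D (Forall S x \<phi>)"
proof -
  let ?E = "Exists S x (Neg S \<phi>)"
  have E: "?E \<in> closed S \<pi>" using assms(1-3) by (auto simp: closed_def)
  have "\<not> D ?E"
  proof
    assume "D ?E"
    then obtain c where "c \<in> closed S (sort_of S x)" "D (subst [x] [c] (Neg S \<phi>))"
      using henkin[of x "Neg S \<phi>"] assms(1-3) by auto
    then show False using assms(4)[of c] not_both[of "subst [x] [c] \<phi>"] by (simp add: subst_Neg)
  qed
  then have 1: "D (Neg S ?E)" using D_Neg[OF E] by blast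
  have "Imp S (subst [x] [Var x] (Neg S \<phi>)) ?E \<in> axioms S"
    using assms(1,2) by (intro axioms.ExI[of _ _ "sort_of S x"]) (auto simp: vars_def Subb_self)
  then have 2: "D (Imp S (Neg S \<phi>) ?E)" using subst_same[of "[x]"] by (simp add: derivable.Axiom)
  have "D \<phi>" by (rule prop2[OF 1 2]) (use assms(2) closed_F[OF E] in \<open>auto simp: boolean_valuation_def\<close>)
  then show ?thesis using assms(1) by (rule derivable.Generalization)
qed

lemma D_Foralls:
  assumes "distinct zs" "set zs \<subseteq> VAR S" "\<phi> \<in> F" "fv S \<phi> \<subseteq> set zs"
    and "\<And>cs. closeds S zs cs \<Longrightarrow> D (subst zs cs \<phi>)"
  shows "D (Foralls S zs \<phi>)"
  using assms
proof (induction zs arbitrary: \<phi>)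
  case Nil
  then show ?case by (simp add: Foralls_def)
next
  case (Cons z zs)
  have "D (Forall S z (Foralls S zs \<phi>))"
  proof (rule D_Forall)
    fix c assume c: "c \<in> closed S (sort_of S z)"
    have cz: "closeds S [z] [c]" using c by (simp add: closeds_Cons)
    have "D (Foralls S zs (subst [z] [c] \<phi>))"
    proof (rule Cons.IH)
      show "subst [z] [c] \<phi> \<in> F" using Cons.prems c by (intro subst_Exprs) (auto simp: closed_def)
      have "fv S c = {}" using c by (rule closed_fv)
      moreover have "fv S (subst [z] [c] \<phi>) \<subseteq> (fv S \<phi> - {z}) \<union> fv S c \<union> {x \<in> fv S \<phi>. x = z \<and> Var x = c}"
        using fv_subst[of "[z]" "[c]" \<phi>] by simp
      ultimately show "fv S (subst [z] [c] \<phi>) \<subseteq> set zs" using Cons.prems(2,4) by auto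
      fix cs assume cs: "closeds S zs cs"
      have l: "length zs = length cs" using cs by (rule closeds_length)
      have "subst zs cs (subst [z] [c] \<phi>) = subst (zs @ [z]) (cs @ [c]) \<phi>"
        using Cons.prems(2) l by (intro subst_append[OF cz Cons.prems(3)]) auto
      \<comment> \<open>\<open>subst_append\<close> leaves \<open>z\<close> at the end of the list;
        for distinct variables the order is immaterial.\<close>
      also have "\<dots> = subst (z # zs) (c # cs) \<phi>"
      proof -
        have "bind (zs @ [z]) (cs @ [c]) x = bind ([z] @ zs) ([c] @ cs) x" for x
          using bind_append[of zs cs "[z]" "[c]" x] bind_append[of "[z]" "[c]" zs cs x] l Cons.prems(1)
            bind_notin[OF l, of x] by auto
        then have "bind (zs @ [z]) (cs @ [c]) = bind (z # zs) (c # cs)" by (simp add: fun_eq_iff)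
        then show ?thesis using l by (simp add: subst_eq_fsub)
      qed
      finally show "D (subst zs cs (subst [z] [c] \<phi>))"
        using Cons.prems(5)[of "c # cs"] c cs by (simp add: closeds_Cons)
    qed (use Cons.prems in auto)
    then show "D (subst [z] [c] (Foralls S zs \<phi>))" using Cons.prems(1) by (simp add: subst_Foralls)
  qed (use Cons.prems in auto)
  then show ?case by (simp add: Foralls_def)
qed

section \<open>Provable equality is a congruence\<close>

lemma D_Eq_refl: "a \<in> Exprs S \<gamma> \<Longrightarrow> D (Eq S \<gamma> a a)"
  using Expr_SRT by (intro derivable.Axiom axioms.I1) auto

text \<open>This is \<open>I2\<close> for the equality symbol itself, in its first argument; the
  resulting equation between formulas is a biconditional. Symmetry and transitivity follow from it
  propositionally.\<close>

lemma D_Eq_left: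
  assumes "D (Eq S \<gamma> a b)" "a \<in> Exprs S \<gamma>" "b \<in> Exprs S \<gamma>" "c \<in> Exprs S \<gamma>"
  shows "D (Iff S (Eq S \<gamma> a c) (Eq S \<gamma> b c))"
proof -
  have \<gamma>: "\<gamma> \<in> SRT S" using assms(2) by (rule Expr_SRT)
  have "Imp S (Foralls S [] (Eq S ([\<gamma>, \<gamma>] ! length ([] :: ('s list \<times> 's expr) list))
          (subst [] (map Var []) a) (subst [] (map Var []) b)))
       (Eq S \<pi> (Op (eq_sym S \<gamma>) ([] @ ([], a) # [([], c)])) (Op (eq_sym S \<gamma>) ([] @ ([], b) # [([], c)]))) \<in> axioms S"
  proof (rule axioms.I2[where \<beta>ss = "[[], []]"])
    show "Op (eq_sym S \<gamma>) ([] @ [([], a), ([], c)]) \<in> F" "Op (eq_sym S \<gamma>) ([] @ [([], b), ([], c)]) \<in> F"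
      using F_intros(10)[OF \<gamma>] assms by (simp_all add: Eq_def)
  qed (use \<gamma> in \<open>auto simp: sym_sigs var_seqs_def\<close>)
  then have "D (Imp S (Eq S \<gamma> a b) (Iff S (Eq S \<gamma> a c) (Eq S \<gamma> b c)))"
    by (intro derivable.Axiom) (simp add: Foralls_def Eq_def[of S \<gamma>])
  then show ?thesis using assms(1) derivable.ModusPonens by blast
qed

lemma D_Eq_sym:
  assumes "D (Eq S \<gamma> a b)" "a \<in> Exprs S \<gamma>" "b \<in> Exprs S \<gamma>"
  shows "D (Eq S \<gamma> b a)"
proof -
  have \<gamma>: "\<gamma> \<in> SRT S" using assms(2) by (rule Expr_SRT)
  show ?thesis
    by (rule prop2[OF D_Eq_left[OF assms assms(2)] D_Eq_refl[OF assms(2)]])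
      (use F_intros(10)[OF \<gamma>] assms(2,3) in \<open>auto simp: boolean_valuation_def\<close>)
qed

lemma D_Eq_trans:
  assumes "D (Eq S \<gamma> a b)" "D (Eq S \<gamma> b c)" "a \<in> Exprs S \<gamma>" "b \<in> Exprs S \<gamma>" "c \<in> Exprs S \<gamma>"
  shows "D (Eq S \<gamma> a c)"
proof -
  have \<gamma>: "\<gamma> \<in> SRT S" using assms(3) by (rule Expr_SRT)
  show ?thesis
    by (rule prop2[OF D_Eq_left[OF assms(1,3-5)] assms(2)])
      (use F_intros(10)[OF \<gamma>] assms(3-5) in \<open>auto simp: boolean_valuation_def\<close>)
qed

lemma closeds_conv: "closeds S vs ts \<longleftrightarrow> list_all2 (\<lambda>\<alpha> t. t \<in> closed S \<alpha>) (map (sort_of S) vs) ts"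
  by (simp add: closeds_def list_all2_map1)

lemma fv_subst_rename:
  assumes "length xs = length zs" "fv S a \<subseteq> set xs"
  shows "fv S (subst xs (map Var zs) a) \<subseteq> set zs"
proof -
  have "fv S (subst xs (map Var zs) a) \<subseteq>
      (fv S a - set xs) \<union> (\<Union>t \<in> set (map Var zs). fv S t) \<union> {x \<in> fv S a. x \<in> set xs \<and> Var x \<in> set (map Var zs)}"
    by (rule fv_subst) (simp add: assms)
  then show ?thesis using assms(2) by auto
qed

text \<open>\<open>I2\<close> compares the bodies over common variables, while \<open>xs\<close> and
  \<open>ys\<close> may differ. With fresh distinct \<open>zs\<close> its premise is a closed
  universal formula, whose closed instances are the assumed equations.\<close>

lemma D_arg_cong:
  assumes f: "f \<in> SOP S" "sig S f = (\<gamma>, \<alpha>s, \<beta>ss)"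
    and e1: "Op f (\<Delta> @ (xs, b1) # \<Theta>) \<in> Exprs S \<gamma>" and e2: "Op f (\<Delta> @ (ys, b2) # \<Theta>) \<in> Exprs S \<gamma>"
    and fv: "fv S b1 \<subseteq> set xs" "fv S b2 \<subseteq> set ys"
    and eq: "\<And>cs. closeds S xs cs \<Longrightarrow> D (Eq S (\<alpha>s ! length \<Delta>) (subst xs cs b1) (subst ys cs b2))"
  shows "D (Eq S \<gamma> (Op f (\<Delta> @ (xs, b1) # \<Theta>)) (Op f (\<Delta> @ (ys, b2) # \<Theta>)))"
proof -
  let ?\<beta>s = "\<beta>ss ! length \<Delta>" and ?\<alpha> = "\<alpha>s ! length \<Delta>"
  have 1: "args_ok S \<alpha>s \<beta>ss (\<Delta> @ (xs, b1) # \<Theta>)" and 2: "args_ok S \<alpha>s \<beta>ss (\<Delta> @ (ys, b2) # \<Theta>)"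
    using e1 e2 f by (auto simp: Op_in_Exprs_iff)
  note b1 = args_ok_middle[OF 1] and b2 = args_ok_middle[OF 2]
  have "set ?\<beta>s \<subseteq> VSRT S" using sig_wf(3,4)[of f \<gamma> \<alpha>s \<beta>ss] f b1(1) by simp
  then obtain zs where zs: "zs \<in> var_seqs S ?\<beta>s" "distinct zs" "set zs \<inter> (set_expr b1 \<union> set_expr b2) = {}"
    using fresh_vars[of ?\<beta>s "set_expr b1 \<union> set_expr b2"] by auto
  have so: "map (sort_of S) xs = ?\<beta>s" "map (sort_of S) ys = ?\<beta>s" "map (sort_of S) zs = ?\<beta>s"
    and V: "set zs \<subseteq> VAR S"
    using b1(2) b2(2) zs(1) by (simp_all add: var_seqs_conv_map)
  have len: "length xs = length zs" "length ys = length zs" using so by (metis length_map)+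
  have zfr: "set zs \<inter> (frs b1 \<union> gv b1) = {}" "set zs \<inter> (frs b2 \<union> gv b2) = {}"
    using zs(3) frs_subset_set_expr[of b1] gv_subset_set_expr[of b1] frs_subset_set_expr[of b2]
      gv_subset_set_expr[of b2] by blast+
  let ?b1 = "subst xs (map Var zs) b1" and ?b2 = "subst ys (map Var zs) b2"
  have "D (Foralls S zs (Eq S ?\<alpha> ?b1 ?b2))"
  proof (rule D_Foralls[OF zs(2) V])
    show "Eq S ?\<alpha> ?b1 ?b2 \<in> F"
      using Expr_SRT[OF b1(4)] subst_vars_Exprs[OF b1(4,2) zs(1)] subst_vars_Exprs[OF b2(4,2) zs(1)] by blast
    show "fv S (Eq S ?\<alpha> ?b1 ?b2) \<subseteq> set zs"
      using fv_subst_rename[OF len(1) fv(1)] fv_subst_rename[OF len(2) fv(2)] by simp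
    fix cs assume cs: "closeds S zs cs"
    then have "closeds S xs cs" by (simp add: closeds_conv so)
    moreover have "length zs = length cs" using cs by (rule closeds_length)
    ultimately show "D (subst zs cs (Eq S ?\<alpha> ?b1 ?b2))"
      using eq[of cs] subst_rename[OF len(1) _ zs(2) zfr(1)] subst_rename[OF len(2) _ zs(2) zfr(2)]
      by (simp add: subst_Eq)
  qed
  moreover have "Imp S (Foralls S zs (Eq S ?\<alpha> ?b1 ?b2))
     (Eq S \<gamma> (Op f (\<Delta> @ (xs, b1) # \<Theta>)) (Op f (\<Delta> @ (ys, b2) # \<Theta>))) \<in> axioms S"
    using zfr by (intro axioms.I2[OF f e1 e2 zs(1)]) (auto simp: fv_eq_frs)
  ultimately show ?thesis using derivable.intros by blast
qed

lemma closed_Op: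
  assumes "Op f args \<in> closed S \<gamma>" "(vs, a) \<in> set args"
  shows "fv S a \<subseteq> set vs"
proof -
  have "(\<Union>(vs, a) \<in> set args. fv S a - set vs) = {}" using assms by (auto simp: closed_def split: if_splits)
  then show ?thesis using assms(2) by auto
qed

text \<open>\<open>I2\<close> exchanges a single argument, so the arguments are exchanged from left
  to right through mixed lists, which begin with \<open>k\<close> entries of \<open>args'\<close>
  and end with those of \<open>args\<close>. Transitivity chains the steps.\<close>

lemma D_op_cong:
  assumes e: "Op f args \<in> closed S \<gamma>" and e': "Op f args' \<in> closed S \<gamma>" and f: "sig S f = (\<gamma>, \<alpha>s, \<beta>ss)"
    and eq: "\<And>i cs. i < length args \<Longrightarrow> closeds S (fst (args ! i)) cs \<Longrightarrow>
      D (Eq S (\<alpha>s ! i) (subst (fst (args ! i)) cs (snd (args ! i))) (subst (fst (args' ! i)) cs (snd (args' ! i))))"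
  shows "D (Eq S \<gamma> (Op f args) (Op f args'))"
proof -
  have ok: "args_ok S \<alpha>s \<beta>ss args" "args_ok S \<alpha>s \<beta>ss args'" and ff: "f \<in> SOP S \<union> VAR S"
    using e e' f by (auto simp: closed_def Op_in_Exprs_iff)
  then have len: "length args' = length args" "length args = length \<alpha>s" by (simp_all add: args_ok_def)
  have ok_mix: "args_ok S \<alpha>s \<beta>ss (take k args' @ drop k args)" if "k \<le> length args" for k
    using ok len that by (auto simp: args_ok_def nth_append)
  have mix: "Op f (take k args' @ drop k args) \<in> Exprs S \<gamma>" if "k \<le> length args" for k
    using ok_mix[OF that] ff f by (simp add: Op_in_Exprs_iff)
  have "D (Eq S \<gamma> (Op f args) (Op f (take k args' @ drop k args)))" if "k \<le> length args" for k
    using that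
  proof (induction k)
    case 0
    then show ?case using D_Eq_refl[OF closed_Exprs[OF e]] by simp
  next
    case (Suc k)
    then have k: "k < length args" by simp
    obtain xs b1 ys b2 where b: "args ! k = (xs, b1)" "args' ! k = (ys, b2)" by fastforce
    have m: "(xs, b1) \<in> set args" "(ys, b2) \<in> set args'" using b k len by (metis nth_mem)+
    have fS: "f \<in> SOP S" using arg_Exprs(4)[OF closed_Exprs[OF e] m(1)] .
    have s1: "take k args' @ drop k args = take k args' @ (xs, b1) # drop (Suc k) args"
      using k by (simp flip: Cons_nth_drop_Suc b)
    have s2: "take (Suc k) args' @ drop (Suc k) args = take k args' @ (ys, b2) # drop (Suc k) args"
      using k len by (simp add: take_Suc_conv_app_nth b)
    have l: "length (take k args') = k" using k len by simp
    have "D (Eq S \<gamma> (Op f (take k args' @ (xs, b1) # drop (Suc k) args))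
                    (Op f (take k args' @ (ys, b2) # drop (Suc k) args)))"
    proof (rule D_arg_cong[OF fS f])
      show "Op f (take k args' @ (xs, b1) # drop (Suc k) args) \<in> Exprs S \<gamma>" using mix[of k] k s1 by simp
      show "Op f (take k args' @ (ys, b2) # drop (Suc k) args) \<in> Exprs S \<gamma>" using mix[of "Suc k"] k s2 by simp
      show "fv S b1 \<subseteq> set xs" "fv S b2 \<subseteq> set ys" using closed_Op e e' m by blast+
      show "D (Eq S (\<alpha>s ! length (take k args')) (subst xs cs b1) (subst ys cs b2))" if "closeds S xs cs" for cs
        using eq[OF k, of cs] that unfolding l b by simp
    qed
    then have "D (Eq S \<gamma> (Op f (take k args' @ drop k args)) (Op f (take (Suc k) args' @ drop (Suc k) args)))"
      unfolding s1 s2 .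
    then show ?case
      using D_Eq_trans[OF Suc.IH] k mix[of k] mix[OF Suc.prems] closed_Exprs[OF e] by simp
  qed
  from this[of "length args"] show ?thesis using len by simp
qed

text \<open>At an operation, \<open>D_op_cong\<close> reduces each argument to closed instances
  \<open>cs\<close> of its bound variables. They extend \<open>ts\<close> and \<open>ts'\<close>
  alike, and so the induction hypothesis applies to the longer list of variables.\<close>

lemma D_subst_cong:
  assumes "closeds S vs ts" "closeds S vs ts'" "set vs \<subseteq> VAR S" "a \<in> Exprs S \<gamma>" "fv S a \<subseteq> set vs"
    and "\<And>i. i < length vs \<Longrightarrow> D (Eq S (sort_of S (vs ! i)) (ts ! i) (ts' ! i))"
  shows "D (Eq S \<gamma> (subst vs ts a) (subst vs ts' a))"
  using assms
proof (induction a arbitrary: vs ts ts' \<gamma> rule: expr_induct)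
  case (Op f args)
  have l: "length ts = length vs" "length ts' = length vs" using Op.prems(1,2) closeds_length by fastforce+
  show ?case
  proof (cases "args = []")
    case True
    show ?thesis
    proof (cases "f \<in> set vs")
      case in_vs: True
      then obtain k where k: "k < length vs" "vs ! k = f" "\<And>ds :: 's expr list. length ds = length vs \<Longrightarrow> bind vs ds f = ds ! k"
        using bind_index[OF in_vs] by metis
      have "sort_of S f = \<gamma>" using Op.prems(4) by (simp add: Op_in_Exprs_iff)
      then show ?thesis using Op.prems(6)[OF k(1)] k True l by (simp add: subst_eq_fsub fsub.simps)
    next
      case False
      then show ?thesis using True l D_Eq_refl[OF Op.prems(4)] by (simp add: subst_eq_fsub fsub.simps bind_notin)
    qed
  next
    case False
    obtain \<alpha>s \<beta>ss where f: "sig S f = (\<gamma>, \<alpha>s, \<beta>ss)" using Op.prems(4) by (metis Op_in_Exprs_iff prod.collapse)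
    have ok: "args_ok S \<alpha>s \<beta>ss args" using Op.prems(4) f by (simp add: Op_in_Exprs_iff)
    have s: "subst vs ts (Op f args) \<in> closed S \<gamma>" "subst vs ts' (Op f args) \<in> closed S \<gamma>"
      using subst_closeds Op.prems(1-5) by blast+
    show ?thesis
      unfolding subst_Op[OF False]
    proof (rule D_op_cong[OF s[unfolded subst_Op[OF False]] f], goal_cases)
      case (1 i cs)
      then have i: "i < length args" by simp
      obtain ws a where a: "args ! i = (ws, a)" by fastforce
      have m: "(ws, a) \<in> set args" using a i by (metis nth_mem)
      have W: "set ws \<subseteq> VAR S" using arg_Exprs(1)[OF Op.prems(4) m] .
      have aE: "a \<in> Exprs S (\<alpha>s ! i)" using ok i a unfolding args_ok_def by (metis snd_conv)
      have cs: "closeds S ws cs" using 1(2) i by (simp add: a)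
      have lc: "length ws = length cs" using cs by (rule closeds_length)
      have "D (Eq S (\<alpha>s ! i) (subst (vs @ ws) (ts @ cs) a) (subst (vs @ ws) (ts' @ cs) a))"
      proof (rule Op.IH[OF m])
        show "closeds S (vs @ ws) (ts @ cs)" "closeds S (vs @ ws) (ts' @ cs)"
          using Op.prems(1,2) cs l by (simp_all add: closeds_append)
        show "set (vs @ ws) \<subseteq> VAR S" using W Op.prems(3) by simp
        have "fv S a - set ws \<subseteq> fv S (Op f args)" using m by auto
        then show "fv S a \<subseteq> set (vs @ ws)" using Op.prems(5) by auto
        fix j assume j: "j < length (vs @ ws)"
        show "D (Eq S (sort_of S ((vs @ ws) ! j)) ((ts @ cs) ! j) ((ts' @ cs) ! j))"
        proof (cases "j < length vs")
          case True
          then show ?thesis using Op.prems(6)[OF True] l by (simp add: nth_append)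
        next
          case False
          then have "j - length vs < length ws" using j by simp
          then have "cs ! (j - length vs) \<in> Exprs S (sort_of S (ws ! (j - length vs)))"
            using cs unfolding closeds_def by (metis list_all2_nthD closed_Exprs)
          then show ?thesis using False l D_Eq_refl by (simp add: nth_append)
        qed
      qed (rule aE)
      then show ?case
        using subst_under_binder[OF Op.prems(1) aE W lc] subst_under_binder[OF Op.prems(2) aE W lc] i
        by (simp add: a)
    qed
  qed
qed

end

section \<open>The term model\<close>

locale term_model = henkin S \<Gamma> for S :: "('srt, 's) signature" and \<Gamma> :: "'s expr set" +
  fixes code :: "'s expr \<Rightarrow> 'u"
  assumes inj_code: "inj_on code (\<Union>\<gamma>. Exprs S \<gamma>)"
begin

definition esort :: "'s expr \<Rightarrow> 'srt" where
  "esort e = (case e of Op f args \<Rightarrow> sort_of S f)"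

text \<open>A chosen representative of the class of \<open>e\<close>. The predicate depends only on
  the class, so provably equal expressions get the same representative. Classes themselves, being
  sets of expressions, might be too many or too large to code in \<open>'u\<close>.\<close>

definition nf :: "'s expr \<Rightarrow> 's expr" where
  "nf e = (SOME e'. e' \<in> closed S (esort e) \<and> D (Eq S (esort e) e e'))"

definition v :: "'s expr \<Rightarrow> 'u" where
  "v e = code (nf e)"

definition rep :: "'u \<Rightarrow> 's expr" where
  "rep = inv_into (\<Union>\<gamma>. Exprs S \<gamma>) code"

lemma esort: "e \<in> Exprs S \<gamma> \<Longrightarrow> esort e = \<gamma>"
  by (cases e) (simp add: esort_def Op_in_Exprs_iff)

lemma nf: assumes "e \<in> closed S \<gamma>" shows "nf e \<in> closed S \<gamma>" "D (Eq S \<gamma> e (nf e))"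
proof -
  have s: "esort e = \<gamma>" using esort closed_Exprs[OF assms] by blast
  have "e \<in> closed S \<gamma> \<and> D (Eq S \<gamma> e e)" using assms D_Eq_refl[OF closed_Exprs[OF assms]] by blast
  then have "nf e \<in> closed S \<gamma> \<and> D (Eq S \<gamma> e (nf e))" unfolding nf_def s by (rule someI)
  then show "nf e \<in> closed S \<gamma>" "D (Eq S \<gamma> e (nf e))" by auto
qed

lemma v_eq_iff: assumes "a \<in> closed S \<gamma>" "b \<in> closed S \<gamma>" shows "v a = v b \<longleftrightarrow> D (Eq S \<gamma> a b)"
proof
  note E = closed_Exprs[OF assms(1)] closed_Exprs[OF assms(2)]
  note n = closed_Exprs[OF nf(1)[OF assms(1)]] closed_Exprs[OF nf(1)[OF assms(2)]]
  { assume "v a = v b"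
    then have "nf a = nf b" using inj_code n unfolding v_def by (auto dest: inj_onD)
    then have "D (Eq S \<gamma> a (nf b))" using nf(2)[OF assms(1)] by simp
    moreover have "D (Eq S \<gamma> (nf b) b)" using D_Eq_sym[OF nf(2)[OF assms(2)]] E n by blast
    ultimately show "D (Eq S \<gamma> a b)" using D_Eq_trans E n by blast }
  { assume d: "D (Eq S \<gamma> a b)"
    have s: "esort a = \<gamma>" "esort b = \<gamma>" using esort E by blast+
    have d': "D (Eq S \<gamma> b a)" using D_Eq_sym[OF d] E by blast
    have "D (Eq S \<gamma> a e) \<longleftrightarrow> D (Eq S \<gamma> b e)" if e: "e \<in> closed S \<gamma>" for e
      using D_Eq_trans[OF d _ E closed_Exprs[OF e]] D_Eq_trans[OF d' _ E(2,1) closed_Exprs[OF e]] by blast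
    then have "(\<lambda>e'. e' \<in> closed S \<gamma> \<and> D (Eq S \<gamma> a e')) = (\<lambda>e'. e' \<in> closed S \<gamma> \<and> D (Eq S \<gamma> b e'))"
      by blast
    then show "v a = v b" unfolding v_def nf_def s by simp }
qed

lemma rep_v: "a \<in> closed S \<gamma> \<Longrightarrow> rep (v a) = nf a"
  unfolding rep_def v_def using closed_Exprs[OF nf(1), of a \<gamma>] by (intro inv_into_f_f[OF inj_code]) blast

text \<open>A sort outside \<open>VSRT S\<close> may have no expressions, yet its domain must be
  nonempty; \<open>undefined\<close> is the filler.\<close>

definition dom :: "'srt \<Rightarrow> 'u set" where
  "dom \<gamma> = (if closed S \<gamma> = {} then {undefined} else v ` closed S \<gamma>)"

definition dseqs :: "'srt list \<Rightarrow> 'u list set" where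
  "dseqs \<sigma>s = {xs. list_all2 (\<lambda>x \<alpha>. x \<in> dom \<alpha>) xs \<sigma>s}"

text \<open>Evaluation takes place at representatives. By the congruence of substitution any other
  closed expressions with the same values would do, as \<open>ind_apply\<close> shows.\<close>

definition ind :: "'s list \<Rightarrow> 's expr \<Rightarrow> 'u list \<Rightarrow> 'u" where
  "ind vs a = (\<lambda>ys \<in> dseqs (map (sort_of S) vs). v (subst vs (map rep ys) a))"

definition fdom :: "'srt \<Rightarrow> 'srt list \<Rightarrow> ('u list \<Rightarrow> 'u) set" where
  "fdom \<gamma> \<sigma>s = (if closed S \<gamma> = {} then {\<lambda>ys \<in> dseqs \<sigma>s. undefined}
     else {ind vs a | vs a. vs \<in> var_seqs S \<sigma>s \<and> distinct vs \<and> a \<in> Exprs S \<gamma> \<and> fv S a \<subseteq> set vs})"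

text \<open>At sort \<open>\<pi>\<close> the value is truth, because equality on the one-element
  domain of a sort without expressions has to hold.\<close>

definition default :: "'srt \<Rightarrow> 'u" where
  "default \<gamma> = (if \<gamma> = \<pi> then v (Top S) else if closed S \<gamma> = {} then undefined else v (SOME e. e \<in> closed S \<gamma>))"

definition represents :: "'s \<Rightarrow> ('u list \<Rightarrow> 'u) list \<Rightarrow> ('s list \<times> 's expr) list \<Rightarrow> bool" where
  "represents f hs args \<longleftrightarrow> Op f args \<in> closed S (sort_of S f) \<and> hs = map (\<lambda>(vs, a). ind vs a) args"

text \<open>The default is only used if some argument sort of \<open>f\<close> has no expressions at all.\<close>

definition op_fun :: "'s \<Rightarrow> ('u list \<Rightarrow> 'u) list \<Rightarrow> 'u" where
  "op_fun f hs = (if \<exists>args. represents f hs args then v (Op f (SOME args. represents f hs args))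
     else default (sort_of S f))"

definition M :: "('srt, 's, 'u) struct" where
  "M = \<lparr> dom_of = dom, fun_dom = fdom, op_int = op_fun \<rparr>"

lemma M_simps [simp]: "dom_of M = dom" "fun_dom M = fdom" "op_int M = op_fun"
  by (simp_all add: M_def)

lemma seqs_M [simp]: "seqs M = dseqs"
  by (simp add: seqs_def dseqs_def fun_eq_iff)

lemma v_dom: "a \<in> closed S \<gamma> \<Longrightarrow> v a \<in> dom \<gamma>"
  by (auto simp: dom_def)

lemma closeds_dseqs: "closeds S vs ts \<Longrightarrow> map v ts \<in> dseqs (map (sort_of S) vs)"
  by (simp add: closeds_def dseqs_def list_all2_conv_all_nth v_dom)

text \<open>Sorts of variables have closed expressions, so no component is the filler of an empty
  sort. Functions on such lists can thus be compared on values of closed expressions only.\<close>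

lemma dseqs_closeds:
  assumes "ys \<in> dseqs (map (sort_of S) vs)" "set vs \<subseteq> VAR S"
  obtains ts where "closeds S vs ts" "ys = map v ts"
proof -
  have l: "length ys = length vs" using assms(1) by (auto simp: dseqs_def dest: list_all2_lengthD)
  have "\<exists>t. t \<in> closed S (sort_of S (vs ! i)) \<and> v t = ys ! i" if i: "i < length vs" for i
  proof -
    have "ys ! i \<in> dom (sort_of S (vs ! i))"
      using assms(1) i l by (simp add: dseqs_def list_all2_conv_all_nth)
    moreover have "closed S (sort_of S (vs ! i)) \<noteq> {}"
      using closed_inhabited sig_VAR assms(2) i nth_mem by blast
    ultimately show ?thesis by (auto simp: dom_def)
  qed
  then obtain t where t: "\<And>i. i < length vs \<Longrightarrow> t i \<in> closed S (sort_of S (vs ! i)) \<and> v (t i) = ys ! i" by metis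
  have "closeds S vs (map t [0..<length vs])" using t by (simp add: closeds_def list_all2_conv_all_nth)
  moreover have "ys = map v (map t [0..<length vs])" using t l by (intro nth_equalityI) auto
  ultimately show ?thesis using that by blast
qed

lemma rep_closeds:
  assumes "closeds S vs ts"
  shows "closeds S vs (map rep (map v ts))" "\<And>i. i < length vs \<Longrightarrow> map rep (map v ts) ! i = nf (ts ! i)"
proof -
  have t: "ts ! i \<in> closed S (sort_of S (vs ! i))" "length ts = length vs" if "i < length vs" for i
    using assms that by (simp_all add: closeds_def list_all2_conv_all_nth)
  show n: "\<And>i. i < length vs \<Longrightarrow> map rep (map v ts) ! i = nf (ts ! i)"
    using t(2) rep_v[OF t(1)] by simp
  show "closeds S vs (map rep (map v ts))"
    unfolding closeds_def list_all2_conv_all_nth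
    using closeds_length[OF assms] n nf(1)[OF t(1)] by simp
qed

lemma ind_apply:
  assumes "closeds S vs ts" "set vs \<subseteq> VAR S" "a \<in> Exprs S \<gamma>" "fv S a \<subseteq> set vs"
  shows "ind vs a (map v ts) = v (subst vs ts a)"
proof -
  note r = rep_closeds[OF assms(1)]
  have "D (Eq S \<gamma> (subst vs ts a) (subst vs (map rep (map v ts)) a))"
  proof (rule D_subst_cong[OF assms(1) r(1) assms(2-4)])
    fix i assume i: "i < length vs"
    then have "ts ! i \<in> closed S (sort_of S (vs ! i))"
      using assms(1) by (simp add: closeds_def list_all2_conv_all_nth)
    then show "D (Eq S (sort_of S (vs ! i)) (ts ! i) (map rep (map v ts) ! i))"
      unfolding r(2)[OF i] by (rule nf(2))
  qed
  then have "v (subst vs ts a) = v (subst vs (map rep (map v ts)) a)"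
    using v_eq_iff subst_closeds[OF assms(1,3,2,4)] subst_closeds[OF r(1) assms(3,2,4)] by blast
  then show ?thesis using closeds_dseqs[OF assms(1)] by (simp add: ind_def)
qed

lemma ind_eqI:
  assumes "\<sigma>s = map (sort_of S) vs" "set vs \<subseteq> VAR S" "a \<in> Exprs S \<gamma>" "fv S a \<subseteq> set vs"
    and "\<And>ts. closeds S vs ts \<Longrightarrow> g (map v ts) = v (subst vs ts a)"
  shows "(\<lambda>ys \<in> dseqs \<sigma>s. g ys) = ind vs a"
proof
  fix ys
  show "(\<lambda>ys \<in> dseqs \<sigma>s. g ys) ys = ind vs a ys"
  proof (cases "ys \<in> dseqs \<sigma>s")
    case True
    then obtain ts where ts: "closeds S vs ts" "ys = map v ts"
      using dseqs_closeds[of ys vs] assms(1,2) by metis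
    have "ind vs a ys = v (subst vs ts a)" unfolding ts(2) by (rule ind_apply[OF ts(1) assms(2-4)])
    then show ?thesis using True assms(5)[OF ts(1)] ts(2) by simp
  next
    case False
    then show ?thesis by (simp add: ind_def assms(1))
  qed
qed

lemma ind_extensional: "map (sort_of S) vs = \<sigma>s \<Longrightarrow> (\<lambda>ys \<in> dseqs \<sigma>s. ind vs a ys) = ind vs a"
  by (auto simp: ind_def restrict_def fun_eq_iff)

text \<open>Lets several functions with common leading arguments be represented over the same
  leading variables, as composition demands.\<close>

lemma ind_rename:
  assumes "ws \<in> var_seqs S \<sigma>s" "zs \<in> var_seqs S \<sigma>s" "distinct zs" "set zs \<inter> set_expr a = {}"
    and "a \<in> Exprs S \<gamma>" "fv S a \<subseteq> set ws"
  shows "ind ws a = ind zs (subst ws (map Var zs) a)"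
proof -
  have so: "map (sort_of S) ws = \<sigma>s" "map (sort_of S) zs = \<sigma>s" and V: "set ws \<subseteq> VAR S" "set zs \<subseteq> VAR S"
    using assms(1,2) by (simp_all add: var_seqs_conv_map)
  have l: "length ws = length zs" using so by (metis length_map)
  have fr: "set zs \<inter> (frs a \<union> gv a) = {}"
    using assms(4) frs_subset_set_expr[of a] gv_subset_set_expr[of a] by blast
  have "(\<lambda>ys \<in> dseqs \<sigma>s. ind ws a ys) = ind zs (subst ws (map Var zs) a)"
  proof (rule ind_eqI[OF so(2)[symmetric] V(2)])
    show "subst ws (map Var zs) a \<in> Exprs S \<gamma>" by (rule subst_vars_Exprs[OF assms(5,1,2)])
    show "fv S (subst ws (map Var zs) a) \<subseteq> set zs" by (rule fv_subst_rename[OF l assms(6)])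
    fix ts assume ts: "closeds S zs ts"
    then have "closeds S ws ts" by (simp add: closeds_conv so)
    then show "ind ws a (map v ts) = v (subst zs ts (subst ws (map Var zs) a))"
      using ind_apply[OF _ V(1) assms(5,6)] subst_rename[OF l closeds_length[OF ts] assms(3) fr] by simp
  qed
  then show ?thesis by (simp add: ind_extensional[OF so(1)])
qed

lemma fv_subst_under:
  assumes "closeds S us ts" "set vs \<subseteq> VAR S" "set us \<subseteq> VAR S" "fv S a \<subseteq> set (us @ vs)"
  shows "fv S (subst (us @ vs) (ts @ map Var vs) a) \<subseteq> set vs"
proof -
  have l: "length us = length ts" using assms(1) by (rule closeds_length)
  have c: "fv S t = {}" if "t \<in> set ts" for t
    using assms(1) that unfolding closeds_def by (metis closed_fv in_set_conv_nth list_all2_nthD2)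
  have "fv S (subst (us @ vs) (ts @ map Var vs) a) \<subseteq> (fv S a - set (us @ vs)) \<union>
      (\<Union>t \<in> set (ts @ map Var vs). fv S t) \<union> {x \<in> fv S a. x \<in> set (us @ vs) \<and> Var x \<in> set (ts @ map Var vs)}"
    by (rule fv_subst) (simp add: l)
  moreover have "{x \<in> fv S a. x \<in> set (us @ vs) \<and> Var x \<in> set (ts @ map Var vs)} \<subseteq> set vs"
  proof clarify
    fix x assume "x \<in> fv S a" "Var x \<in> set (ts @ map Var vs)"
    then show "x \<in> set vs" using c[of "Var x"] by (auto simp: fv_eq_frs[of S a])
  qed
  moreover have "(\<Union>t \<in> set (ts @ map Var vs). fv S t) \<subseteq> set vs" using c by auto
  moreover have "fv S a - set (us @ vs) = {}" using assms(4) by blast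
  ultimately show ?thesis by blast
qed

lemma subst_under_Exprs:
  assumes "closeds S us ts" "set vs \<subseteq> VAR S" "set us \<subseteq> VAR S" "a \<in> Exprs S \<gamma>"
  shows "subst (us @ vs) (ts @ map Var vs) a \<in> Exprs S \<gamma>"
proof (rule subst_Exprs[OF assms(4)])
  have "list_all2 (\<lambda>x t. x \<in> VAR S \<and> t \<in> Exprs S (sort_of S x)) vs (map Var vs)"
    using assms(2) by (auto simp: list_all2_conv_all_nth subset_iff)
  then show "list_all2 (\<lambda>x t. x \<in> VAR S \<and> t \<in> Exprs S (sort_of S x)) (us @ vs) (ts @ map Var vs)"
    using closeds_Exprs[OF assms(1,3)] by (rule list_all2_appendI[rotated])
qed

text \<open>Fixing leading arguments is substituting closed expressions for their variables. Sending
  \<open>vs\<close> to themselves shields a variable that occurs in both \<open>us\<close> and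
  \<open>vs\<close>.\<close>

lemma ind_partial:
  assumes "closeds S us ts" "set vs \<subseteq> VAR S" "set us \<subseteq> VAR S" "a \<in> Exprs S \<gamma>" "fv S a \<subseteq> set (us @ vs)"
  shows "(\<lambda>rs \<in> dseqs (map (sort_of S) vs). ind (us @ vs) a (map v ts @ rs)) =
    ind vs (subst (us @ vs) (ts @ map Var vs) a)"
proof (rule ind_eqI[OF refl assms(2) subst_under_Exprs[OF assms(1-4)] fv_subst_under[OF assms(1-3,5)]])
  fix rs assume rs: "closeds S vs rs"
  have "closeds S (us @ vs) (ts @ rs)" using assms(1) rs closeds_length by (simp add: closeds_append)
  then have "ind (us @ vs) a (map v (ts @ rs)) = v (subst (us @ vs) (ts @ rs) a)"
    using assms by (intro ind_apply) auto
  then show "ind (us @ vs) a (map v ts @ map v rs) = v (subst vs rs (subst (us @ vs) (ts @ map Var vs) a))"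
    using subst_under_binder[OF assms(1,4,2) closeds_length[OF rs]] by simp
qed

lemma default_dom: "\<gamma> \<in> SRT S \<Longrightarrow> default \<gamma> \<in> dom \<gamma>"
proof -
  have "Top S \<in> closed S \<pi>" by (simp add: closed_def)
  then show ?thesis by (auto simp: default_def dom_def intro: someI)
qed

text \<open>The arguments picked by \<open>SOME\<close> may differ from \<open>args\<close>, but
  they induce the same functions. Evaluated at closed expressions this is agreement up to provable
  equality, the premise of \<open>D_op_cong\<close>.\<close>

lemma op_fun_apply:
  assumes e: "Op f args \<in> closed S \<gamma>"
  shows "op_fun f (map (\<lambda>(vs, a). ind vs a) args) = v (Op f args)"
proof -
  let ?hs = "map (\<lambda>(vs, a). ind vs a) args"
  have s: "sort_of S f = \<gamma>" using closed_Exprs[OF e] by (simp add: Op_in_Exprs_iff)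
  have r: "represents f ?hs args" using e by (simp add: represents_def s)
  define args' where "args' = (SOME args. represents f ?hs args)"
  have r': "represents f ?hs args'" unfolding args'_def using r by (rule someI)
  then have e': "Op f args' \<in> closed S \<gamma>" and hs: "map (\<lambda>(vs, a). ind vs a) args = map (\<lambda>(vs, a). ind vs a) args'"
    by (simp_all add: represents_def s)
  obtain \<alpha>s \<beta>ss where f: "sig S f = (\<gamma>, \<alpha>s, \<beta>ss)" using s by (metis prod.collapse)
  have ok: "args_ok S \<alpha>s \<beta>ss args" "args_ok S \<alpha>s \<beta>ss args'"
    using closed_Exprs[OF e] closed_Exprs[OF e'] f by (simp_all add: Op_in_Exprs_iff)
  have len: "length args = length \<alpha>s" "length args' = length \<alpha>s" using ok by (simp_all add: args_ok_def)
  have "D (Eq S \<gamma> (Op f args) (Op f args'))"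
  proof (rule D_op_cong[OF e e' f])
    fix i cs assume i: "i < length args" and cs: "closeds S (fst (args ! i)) cs"
    obtain xs b1 ys b2 where b: "args ! i = (xs, b1)" "args' ! i = (ys, b2)" by fastforce
    have m: "(xs, b1) \<in> set args" "(ys, b2) \<in> set args'" using b i len by (metis nth_mem)+
    have fv: "fv S b1 \<subseteq> set xs" "fv S b2 \<subseteq> set ys" using closed_Op e e' m by blast+
    have o: "xs \<in> var_seqs S (\<beta>ss ! i)" "ys \<in> var_seqs S (\<beta>ss ! i)" "b1 \<in> Exprs S (\<alpha>s ! i)" "b2 \<in> Exprs S (\<alpha>s ! i)"
      using ok i b len unfolding args_ok_def by (metis fst_conv snd_conv)+
    have V: "set xs \<subseteq> VAR S" "set ys \<subseteq> VAR S" and so: "map (sort_of S) xs = map (sort_of S) ys"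
      using o(1,2) by (simp_all add: var_seqs_conv_map)
    have cx: "closeds S xs cs" using cs b by simp
    then have cy: "closeds S ys cs" by (simp add: closeds_conv so)
    have "map (\<lambda>(vs, a). ind vs a) args ! i = map (\<lambda>(vs, a). ind vs a) args' ! i" using hs by simp
    then have "ind xs b1 = ind ys b2" using b i len by simp
    then have "v (subst xs cs b1) = v (subst ys cs b2)"
      using ind_apply[OF cx V(1) o(3) fv(1)] ind_apply[OF cy V(2) o(4) fv(2)] by simp
    then show "D (Eq S (\<alpha>s ! i) (subst (fst (args ! i)) cs (snd (args ! i))) (subst (fst (args' ! i)) cs (snd (args' ! i))))"
      using v_eq_iff[OF subst_closeds[OF cx o(3) V(1) fv(1)] subst_closeds[OF cy o(4) V(2) fv(2)]] b by simp
  qed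
  then have "v (Op f args) = v (Op f args')" using v_eq_iff[OF e e'] by blast
  then show ?thesis using r unfolding op_fun_def args'_def by auto
qed

lemma op_fun_default:
  assumes "sig S f = (\<gamma>, \<alpha>s, \<beta>ss)" "i < length \<alpha>s" "closed S (\<alpha>s ! i) = {}"
  shows "op_fun f hs = default \<gamma>"
proof -
  have "\<not> represents f hs args" for args
  proof
    assume "represents f hs args"
    then have "args_ok S \<alpha>s \<beta>ss args" using assms(1) by (simp add: represents_def closed_def Op_in_Exprs_iff)
    then have "snd (args ! i) \<in> Exprs S (\<alpha>s ! i)" using assms(2) by (simp add: args_ok_def)
    then show False using closed_inhabitedI assms(3) by blast
  qed
  then show ?thesis using assms(1) by (simp add: op_fun_def)
qed

lemma fdomE:
  assumes "g \<in> fdom \<gamma> \<sigma>s" "closed S \<gamma> \<noteq> {}"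
  obtains vs a where "g = ind vs a" "vs \<in> var_seqs S \<sigma>s" "distinct vs" "a \<in> Exprs S \<gamma>" "fv S a \<subseteq> set vs"
  using assms by (auto simp: fdom_def)

lemma fdomI:
  assumes "vs \<in> var_seqs S \<sigma>s" "distinct vs" "a \<in> Exprs S \<gamma>" "fv S a \<subseteq> set vs"
  shows "ind vs a \<in> fdom \<gamma> \<sigma>s"
  using assms closed_inhabitedI[OF assms(3)] by (auto simp: fdom_def)

lemma args_represented:
  assumes f: "f \<in> SOP S" "sig S f = (\<gamma>, \<alpha>s, \<beta>ss)" and hs: "hs \<in> arg_seqs M \<alpha>s \<beta>ss"
    and inh: "\<And>i. i < length \<alpha>s \<Longrightarrow> closed S (\<alpha>s ! i) \<noteq> {}"
  obtains args where "Op f args \<in> closed S \<gamma>" "hs = map (\<lambda>(vs, a). ind vs a) args"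
proof -
  have len: "length hs = length \<alpha>s" using hs by (simp add: arg_seqs_def)
  have "\<exists>p. hs ! i = ind (fst p) (snd p) \<and> fst p \<in> var_seqs S (\<beta>ss ! i) \<and> distinct (fst p) \<and>
      snd p \<in> Exprs S (\<alpha>s ! i) \<and> fv S (snd p) \<subseteq> set (fst p)" if i: "i < length \<alpha>s" for i
  proof -
    have "hs ! i \<in> fdom (\<alpha>s ! i) (\<beta>ss ! i)" using hs i by (simp add: arg_seqs_def)
    then show ?thesis using inh[OF i] by (elim fdomE) auto
  qed
  then obtain p where p: "\<And>i. i < length \<alpha>s \<Longrightarrow> hs ! i = ind (fst (p i)) (snd (p i)) \<and>
      fst (p i) \<in> var_seqs S (\<beta>ss ! i) \<and> distinct (fst (p i)) \<and>
      snd (p i) \<in> Exprs S (\<alpha>s ! i) \<and> fv S (snd (p i)) \<subseteq> set (fst (p i))" by metis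
  let ?args = "map p [0..<length \<alpha>s]"
  have "Op f ?args \<in> Exprs S \<gamma>" using p f by (simp add: Op_in_Exprs_iff args_ok_def)
  moreover have "fv S (Op f ?args) = {}"
  proof (cases "\<alpha>s = []")
    case True
    then show ?thesis using f(1) disj by auto
  next
    case False
    have "\<forall>i < length \<alpha>s. fv S (snd (p i)) - set (fst (p i)) = {}" using p by blast
    then show ?thesis using False by (simp add: split_beta)
  qed
  moreover have "hs = map (\<lambda>(vs, a). ind vs a) ?args"
    using p len by (intro nth_equalityI) (auto simp: case_prod_unfold)
  ultimately show ?thesis by (intro that[of ?args]) (simp_all add: closed_def del: fv.simps)
qed

lemma op_fun_dom:
  assumes f: "f \<in> SOP S" "sig S f = (\<gamma>, \<alpha>s, \<beta>ss)" and hs: "hs \<in> arg_seqs M \<alpha>s \<beta>ss"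
  shows "op_fun f hs \<in> dom \<gamma>"
proof (cases "\<exists>i < length \<alpha>s. closed S (\<alpha>s ! i) = {}")
  case True
  then show ?thesis using op_fun_default[OF f(2)] default_dom sig_wf(1)[of f \<gamma> \<alpha>s \<beta>ss] f by auto
next
  case False
  then obtain args where "Op f args \<in> closed S \<gamma>" "hs = map (\<lambda>(vs, a). ind vs a) args"
    using args_represented[OF f hs] by blast
  then show ?thesis using op_fun_apply v_dom by metis
qed

section \<open>Closure properties of the function spaces\<close>

lemma fdom_Nil: "fdom \<gamma> [] = const ` dom \<gamma>"
proof (cases "closed S \<gamma> = {}")
  case True
  then show ?thesis by (simp add: fdom_def dom_def const_def dseqs_def)
next
  case False
  have i: "ind [] a = const (v a)" for a by (simp add: ind_def const_def dseqs_def fun_eq_iff)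
  have "fdom \<gamma> [] = {ind [] a | a. a \<in> Exprs S \<gamma> \<and> fv S a = {}}"
    using False by (auto simp: fdom_def var_seqs_def)
  also have "\<dots> = const ` dom \<gamma>" using False by (auto simp: i dom_def closed_def)
  finally show ?thesis .
qed

lemma fdom_funcset: "set \<sigma>s \<subseteq> VSRT S \<Longrightarrow> fdom \<gamma> \<sigma>s \<subseteq> dseqs \<sigma>s \<rightarrow>\<^sub>E dom \<gamma>"
proof (cases "closed S \<gamma> = {}")
  case True
  then show ?thesis by (auto simp: fdom_def dom_def)
next
  case False
  show ?thesis
  proof
    fix g assume "g \<in> fdom \<gamma> \<sigma>s"
    then obtain vs a where g: "g = ind vs a" "vs \<in> var_seqs S \<sigma>s" "a \<in> Exprs S \<gamma>" "fv S a \<subseteq> set vs"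
      using False by (rule fdomE)
    have V: "set vs \<subseteq> VAR S" and so: "map (sort_of S) vs = \<sigma>s" using g(2) by (simp_all add: var_seqs_conv_map)
    have "ind vs a ys \<in> dom \<gamma>" if ys: "ys \<in> dseqs \<sigma>s" for ys
    proof -
      obtain ts where ts: "closeds S vs ts" "ys = map v ts" using dseqs_closeds[of ys vs] ys V so by metis
      then show ?thesis using ind_apply[OF ts(1) V g(3,4)] v_dom[OF subst_closeds[OF ts(1) g(3) V g(4)]] by simp
    qed
    then show "g \<in> dseqs \<sigma>s \<rightarrow>\<^sub>E dom \<gamma>" unfolding g(1) by (auto simp: ind_def so)
  qed
qed

lemma fdom_const:
  assumes "set \<sigma>s \<subseteq> VSRT S" "w \<in> dom \<gamma>"
  shows "(\<lambda>_ \<in> dseqs \<sigma>s. w) \<in> fdom \<gamma> \<sigma>s"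
proof (cases "closed S \<gamma> = {}")
  case True
  then show ?thesis using assms(2) by (simp add: fdom_def dom_def)
next
  case False
  then obtain e where e: "e \<in> closed S \<gamma>" "w = v e" using assms(2) by (auto simp: dom_def)
  obtain vs where vs: "vs \<in> var_seqs S \<sigma>s" "distinct vs" using fresh_vars[OF assms(1), of "{}"] by auto
  have V: "set vs \<subseteq> VAR S" and so: "map (sort_of S) vs = \<sigma>s" using vs(1) by (simp_all add: var_seqs_conv_map)
  have "(\<lambda>_ \<in> dseqs \<sigma>s. w) = ind vs e"
  proof (rule ind_eqI[OF so[symmetric] V closed_Exprs[OF e(1)]])
    fix ts assume "closeds S vs ts"
    then show "w = v (subst vs ts e)"
      using subst_closed[OF closed_fv[OF e(1)] V closeds_length] e(2) by simp
  qed (simp add: closed_fv[OF e(1)])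
  then show ?thesis using fdomI[OF vs closed_Exprs[OF e(1)]] closed_fv[OF e(1)] by simp
qed

lemma fdom_proj:
  assumes "set \<sigma>s \<subseteq> VSRT S" "j < length \<sigma>s"
  shows "(\<lambda>xs \<in> dseqs \<sigma>s. xs ! j) \<in> fdom (\<sigma>s ! j) \<sigma>s"
proof -
  obtain vs where vs: "vs \<in> var_seqs S \<sigma>s" "distinct vs" using fresh_vars[OF assms(1), of "{}"] by auto
  have V: "set vs \<subseteq> VAR S" and so: "map (sort_of S) vs = \<sigma>s" using vs(1) by (simp_all add: var_seqs_conv_map)
  have l: "j < length vs" using so assms(2) by (metis length_map)
  then have x: "vs ! j \<in> VAR S" "sort_of S (vs ! j) = \<sigma>s ! j" using V so by (auto simp: subset_iff)
  then have E: "Var (vs ! j) \<in> Exprs S (\<sigma>s ! j)" by simp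
  have fv: "fv S (Var (vs ! j)) \<subseteq> set vs" using nth_mem[OF l] by auto
  have "(\<lambda>xs \<in> dseqs \<sigma>s. xs ! j) = ind vs (Var (vs ! j))"
  proof (rule ind_eqI[OF so[symmetric] V E fv])
    fix ts assume ts: "closeds S vs ts"
    have lt: "length vs = length ts" using ts by (rule closeds_length)
    show "map v ts ! j = v (subst vs ts (Var (vs ! j)))"
      using l lt by (simp add: subst_eq_fsub fsub.simps bind_nth[OF vs(2) lt l])
  qed
  then show ?thesis using fdomI[OF vs E fv] by simp
qed

lemma fdom_fix:
  assumes "set \<sigma>s \<subseteq> VSRT S" "set \<rho>s \<subseteq> VSRT S" "g \<in> fdom \<gamma> (\<sigma>s @ \<rho>s)" "xs \<in> dseqs \<sigma>s"
  shows "(\<lambda>rs \<in> dseqs \<rho>s. g (xs @ rs)) \<in> fdom \<gamma> \<rho>s"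
proof (cases "closed S \<gamma> = {}")
  case True
  have "xs @ rs \<in> dseqs (\<sigma>s @ \<rho>s)" if "rs \<in> dseqs \<rho>s" for rs
    using that assms(4) by (simp add: dseqs_def list_all2_appendI)
  then have "(\<lambda>rs \<in> dseqs \<rho>s. g (xs @ rs)) = (\<lambda>rs \<in> dseqs \<rho>s. undefined)"
    using assms(3) True by (auto simp: fdom_def)
  then show ?thesis using True by (simp add: fdom_def)
next
  case False
  with assms(3) obtain ws a where g: "g = ind ws a" "ws \<in> var_seqs S (\<sigma>s @ \<rho>s)" "distinct ws"
    "a \<in> Exprs S \<gamma>" "fv S a \<subseteq> set ws" by (rule fdomE)
  define us vs where "us = take (length \<sigma>s) ws" and "vs = drop (length \<sigma>s) ws"
  have ws: "ws = us @ vs" by (simp add: us_def vs_def)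
  have wV: "set ws \<subseteq> VAR S" and wso: "map (sort_of S) ws = \<sigma>s @ \<rho>s" using g(2) by (simp_all add: var_seqs_conv_map)
  then have so: "map (sort_of S) us = \<sigma>s" "map (sort_of S) vs = \<rho>s"
    unfolding us_def vs_def by (simp_all flip: take_map drop_map)
  have V: "set us \<subseteq> VAR S" "set vs \<subseteq> VAR S" using wV ws by auto
  obtain ts where ts: "closeds S us ts" "xs = map v ts" using dseqs_closeds[of xs us] assms(4) V so by metis
  have fv: "fv S a \<subseteq> set (us @ vs)" using g(5) ws by simp
  have "(\<lambda>rs \<in> dseqs \<rho>s. g (xs @ rs)) = ind vs (subst (us @ vs) (ts @ map Var vs) a)"
    using ind_partial[OF ts(1) V(2,1) g(4) fv] by (simp add: so(2) g(1) ts(2) ws)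
  moreover have "vs \<in> var_seqs S \<rho>s" "distinct vs" using V so g(3) ws by (simp_all add: var_seqs_conv_map)
  ultimately show ?thesis
    using fdomI[of vs \<rho>s "subst (us @ vs) (ts @ map Var vs) a"] subst_under_Exprs[OF ts(1) V(2,1) g(4)]
      fv_subst_under[OF ts(1) V(2,1) fv] by simp
qed

end

context term_model
begin

lemma map2_nth_eqI:
  assumes "length gs = n" "length \<beta>ss = n" "length args = n"
    and "\<And>i. i < n \<Longrightarrow> h (gs ! i) (\<beta>ss ! i) = k (args ! i)"
  shows "map2 h gs \<beta>ss = map k args"
  using assms by (intro nth_equalityI) auto

text \<open>The composite is induced by \<open>f\<close> applied to the representing bodies. For
  this their parameters are renamed to a single sequence \<open>us\<close>, fresh for all bodies at
  once, while the bound variables \<open>q i\<close> are chosen for each argument separately and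
  apart from \<open>us\<close>.\<close>

lemma fdom_comp:
  assumes f: "f \<in> SOP S" "sig S f = (\<gamma>, \<alpha>s, \<beta>ss)" and ne: "\<alpha>s \<noteq> []" and \<sigma>s: "set \<sigma>s \<subseteq> VSRT S"
    and gs: "gs \<in> arg_seqs M \<alpha>s (map (\<lambda>\<beta>s. \<sigma>s @ \<beta>s) \<beta>ss)"
  shows "(\<lambda>ys \<in> dseqs \<sigma>s. op_fun f (map2 (\<lambda>g \<beta>s. \<lambda>rs \<in> dseqs \<beta>s. g (ys @ rs)) gs \<beta>ss)) \<in> fdom \<gamma> \<sigma>s"
proof (cases "\<exists>i < length \<alpha>s. closed S (\<alpha>s ! i) = {}")
  case True
  \<comment> \<open>An argument sort without expressions makes the operation constant, so the
    composite is a constant function.\<close>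
  then have "op_fun f hs = default \<gamma>" for hs using op_fun_default[OF f(2)] by blast
  then show ?thesis using fdom_const[OF \<sigma>s default_dom] sig_wf(1)[of f \<gamma> \<alpha>s \<beta>ss] f by simp
next
  case False
  define n where "n = length \<alpha>s"
  have len: "length gs = n" "length \<beta>ss = n" "length \<alpha>s = n"
    using gs sig_wf(3)[of f \<gamma> \<alpha>s \<beta>ss] f by (simp_all add: arg_seqs_def n_def)
  have "\<exists>p. gs ! i = ind (fst p) (snd p) \<and> fst p \<in> var_seqs S (\<sigma>s @ \<beta>ss ! i) \<and>
      snd p \<in> Exprs S (\<alpha>s ! i) \<and> fv S (snd p) \<subseteq> set (fst p)" if i: "i < n" for i
  proof -
    have "gs ! i \<in> fdom (\<alpha>s ! i) (\<sigma>s @ \<beta>ss ! i)" using gs i len by (simp add: arg_seqs_def)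
    then show ?thesis using False i len by (elim fdomE) auto
  qed
  then obtain p where p: "\<And>i. i < n \<Longrightarrow> gs ! i = ind (fst (p i)) (snd (p i)) \<and>
      fst (p i) \<in> var_seqs S (\<sigma>s @ \<beta>ss ! i) \<and>
      snd (p i) \<in> Exprs S (\<alpha>s ! i) \<and> fv S (snd (p i)) \<subseteq> set (fst (p i))" by metis
  obtain us where us: "us \<in> var_seqs S \<sigma>s" "distinct us" "set us \<inter> (\<Union>i < n. set_expr (snd (p i))) = {}"
    using fresh_vars[OF \<sigma>s, of "\<Union>i < n. set_expr (snd (p i))"] by auto
  have "\<exists>vs. vs \<in> var_seqs S (\<beta>ss ! i) \<and> distinct vs \<and> set vs \<inter> (set us \<union> set_expr (snd (p i))) = {}"
    if "i < n" for i
    using fresh_vars[of "\<beta>ss ! i" "set us \<union> set_expr (snd (p i))"] sig_wf(4)[of f \<gamma> \<alpha>s \<beta>ss] f that len by simp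
  then obtain q where q: "\<And>i. i < n \<Longrightarrow> q i \<in> var_seqs S (\<beta>ss ! i) \<and> distinct (q i) \<and>
      set (q i) \<inter> (set us \<union> set_expr (snd (p i))) = {}" by metis
  define b where "b i = subst (fst (p i)) (map Var (us @ q i)) (snd (p i))" for i
  have V: "set us \<subseteq> VAR S" and so: "map (sort_of S) us = \<sigma>s" using us(1) by (simp_all add: var_seqs_conv_map)
  have b: "gs ! i = ind (us @ q i) (b i)" "b i \<in> Exprs S (\<alpha>s ! i)" "fv S (b i) \<subseteq> set (us @ q i)"
    "set (q i) \<subseteq> VAR S" "map (sort_of S) (q i) = \<beta>ss ! i"
    if i: "i < n" for i
  proof -
    show Q: "set (q i) \<subseteq> VAR S" "map (sort_of S) (q i) = \<beta>ss ! i"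
      using q[OF i] by (simp_all add: var_seqs_conv_map)
    have w: "us @ q i \<in> var_seqs S (\<sigma>s @ \<beta>ss ! i)" using Q V so by (simp add: var_seqs_conv_map)
    have P: "fst (p i) \<in> var_seqs S (\<sigma>s @ \<beta>ss ! i)" "snd (p i) \<in> Exprs S (\<alpha>s ! i)" "fv S (snd (p i)) \<subseteq> set (fst (p i))"
      using p[OF i] by blast+
    have "length (fst (p i)) = length (us @ q i)"
      using P(1) w by (simp only: var_seqs_conv_map) (metis length_map)
    then show "fv S (b i) \<subseteq> set (us @ q i)" unfolding b_def using P(3) by (rule fv_subst_rename)
    show "b i \<in> Exprs S (\<alpha>s ! i)" unfolding b_def using subst_vars_Exprs[OF P(2,1) w] .
    have "distinct (us @ q i)" using us(2) q[OF i] by auto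
    moreover have "set (us @ q i) \<inter> set_expr (snd (p i)) = {}" using us(3) q[OF i] i by auto
    ultimately show "gs ! i = ind (us @ q i) (b i)"
      unfolding b_def using p[OF i] ind_rename[OF P(1) w _ _ P(2,3)] by simp
  qed
  define args where "args = map (\<lambda>i. (q i, b i)) [0..<n]"
  have ane: "args \<noteq> []" using ne len by (auto simp: args_def)
  have E: "Op f args \<in> Exprs S \<gamma>"
    using f b q len by (simp add: Op_in_Exprs_iff args_ok_def args_def)
  have fv: "fv S (Op f args) \<subseteq> set us"
  proof -
    have "fv S (b i) - set (q i) \<subseteq> set us" if "i < n" for i using b(3)[OF that] by auto
    moreover have "fv S (Op f args) = (\<Union>i < n. fv S (b i) - set (q i))" using ane by (auto simp: args_def)
    ultimately show ?thesis by blast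
  qed
  have "(\<lambda>ys \<in> dseqs \<sigma>s. op_fun f (map2 (\<lambda>g \<beta>s. \<lambda>rs \<in> dseqs \<beta>s. g (ys @ rs)) gs \<beta>ss)) = ind us (Op f args)"
  proof (rule ind_eqI[OF so[symmetric] V E fv])
    fix ts assume ts: "closeds S us ts"
    let ?args' = "map (\<lambda>(vs, a). (vs, subst (us @ vs) (ts @ map Var vs) a)) args"
    have "map2 (\<lambda>g \<beta>s. \<lambda>rs \<in> dseqs \<beta>s. g (map v ts @ rs)) gs \<beta>ss = map (\<lambda>(vs, a). ind vs a) ?args'"
    proof (rule map2_nth_eqI[where n = n])
      fix i assume i: "i < n"
      have "(\<lambda>rs \<in> dseqs (map (sort_of S) (q i)). ind (us @ q i) (b i) (map v ts @ rs)) =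
          ind (q i) (subst (us @ q i) (ts @ map Var (q i)) (b i))"
        by (rule ind_partial[OF ts b(4)[OF i] V b(2)[OF i] b(3)[OF i]])
      then show "(\<lambda>rs \<in> dseqs (\<beta>ss ! i). (gs ! i) (map v ts @ rs)) = (case ?args' ! i of (vs, a) \<Rightarrow> ind vs a)"
        using i by (simp add: b(1)[OF i] b(5)[OF i] args_def)
    qed (use len in \<open>simp_all add: args_def\<close>)
    moreover have "Op f ?args' \<in> closed S \<gamma>" using subst_closeds[OF ts E V fv] by (simp add: subst_Op[OF ane])
    ultimately show "op_fun f (map2 (\<lambda>g \<beta>s. \<lambda>rs \<in> dseqs \<beta>s. g (map v ts @ rs)) gs \<beta>ss) = v (subst us ts (Op f args))"
      by (simp only: op_fun_apply subst_Op[OF ane])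
  qed
  then show ?thesis using fdomI[OF us(1,2) E fv] by simp
qed

section \<open>Truth values, connectives, quantifiers and equality in the term model\<close>

lemma Top_closed: "Top S \<in> closed S \<pi>" and Bot_closed: "Bot S \<in> closed S \<pi>"
  by (simp_all add: closed_def)

lemma truth_M: "truth S M b = v (if b then Top S else Bot S)"
  using op_fun_apply[of "top_sym S" "[]"] op_fun_apply[of "bot_sym S" "[]"] Top_closed Bot_closed
  by (simp add: truth_def Top_def Bot_def)

lemma D_Bot: "\<not> D (Bot S)"
  by (rule consistent)

text \<open>Equality at \<open>\<pi>\<close> is the biconditional, and by completeness every closed
  formula is provably equivalent to \<open>Top S\<close> or to \<open>Bot S\<close>.\<close>

lemma v_truth: assumes "\<psi> \<in> closed S \<pi>" shows "v \<psi> = truth S M (D \<psi>)"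
proof (cases "D \<psi>")
  case True
  then have "D (Eq S \<pi> \<psi> (Top S))" using D_Iff[OF assms Top_closed] D_Top by simp
  then show ?thesis using True v_eq_iff[OF assms Top_closed] by (simp add: truth_M)
next
  case False
  then have "D (Eq S \<pi> \<psi> (Bot S))" using D_Iff[OF assms Bot_closed] D_Bot by simp
  then show ?thesis using False v_eq_iff[OF assms Bot_closed] by (simp add: truth_M)
qed

lemma truth_inj: "truth S M p = truth S M q \<longleftrightarrow> p = q"
proof -
  have "v (Top S) \<noteq> v (Bot S)"
    using v_eq_iff[OF Top_closed Bot_closed] D_Iff[OF Top_closed Bot_closed] D_Top D_Bot by simp
  then show ?thesis by (auto simp: truth_M)
qed

lemma const_v: "const (v a) = ind [] a"
  by (simp add: ind_def const_def dseqs_def fun_eq_iff)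

lemma op_const: 
  assumes "Op f (map (Pair []) as) \<in> closed S \<gamma>"
  shows "op_fun f (map (\<lambda>a. const (v a)) as) = v (Op f (map (Pair []) as))"
  using op_fun_apply[OF assms] by (simp add: const_v comp_def)

lemma tf_closed: "(if p then Top S else Bot S) \<in> closed S \<pi>" and D_tf: "D (if p then Top S else Bot S) \<longleftrightarrow> p"
  using Top_closed Bot_closed D_Top D_Bot by auto

lemma connectives:
  "op_fun (neg_sym S) [const (truth S M p)] = truth S M (\<not> p)"
  "op_fun (con_sym S) [const (truth S M p), const (truth S M q)] = truth S M (p \<and> q)"
  "op_fun (dis_sym S) [const (truth S M p), const (truth S M q)] = truth S M (p \<or> q)"
  "op_fun (imp_sym S) [const (truth S M p), const (truth S M q)] = truth S M (p \<longrightarrow> q)"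
  "op_fun (iff_sym S) [const (truth S M p), const (truth S M q)] = truth S M (p \<longleftrightarrow> q)"
proof -
  define a b where "a = (if p then Top S else Bot S)" and "b = (if q then Top S else Bot S)"
  have ab: "truth S M p = v a" "truth S M q = v b" "a \<in> closed S \<pi>" "b \<in> closed S \<pi>" "D a = p" "D b = q"
    using tf_closed D_tf by (simp_all add: truth_M a_def b_def)
  have F: "a \<in> F" "b \<in> F" "fv S a = {}" "fv S b = {}" using ab by (auto simp: closed_def)
  have c: "Neg S a \<in> closed S \<pi>" "Con S a b \<in> closed S \<pi>" "Dis S a b \<in> closed S \<pi>" "Imp S a b \<in> closed S \<pi>" "Iff S a b \<in> closed S \<pi>"
    using F by (simp_all add: closed_def)
  show "op_fun (neg_sym S) [const (truth S M p)] = truth S M (\<not> p)"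
    using op_const[of "neg_sym S" "[a]" \<pi>] c(1) v_truth[OF c(1)] D_Neg[OF ab(3)] ab by (simp add: Neg_def)
  show "op_fun (con_sym S) [const (truth S M p), const (truth S M q)] = truth S M (p \<and> q)"
    using op_const[of "con_sym S" "[a, b]" \<pi>] c(2) v_truth[OF c(2)] D_Con[OF ab(3,4)] ab by (simp add: Con_def)
  show "op_fun (dis_sym S) [const (truth S M p), const (truth S M q)] = truth S M (p \<or> q)"
    using op_const[of "dis_sym S" "[a, b]" \<pi>] c(3) v_truth[OF c(3)] D_Dis[OF ab(3,4)] ab by (simp add: Dis_def)
  show "op_fun (imp_sym S) [const (truth S M p), const (truth S M q)] = truth S M (p \<longrightarrow> q)"
    using op_const[of "imp_sym S" "[a, b]" \<pi>] c(4) v_truth[OF c(4)] D_Imp[OF ab(3,4)] ab by (simp add: Imp_def)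
  show "op_fun (iff_sym S) [const (truth S M p), const (truth S M q)] = truth S M (p \<longleftrightarrow> q)"
    using op_const[of "iff_sym S" "[a, b]" \<pi>] c(5) v_truth[OF c(5)] D_Iff[OF ab(3,4)] ab by (simp add: Iff_def)
qed

lemma dom_form: "dom \<pi> = {truth S M False, truth S M True}"
proof -
  have "dom \<pi> = v ` closed S \<pi>" using Top_closed by (auto simp: dom_def)
  also have "\<dots> = {truth S M False, truth S M True}"
  proof
    show "v ` closed S \<pi> \<subseteq> {truth S M False, truth S M True}"
    proof
      fix y assume "y \<in> v ` closed S \<pi>"
      then obtain \<psi> where "y = truth S M (D \<psi>)" using v_truth by auto
      then show "y \<in> {truth S M False, truth S M True}" by (cases "D \<psi>") auto
    qed
    show "{truth S M False, truth S M True} \<subseteq> v ` closed S \<pi>" using Top_closed Bot_closed by (auto simp: truth_M)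
  qed
  finally show ?thesis .
qed

text \<open>The elements of \<open>dom \<alpha>\<close> are values of closed expressions, so both
  quantifiers reduce to closed instances. The nontrivial directions are \<open>D_Forall\<close> and
  the existence of witnesses.\<close>

lemma quantifiers:
  assumes "\<alpha> \<in> VSRT S" "\<theta> \<in> fdom \<pi> [\<alpha>]"
  shows "op_fun (all_sym S \<alpha>) [\<theta>] = truth S M (\<forall>x \<in> dom \<alpha>. \<theta> [x] = truth S M True)"
    and "op_fun (ex_sym S \<alpha>) [\<theta>] = truth S M (\<exists>x \<in> dom \<alpha>. \<theta> [x] = truth S M True)"
proof -
  have "closed S \<pi> \<noteq> {}" using Top_closed by blast
  then obtain vs a where vs: "\<theta> = ind vs a" "vs \<in> var_seqs S [\<alpha>]" "a \<in> F" "fv S a \<subseteq> set vs"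
    using assms(2) by (elim fdomE)
  then obtain x where x: "vs = [x]" "x \<in> VAR S" "sort_of S x = \<alpha>" by (auto simp: var_seqs_conv_map)
  have fv: "fv S a \<subseteq> {x}" using vs(4) x by simp
  have c: "closeds S [x] [c]" "subst [x] [c] a \<in> closed S \<pi>" if "c \<in> closed S \<alpha>" for c
  proof -
    show *: "closeds S [x] [c]" using that x by (simp add: closeds_Cons)
    show "subst [x] [c] a \<in> closed S \<pi>" using subst_closeds[OF * vs(3)] x fv by simp
  qed
  have \<theta>: "\<theta> [v c] = truth S M True \<longleftrightarrow> D (subst [x] [c] a)" if "c \<in> closed S \<alpha>" for c
    using ind_apply[OF c(1)[OF that] _ vs(3)] x fv v_truth[OF c(2)[OF that]] by (simp add: vs(1) truth_inj)
  have dom: "dom \<alpha> = v ` closed S \<alpha>" using closed_inhabited[OF assms(1)] by (simp add: dom_def)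
  have A: "Forall S x a \<in> closed S \<pi>" and E: "Exists S x a \<in> closed S \<pi>"
    using x(2) vs(3) fv by (auto simp: closed_def)
  have "D (Forall S x a) \<longleftrightarrow> (\<forall>c \<in> closed S \<alpha>. D (subst [x] [c] a))"
  proof
    assume "D (Forall S x a)"
    then have "D (Foralls S [x] a)" by (simp add: Foralls_def)
    then have "D a" using derivable_Foralls_elim x(2) vs(3) by (metis empty_set empty_subsetI insert_subset list.simps(15))
    then show "\<forall>c \<in> closed S \<alpha>. D (subst [x] [c] a)" using derivable_subst_closed[OF _ vs(3) x(2)] x(3) by blast
  next
    assume "\<forall>c \<in> closed S \<alpha>. D (subst [x] [c] a)"
    then show "D (Forall S x a)" using D_Forall[OF x(2) vs(3) fv] x(3) by blast
  qed
  then have "truth S M (D (Forall S x a)) = truth S M (\<forall>x \<in> dom \<alpha>. \<theta> [x] = truth S M True)"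
    by (simp add: dom \<theta>)
  then show "op_fun (all_sym S \<alpha>) [\<theta>] = truth S M (\<forall>x \<in> dom \<alpha>. \<theta> [x] = truth S M True)"
    using op_fun_apply[of "all_sym S \<alpha>" "[([x], a)]" \<pi>] A v_truth[OF A] by (simp add: Forall_def x(3) vs(1) x(1))
  have "D (Exists S x a) \<longleftrightarrow> (\<exists>c \<in> closed S \<alpha>. D (subst [x] [c] a))"
  proof
    assume "D (Exists S x a)"
    then show "\<exists>c \<in> closed S \<alpha>. D (subst [x] [c] a)" using henkin[OF x(2) vs(3) fv] x(3) by blast
  next
    assume "\<exists>c \<in> closed S \<alpha>. D (subst [x] [c] a)"
    then obtain c where c: "c \<in> closed S \<alpha>" "D (subst [x] [c] a)" by blast
    then show "D (Exists S x a)"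
      using D_ExI[OF x(2) vs(3) _ _ c(2)] closed_Exprs[OF c(1)] Subb_closed[OF closed_fv[OF c(1)]] x(3) by blast
  qed
  then have "truth S M (D (Exists S x a)) = truth S M (\<exists>x \<in> dom \<alpha>. \<theta> [x] = truth S M True)"
    by (simp add: dom \<theta>)
  then show "op_fun (ex_sym S \<alpha>) [\<theta>] = truth S M (\<exists>x \<in> dom \<alpha>. \<theta> [x] = truth S M True)"
    using op_fun_apply[of "ex_sym S \<alpha>" "[([x], a)]" \<pi>] E v_truth[OF E] by (simp add: Exists_def x(3) vs(1) x(1))
qed

lemma equality:
  assumes "\<alpha> \<in> SRT S" "x \<in> dom \<alpha>" "y \<in> dom \<alpha>"
  shows "op_fun (eq_sym S \<alpha>) [const x, const y] = truth S M (x = y)"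
proof (cases "closed S \<alpha> = {}")
  case True
  \<comment> \<open>The domain has one element, so the equation must come out true; the default at
    \<open>\<pi>\<close> was chosen accordingly.\<close>
  then have "x = y" using assms(2,3) by (simp add: dom_def)
  then show ?thesis
    using op_fun_default[of "eq_sym S \<alpha>" \<pi> "[\<alpha>, \<alpha>]" "[[], []]" 0] assms(1) True
    by (simp add: sym_sigs default_def truth_M)
next
  case False
  then obtain a b where ab: "a \<in> closed S \<alpha>" "b \<in> closed S \<alpha>" "x = v a" "y = v b"
    using assms(2,3) by (auto simp: dom_def)
  have E: "Eq S \<alpha> a b \<in> closed S \<pi>"
    using F_intros(10)[OF assms(1) closed_Exprs[OF ab(1)] closed_Exprs[OF ab(2)]] closed_fv[OF ab(1)] closed_fv[OF ab(2)]
    by (simp add: closed_def)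
  show ?thesis
    using op_const[of "eq_sym S \<alpha>" "[a, b]" \<pi>] E v_truth[OF E] v_eq_iff[OF ab(1,2)] ab(3,4) by (simp add: Eq_def)
qed

lemma M_structure: "is_structure S M"
  unfolding is_structure_def M_simps seqs_M
proof (intro conjI ballI allI impI)
  fix \<alpha> show "dom \<alpha> \<noteq> {}" by (simp add: dom_def)
next
  fix \<gamma> show "fdom \<gamma> [] = const ` dom \<gamma>" by (rule fdom_Nil)
next
  fix \<gamma> \<sigma>s assume "\<sigma>s \<in> lists (VSRT S)"
  then show "fdom \<gamma> \<sigma>s \<subseteq> dseqs \<sigma>s \<rightarrow>\<^sub>E dom \<gamma>" by (intro fdom_funcset) auto
next
  fix f \<gamma> \<alpha>s \<beta>ss assume "f \<in> SOP S" "sig S f = (\<gamma>, \<alpha>s, \<beta>ss)"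
  then show "op_fun f \<in> arg_seqs M \<alpha>s \<beta>ss \<rightarrow> dom \<gamma>" using op_fun_dom by blast
next
  fix \<gamma> \<sigma>s w assume "\<sigma>s \<in> lists (VSRT S)" "w \<in> dom \<gamma>"
  then show "(\<lambda>_ \<in> dseqs \<sigma>s. w) \<in> fdom \<gamma> \<sigma>s" by (intro fdom_const) auto
next
  fix \<sigma>s j assume "\<sigma>s \<in> lists (VSRT S)" "j < length \<sigma>s"
  then show "(\<lambda>xs \<in> dseqs \<sigma>s. xs ! j) \<in> fdom (\<sigma>s ! j) \<sigma>s" by (intro fdom_proj) auto
next
  fix \<gamma> \<sigma>s \<rho>s g xs assume "\<sigma>s \<in> lists (VSRT S)" "\<rho>s \<in> lists (VSRT S)" "g \<in> fdom \<gamma> (\<sigma>s @ \<rho>s)" "xs \<in> dseqs \<sigma>s"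
  then show "(\<lambda>rs \<in> dseqs \<rho>s. g (xs @ rs)) \<in> fdom \<gamma> \<rho>s" by (intro fdom_fix) auto
next
  fix f \<gamma> \<alpha>s \<beta>ss \<sigma>s gs
  assume "f \<in> SOP S" "sig S f = (\<gamma>, \<alpha>s, \<beta>ss)" "\<alpha>s \<noteq> []" "\<sigma>s \<in> lists (VSRT S)"
    "gs \<in> arg_seqs M \<alpha>s (map (\<lambda>\<beta>s. \<sigma>s @ \<beta>s) \<beta>ss)"
  then show "(\<lambda>ys \<in> dseqs \<sigma>s. op_fun f (map2 (\<lambda>g \<beta>s. \<lambda>rs \<in> dseqs \<beta>s. g (ys @ rs)) gs \<beta>ss)) \<in> fdom \<gamma> \<sigma>s"
    by (intro fdom_comp) auto
next
  show "truth S M False \<noteq> truth S M True" by (simp add: truth_inj)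
qed (rule connectives dom_form quantifiers equality; assumption)+

text \<open>The truth lemma, for expressions of every sort. At a binder the environment grows by
  closed expressions \<open>rs\<close>, and \<open>subst_under_binder\<close> splits them off again,
  leaving the function induced by the substituted argument.\<close>

lemma interp_M:
  assumes "closeds S us ts" "set us \<subseteq> VAR S" "e \<in> Exprs S \<gamma>" "fv S e \<subseteq> set us"
  shows "interp S M us e (map v ts) = v (subst us ts e)"
  using assms
proof (induction e arbitrary: us ts \<gamma> rule: expr_induct)
  case (Op f args)
  have l: "length us = length ts" using Op.prems(1) by (rule closeds_length)
  have xs: "map v ts \<in> dseqs (map (sort_of S) us)" using closeds_dseqs[OF Op.prems(1)] .
  show ?case
  proof (cases "args = [] \<and> f \<in> VAR S")
    case True
    then have "f \<in> set us" using Op.prems(4) by auto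
    then obtain d where "last_assoc us ts f = Some d" using last_assoc_None_iff[OF l] by fastforce
    then show ?thesis using xs True by (simp add: last_assoc_map subst.simps)
  next
    case False
    let ?args = "map (\<lambda>(vs, a). (vs, subst (us @ vs) (ts @ map Var vs) a)) args"
    have "(\<lambda>ys \<in> dseqs (map (sort_of S) vs). interp S M (us @ vs) a (map v ts @ ys)) =
        ind vs (subst (us @ vs) (ts @ map Var vs) a)" if m: "(vs, a) \<in> set args" for vs a
    proof -
      have V: "set vs \<subseteq> VAR S" using arg_Exprs(1)[OF Op.prems(3) m] .
      obtain \<alpha> where a: "a \<in> Exprs S \<alpha>" using arg_Exprs(3)[OF Op.prems(3) m] by blast
      have "fv S a - set vs \<subseteq> fv S (Op f args)" using m by auto
      then have fv: "fv S a \<subseteq> set (us @ vs)" using Op.prems(4) by auto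
      show ?thesis
      proof (rule ind_eqI[OF refl V subst_under_Exprs[OF Op.prems(1) V Op.prems(2) a] fv_subst_under[OF Op.prems(1) V Op.prems(2) fv]])
        fix rs assume rs: "closeds S vs rs"
        have "closeds S (us @ vs) (ts @ rs)" using Op.prems(1) rs l by (simp add: closeds_append)
        then have "interp S M (us @ vs) a (map v (ts @ rs)) = v (subst (us @ vs) (ts @ rs) a)"
          using V Op.prems(2) by (intro Op.IH[OF m _ _ a fv]) auto
        then show "interp S M (us @ vs) a (map v ts @ map v rs) = v (subst vs rs (subst (us @ vs) (ts @ map Var vs) a))"
          using subst_under_binder[OF Op.prems(1) a V closeds_length[OF rs]] by simp
      qed
    qed
    then have "map (\<lambda>(vs, a). \<lambda>ys \<in> dseqs (map (sort_of S) vs). interp S M (us @ vs) a (map v ts @ ys)) args =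
        map (\<lambda>(vs, a). ind vs a) ?args" by auto
    moreover have "interp S M us (Op f args) (map v ts) = op_fun f
        (map (\<lambda>(vs, a). \<lambda>ys \<in> dseqs (map (sort_of S) vs). interp S M (us @ vs) a (map v ts @ ys)) args)"
      using xs False by auto
    ultimately have i: "interp S M us (Op f args) (map v ts) = op_fun f (map (\<lambda>(vs, a). ind vs a) ?args)"
      by (simp only:)
    have s: "subst us ts (Op f args) = Op f ?args"
    proof (cases "args = []")
      case True
      then have "f \<notin> set us" using False Op.prems(2) by auto
      then show ?thesis using True l by (simp add: subst_eq_fsub fsub.simps bind_notin)
    qed (rule subst_Op)
    then have "Op f ?args \<in> closed S \<gamma>" using subst_closeds[OF Op.prems(1,3,2,4)] by simp
    then show ?thesis unfolding i s by (rule op_fun_apply)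
  qed
qed

text \<open>This includes open \<open>\<phi>\<close>: every assignment consists of values of closed
  expressions, so satisfaction means derivability of all closed instances, which by
  \<open>D_Foralls\<close> is derivability of the universal closure.\<close>

lemma satisfies_iff:
  assumes "\<phi> \<in> F"
  shows "satisfies S M \<phi> \<longleftrightarrow> D \<phi>"
proof
  assume d: "D \<phi>"
  show "satisfies S M \<phi>"
    unfolding satisfies_def seqs_M
  proof (intro ballI impI)
    fix us xs assume us: "us \<in> lists (VAR S)" "fv S \<phi> \<subseteq> set us" and xs: "xs \<in> dseqs (map (sort_of S) us)"
    have V: "set us \<subseteq> VAR S" using us(1) by auto
    obtain ts where ts: "closeds S us ts" "xs = map v ts" using dseqs_closeds[OF xs V] by blast
    have "D (subst us ts \<phi>)" using derivable_subst_closeds[OF d assms V ts(1)] .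
    then show "interp S M us \<phi> xs = truth S M True"
      using interp_M[OF ts(1) V assms us(2)] v_truth[OF subst_closeds[OF ts(1) assms V us(2)]] ts(2) by simp
  qed
next
  assume sat: "satisfies S M \<phi>"
  have "finite (fv S \<phi>)" using frs_subset_set_expr[of \<phi>] by (auto simp: fv_eq_frs intro: finite_subset)
  then obtain us where us: "set us = fv S \<phi>" "distinct us" using finite_distinct_list by blast
  then have V: "set us \<subseteq> VAR S" by (auto simp: fv_eq_frs)
  have "D (Foralls S us \<phi>)"
  proof (rule D_Foralls[OF us(2) V assms])
    fix ts assume ts: "closeds S us ts"
    have "interp S M us \<phi> (map v ts) = truth S M True"
      using sat V us(1) closeds_dseqs[OF ts] unfolding satisfies_def seqs_M by (auto simp: in_lists_conv_set)
    then show "D (subst us ts \<phi>)"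
      using interp_M[OF ts V assms] v_truth[OF subst_closeds[OF ts assms V]] us(1) by (simp add: truth_inj)
  qed (simp add: us(1))
  then show "D \<phi>" using derivable_Foralls_elim V assms by blast
qed

end

section \<open>Maximal consistent extensions\<close>

text \<open>Zorn's lemma, as the language may be uncountable; unions of chains stay consistent
  because derivations are finite. \<open>\<psi>\<close> is closed so that \<open>deduction\<close>
  can turn an inconsistency with its negation into a derivation of \<open>\<psi>\<close>.\<close>

lemma (in sgn) lindenbaum:
  assumes "\<Gamma>0 \<subseteq> F" "\<not> derivable S \<Gamma>0 (Bot S)"
  obtains \<Gamma> where "\<Gamma>0 \<subseteq> \<Gamma>" "\<Gamma> \<subseteq> F" "\<not> derivable S \<Gamma> (Bot S)"
    "\<And>\<psi>. \<psi> \<in> closed S \<pi> \<Longrightarrow> derivable S \<Gamma> \<psi> \<or> derivable S \<Gamma> (Neg S \<psi>)"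
proof -
  let ?A = "{\<Gamma>. \<Gamma>0 \<subseteq> \<Gamma> \<and> \<Gamma> \<subseteq> F \<and> \<not> derivable S \<Gamma> (Bot S)}"
  have "\<exists>\<Gamma> \<in> ?A. \<forall>X \<in> ?A. \<Gamma> \<subseteq> X \<longrightarrow> X = \<Gamma>"
  proof (rule subset_Zorn_nonempty)
    show "?A \<noteq> {}" using assms by blast
    fix C assume C: "C \<noteq> {}" "subset.chain ?A C"
    then have CA: "C \<subseteq> ?A" by (simp add: subset.chain_def)
    have "\<not> derivable S (\<Union> C) (Bot S)"
    proof
      assume "derivable S (\<Union> C) (Bot S)"
      then obtain \<Delta> where \<Delta>: "\<Delta> \<subseteq> \<Union> C" "finite \<Delta>" "derivable S \<Delta> (Bot S)" using derivable_finite by blast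
      then obtain X where "X \<in> C" "\<Delta> \<subseteq> X" using finite_subset_Union_chain[OF \<Delta>(2,1) C] by blast
      then show False using \<Delta>(3) CA derivable_mono by blast
    qed
    then show "\<Union> C \<in> ?A" using C(1) CA by blast
  qed
  then obtain \<Gamma> where \<Gamma>A: "\<Gamma> \<in> ?A" and max: "\<forall>X \<in> ?A. \<Gamma> \<subseteq> X \<longrightarrow> X = \<Gamma>" by (elim bexE)
  then have \<Gamma>: "\<Gamma>0 \<subseteq> \<Gamma>" "\<Gamma> \<subseteq> F" "\<not> derivable S \<Gamma> (Bot S)" by simp_all
  have "derivable S \<Gamma> \<psi> \<or> derivable S \<Gamma> (Neg S \<psi>)" if \<psi>: "\<psi> \<in> closed S \<pi>" for \<psi>
  proof (rule disjCI)
    assume n: "\<not> derivable S \<Gamma> (Neg S \<psi>)"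
    have \<psi>F: "\<psi> \<in> F" "fv S \<psi> = {}" using \<psi> by (auto simp: closed_def)
    have "derivable S (insert (Neg S \<psi>) \<Gamma>) (Bot S)"
    proof (rule ccontr)
      assume "\<not> derivable S (insert (Neg S \<psi>) \<Gamma>) (Bot S)"
      then have "insert (Neg S \<psi>) \<Gamma> \<in> ?A" using \<Gamma> \<psi>F by auto
      then have "insert (Neg S \<psi>) \<Gamma> = \<Gamma>" using max by (meson subset_insertI)
      then show False using n derivable.Assumption[of "Neg S \<psi>" \<Gamma> S] by blast
    qed
    then have "derivable S \<Gamma> (Imp S (Neg S \<psi>) (Bot S))" using \<Gamma>(2) \<psi>F by (intro deduction) auto
    then show "derivable S \<Gamma> \<psi>" by (rule prop1) (use \<psi>F in \<open>auto simp: boolean_valuation_def\<close>)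
  qed
  then show ?thesis using \<Gamma> that by blast
qed

lemma frs_map_inj: "inj \<rho> \<Longrightarrow> frs (map_expr \<rho> e) = \<rho> ` frs e"
proof (induction e rule: expr_induct)
  case (Op f args)
  have *: "frs (map_expr \<rho> a) - set (map \<rho> vs) = \<rho> ` (frs a - set vs)" if "(vs, a) \<in> set args" for vs a
    using Op.IH[OF that Op.prems] Op.prems by (simp add: image_set_diff)
  show ?case
  proof (cases "args = []")
    case False
    then have "frs (map_expr \<rho> (Op f args)) = (\<Union>(vs, a) \<in> set args. frs (map_expr \<rho> a) - set (map \<rho> vs))"
      by (simp add: map_expr_Op split_beta)
    also have "\<dots> = (\<Union>(vs, a) \<in> set args. \<rho> ` (frs a - set vs))"
      by (rule SUP_cong) (use * in auto)
    also have "\<dots> = \<rho> ` frs (Op f args)" using False by (simp add: image_UN split_beta)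
    finally show ?thesis .
  qed (simp add: map_expr_Op)
qed

context sgn_ext
begin

lemma fv_Base: "fv H (map_expr Base e) = Base ` fv S e"
  by (auto simp: fv_eq_frs frs_map_inj inj_on_def)

lemma set_hsym_syms: "e \<in> Exprs H \<gamma> \<Longrightarrow> s \<in> set_expr e \<Longrightarrow> set_hsym s \<subseteq> SOP S \<union> VAR S"
  using H.set_expr_syms[of e \<gamma>] by (auto simp: hext_def)

text \<open>The witness axioms for all formulas of the extended language are added at once, since
  the witness constants already cover that language. \<open>\<phi>\<close> is closed so that its
  negation can be added by way of \<open>deduction\<close>.\<close>

lemma henkin_extension:
  assumes T: "T \<subseteq> F" and \<phi>: "\<phi> \<in> F" "fv S \<phi> = {}" and nd: "\<not> derivable S T \<phi>"
  obtains \<Gamma> where "henkin H \<Gamma>" "map_expr Base ` T \<subseteq> \<Gamma>" "\<not> derivable H \<Gamma> (map_expr Base \<phi>)"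
proof -
  interpret B: renaming S H Base by (rule renaming_Base)
  let ?W = "(\<lambda>(x, \<phi>). witness_axiom S x \<phi>) ` witness_pairs"
  let ?T = "map_expr Base ` T" and ?\<phi> = "map_expr Base \<phi>"
  have RF: "map_expr Base \<psi> \<in> H.F" if "\<psi> \<in> F" for \<psi> using B.R_Exprs[OF that] by (simp add: hext_form)
  have TF: "?T \<subseteq> H.F" and \<phi>F: "?\<phi> \<in> H.F" using RF T \<phi> by auto
  have \<phi>c: "?\<phi> \<in> closed H H.\<pi>" using \<phi>F \<phi>(2) by (simp add: closed_def fv_Base)
  have WF: "?W \<subseteq> H.F"
  proof clarify
    fix x \<chi> assume "(x, \<chi>) \<in> witness_pairs"
    then show "witness_axiom S x \<chi> \<in> H.F"
      using witness_axiom_closed[of x \<chi>] unfolding witness_pairs_def closed_def by blast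
  qed
  have base: "set_expr (map_expr Base \<psi>) \<subseteq> range Base" for \<psi> by (auto simp: expr.set_map)
  have "\<not> derivable H (?T \<union> ?W) ?\<phi>"
  proof
    assume "derivable H (?T \<union> ?W) ?\<phi>"
    then obtain \<Delta> where \<Delta>: "\<Delta> \<subseteq> ?T \<union> ?W" "finite \<Delta>" "derivable H \<Delta> ?\<phi>" using derivable_finite by blast
    then obtain P where P: "P \<subseteq> witness_pairs" "finite P" "\<Delta> - ?T = (\<lambda>(x, \<phi>). witness_axiom S x \<phi>) ` P"
      using finite_subset_image[of "\<Delta> - ?T" "\<lambda>(x, \<phi>). witness_axiom S x \<phi>" witness_pairs] by blast
    have "derivable H (?T \<union> (\<lambda>(x, \<phi>). witness_axiom S x \<phi>) ` P) ?\<phi>"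
      using P(3) by (intro derivable_mono[OF \<Delta>(3)]) auto
    then have "derivable H ?T ?\<phi>"
      using base by (intro witnesses_elim[OF P(2,1) _ TF \<phi>F]) auto
    then show False using hext_conservative nd by blast
  qed
  note n\<phi> = this
  have "\<not> derivable H (insert (Neg H ?\<phi>) (?T \<union> ?W)) (Bot H)"
  proof
    assume "derivable H (insert (Neg H ?\<phi>) (?T \<union> ?W)) (Bot H)"
    then have "derivable H (?T \<union> ?W) (Imp H (Neg H ?\<phi>) (Bot H))"
      using TF WF \<phi>F \<phi>c by (intro H.deduction) (auto simp: closed_def)
    then have "derivable H (?T \<union> ?W) ?\<phi>"
      by (rule H.prop1) (use \<phi>F in \<open>auto simp: boolean_valuation_def\<close>)
    then show False using n\<phi> by blast
  qed
  then obtain \<Gamma> where \<Gamma>: "insert (Neg H ?\<phi>) (?T \<union> ?W) \<subseteq> \<Gamma>" "\<Gamma> \<subseteq> H.F" "\<not> derivable H \<Gamma> (Bot H)"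
    and compl: "\<And>\<psi>. \<psi> \<in> closed H H.\<pi> \<Longrightarrow> derivable H \<Gamma> \<psi> \<or> derivable H \<Gamma> (Neg H \<psi>)"
    using H.lindenbaum[of "insert (Neg H ?\<phi>) (?T \<union> ?W)"] TF WF \<phi>F by (metis H.F_intros(3) insert_subset Un_least)
  have hk: "henkin H \<Gamma>"
  proof unfold_locales
    fix x \<chi> assume x: "x \<in> VAR H" and \<chi>: "\<chi> \<in> H.F" "fv H \<chi> \<subseteq> {x}" and d: "derivable H \<Gamma> (Exists H x \<chi>)"
    obtain x' where x': "x = Base x'" "x' \<in> VAR S" using x by auto
    then have "(x', \<chi>) \<in> witness_pairs" using \<chi> by (simp add: witness_pairs_def)
    then have "witness_axiom S x' \<chi> \<in> \<Gamma>" using \<Gamma>(1) by auto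
    then have "derivable H \<Gamma> (Imp H (Exists H x \<chi>) (subst [x] [Op (Wit x' \<chi>) []] \<chi>))"
      using derivable.Assumption by (simp add: witness_axiom_def x'(1))
    then have "derivable H \<Gamma> (subst [x] [Op (Wit x' \<chi>) []] \<chi>)" using d derivable.ModusPonens by blast
    then show "\<exists>c \<in> closed H (sort_of H x). derivable H \<Gamma> (subst [x] [c] \<chi>)"
      using Wit_closed[OF x'(2) \<chi>(1)] x'(1) by auto
  qed (use \<Gamma> compl in auto)
  have "\<not> derivable H \<Gamma> ?\<phi>"
  proof
    assume "derivable H \<Gamma> ?\<phi>"
    moreover have "derivable H \<Gamma> (Neg H ?\<phi>)" using \<Gamma>(1) derivable.Assumption by blast
    ultimately show False using henkin.not_both[OF hk] by blast
  qed
  then show ?thesis using that[OF hk] \<Gamma>(1) by blast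
qed


section \<open>Reducts\<close>

definition reduct :: "('srt, 's hsym, 'u) struct \<Rightarrow> ('srt, 's, 'u) struct" where
  "reduct N = \<lparr> dom_of = dom_of N, fun_dom = fun_dom N, op_int = (\<lambda>f. op_int N (Base f)) \<rparr>"

lemma reduct_simps [simp]:
  "dom_of (reduct N) = dom_of N" "fun_dom (reduct N) = fun_dom N" "op_int (reduct N) f = op_int N (Base f)"
  "seqs (reduct N) = seqs N" "arg_seqs (reduct N) = arg_seqs N" "truth S (reduct N) = truth H N"
  by (simp_all add: reduct_def seqs_def arg_seqs_def truth_def hext_def fun_eq_iff)

text \<open>Both languages have the same sorts, domains and function spaces; forgetting the witness
  constants only leaves fewer operations to satisfy the conditions.\<close>

lemma reduct_structure:
  assumes "is_structure H N"
  shows "is_structure S (reduct N)"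
proof -
  have syms: "neg_sym H = Base (neg_sym S)" "imp_sym H = Base (imp_sym S)" "con_sym H = Base (con_sym S)"
    "dis_sym H = Base (dis_sym S)" "iff_sym H = Base (iff_sym S)" "all_sym H = (\<lambda>\<alpha>. Base (all_sym S \<alpha>))"
    "ex_sym H = (\<lambda>\<alpha>. Base (ex_sym S \<alpha>))" "eq_sym H = (\<lambda>\<alpha>. Base (eq_sym S \<alpha>))"
    by (simp_all add: hext_def)
  note h = assms[unfolded is_structure_def hext_simps hext_form syms]
  have 1: "op_int N (Base f) \<in> arg_seqs N \<alpha>s \<beta>ss \<rightarrow> dom_of N \<gamma>"
    if f: "f \<in> SOP S" "sig S f = (\<gamma>, \<alpha>s, \<beta>ss)" for f \<gamma> \<alpha>s \<beta>ss
  proof -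
    have "\<forall>f \<in> SOP H. \<forall>\<gamma> \<alpha>s \<beta>ss. sig H f = (\<gamma>, \<alpha>s, \<beta>ss) \<longrightarrow> op_int N f \<in> arg_seqs N \<alpha>s \<beta>ss \<rightarrow> dom_of N \<gamma>"
      using h by (elim conjE) assumption
    then show ?thesis using f by (metis hext_simps(4,6))
  qed
  have 2: "(\<lambda>ys \<in> seqs N \<sigma>s. op_int N (Base f) (map2 (\<lambda>g \<beta>s. \<lambda>rs \<in> seqs N \<beta>s. g (ys @ rs)) gs \<beta>ss)) \<in> fun_dom N \<gamma> \<sigma>s"
    if f: "f \<in> SOP S" "sig S f = (\<gamma>, \<alpha>s, \<beta>ss)" "\<alpha>s \<noteq> []" "\<sigma>s \<in> lists (VSRT S)" "\<sigma>s \<noteq> []"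
      "gs \<in> arg_seqs N \<alpha>s (map (\<lambda>\<beta>s. \<sigma>s @ \<beta>s) \<beta>ss)" for f \<gamma> \<alpha>s \<beta>ss \<sigma>s gs
  proof -
    have "\<forall>f \<in> SOP H. \<forall>\<gamma> \<alpha>s \<beta>ss. sig H f = (\<gamma>, \<alpha>s, \<beta>ss) \<longrightarrow> \<alpha>s \<noteq> [] \<longrightarrow>
        (\<forall>\<sigma>s \<in> lists (VSRT S). \<sigma>s \<noteq> [] \<longrightarrow>
          (\<forall>gs \<in> arg_seqs N \<alpha>s (map (\<lambda>\<beta>s. \<sigma>s @ \<beta>s) \<beta>ss).
            (\<lambda>ys \<in> seqs N \<sigma>s. op_int N f (map2 (\<lambda>g \<beta>s. \<lambda>rs \<in> seqs N \<beta>s. g (ys @ rs)) gs \<beta>ss))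
            \<in> fun_dom N \<gamma> \<sigma>s))"
      using h by (elim conjE) assumption
    moreover have "Base f \<in> SOP H" "sig H (Base f) = (\<gamma>, \<alpha>s, \<beta>ss)" using f by simp_all
    ultimately show ?thesis using f(3-6) by blast
  qed
  have 3: "\<forall>f \<in> SOP S. \<forall>\<gamma> \<alpha>s \<beta>ss. sig S f = (\<gamma>, \<alpha>s, \<beta>ss) \<longrightarrow>
      op_int N (Base f) \<in> arg_seqs N \<alpha>s \<beta>ss \<rightarrow> dom_of N \<gamma>"
    by (intro ballI allI impI) (rule 1)
  have 4: "\<forall>f \<in> SOP S. \<forall>\<gamma> \<alpha>s \<beta>ss. sig S f = (\<gamma>, \<alpha>s, \<beta>ss) \<longrightarrow> \<alpha>s \<noteq> [] \<longrightarrow>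
        (\<forall>\<sigma>s \<in> lists (VSRT S). \<sigma>s \<noteq> [] \<longrightarrow>
          (\<forall>gs \<in> arg_seqs N \<alpha>s (map (\<lambda>\<beta>s. \<sigma>s @ \<beta>s) \<beta>ss).
            (\<lambda>ys \<in> seqs N \<sigma>s. op_int N (Base f) (map2 (\<lambda>g \<beta>s. \<lambda>rs \<in> seqs N \<beta>s. g (ys @ rs)) gs \<beta>ss))
            \<in> fun_dom N \<gamma> \<sigma>s))"
    by (intro ballI allI impI) (rule 2)
  show ?thesis
    unfolding is_structure_def reduct_simps
    using h by (elim conjE, intro conjI) (assumption | rule 3 4)+
qed

lemma interp_reduct:
  "interp S (reduct N) us e = interp H N (map Base us) (map_expr Base e)"
proof (induction e arbitrary: us rule: expr_induct)
  case (Op f args)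
  have so: "map (sort_of H) (map Base vs) = map (sort_of S) vs" for vs by simp
  have "interp S (reduct N) us (Op f args) xs = interp H N (map Base us) (map_expr Base (Op f args)) xs"
    if xs: "xs \<in> seqs N (map (sort_of S) us)" for xs
  proof -
    have l: "length us = length xs" using xs by (auto simp: seqs_def dest: list_all2_lengthD)
    have la: "last_assoc (map Base us) xs (Base f) = last_assoc us xs f"
      using l by (intro last_assoc_map_key) auto
    have *: "(\<lambda>ys \<in> seqs N (map (sort_of S) vs). interp S (reduct N) (us @ vs) a (xs @ ys)) =
       (\<lambda>ys \<in> seqs N (map (sort_of H) (map Base vs)). interp H N (map Base us @ map Base vs) (map_expr Base a) (xs @ ys))"
      if m: "(vs, a) \<in> set args" for vs a
      unfolding so using Op.IH[OF m, of "us @ vs"] by simp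
    define args' where "args' = map (\<lambda>(vs, a). (map Base vs, map_expr Base a)) args"
    have m: "map (\<lambda>(vs, a). \<lambda>ys \<in> seqs N (map (sort_of S) vs). interp S (reduct N) (us @ vs) a (xs @ ys)) args =
      map (\<lambda>(vs, a). \<lambda>ys \<in> seqs N (map (sort_of H) vs). interp H N (map Base us @ vs) a (xs @ ys)) args'"
      unfolding args'_def map_map by (rule map_cong[OF refl]) (use * in auto)
    have e: "args' = [] \<longleftrightarrow> args = []" "Base f \<in> VAR H \<longleftrightarrow> f \<in> VAR S" by (auto simp: args'_def)
    have "interp H N (map Base us) (Op (Base f) args') xs = (if args = [] \<and> f \<in> VAR S then the (last_assoc us xs f)
        else op_int N (Base f) (map (\<lambda>(vs, a). \<lambda>ys \<in> seqs N (map (sort_of H) vs). interp H N (map Base us @ vs) a (xs @ ys)) args'))"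
      unfolding interp.simps so e using xs la by simp
    moreover have "interp S (reduct N) us (Op f args) xs = (if args = [] \<and> f \<in> VAR S then the (last_assoc us xs f)
        else op_int N (Base f) (map (\<lambda>(vs, a). \<lambda>ys \<in> seqs N (map (sort_of S) vs). interp S (reduct N) (us @ vs) a (xs @ ys)) args))"
      using xs by simp
    ultimately show ?thesis unfolding map_expr_Op args'_def[symmetric] m by simp
  qed
  moreover have "interp S (reduct N) us (Op f args) xs = interp H N (map Base us) (map_expr Base (Op f args)) xs"
    if "xs \<notin> seqs N (map (sort_of S) us)" for xs
    unfolding map_expr_Op interp.simps so using that by simp
  ultimately show ?case by blast
qed

text \<open>The extension adds constants but no variables, so the variable sequences of the two
  languages correspond.\<close>

lemma satisfies_reduct: "satisfies S (reduct N) \<phi> \<longleftrightarrow> satisfies H N (map_expr Base \<phi>)"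
proof -
  have *: "(\<forall>us \<in> lists (VAR H). P us) \<longleftrightarrow> (\<forall>us \<in> lists (VAR S). P (map Base us))" for P
    by (simp add: lists_image)
  have so: "map (sort_of H) (map Base us) = map (sort_of S) us" for us by simp
  have fv: "fv H (map_expr Base \<phi>) \<subseteq> set (map Base us) \<longleftrightarrow> fv S \<phi> \<subseteq> set us" for us
    by (auto simp: fv_Base)
  show ?thesis unfolding satisfies_def * fv so reduct_simps interp_reduct ..
qed

end


section \<open>Coding expressions\<close>

text \<open>The coding uses an injective pairing \<open>p\<close> and two distinct elements \<open>a\<close>, \<open>b\<close> as tags.\<close>

fun list_code :: "('u \<Rightarrow> 'u \<Rightarrow> 'u) \<Rightarrow> 'u \<Rightarrow> 'u \<Rightarrow> 'u list \<Rightarrow> 'u" where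
  "list_code p a b [] = p a a"
| "list_code p a b (x # xs) = p b (p x (list_code p a b xs))"

fun expr_code :: "('u \<Rightarrow> 'u \<Rightarrow> 'u) \<Rightarrow> 'u \<Rightarrow> 'u \<Rightarrow> 'u expr \<Rightarrow> 'u" where
  "expr_code p a b (Op f args) =
     p f (list_code p a b (map (\<lambda>(vs, e). p (list_code p a b vs) (expr_code p a b e)) args))"

text \<open>The formula in a witness contains symbols of the same type. These are coded first, which
  leaves an expression over \<open>'u\<close> for \<open>expr_code\<close>.\<close>

primrec hsym_code :: "('u \<Rightarrow> 'u \<Rightarrow> 'u) \<Rightarrow> 'u \<Rightarrow> 'u \<Rightarrow> 'u hsym \<Rightarrow> 'u" where
  "hsym_code p a b (Base x) = p a x"
| "hsym_code p a b (Wit x e) = p b (p x (expr_code p a b (map_expr (hsym_code p a b) e)))"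

locale pairing =
  fixes p :: "'u \<Rightarrow> 'u \<Rightarrow> 'u" and a b :: 'u
  assumes p_inj: "p x y = p x' y' \<longleftrightarrow> x = x' \<and> y = y'" and ab: "a \<noteq> b"
begin

lemma list_code_inj: "list_code p a b xs = list_code p a b ys \<longleftrightarrow> xs = ys"
proof (induction xs arbitrary: ys)
  case Nil
  then show ?case using ab by (cases ys) (auto simp: p_inj)
next
  case (Cons x xs)
  then show ?case using ab by (cases ys) (auto simp: p_inj)
qed

lemma expr_code_inj: "expr_code p a b e = expr_code p a b e' \<Longrightarrow> e = e'"
proof (induction e arbitrary: e' rule: expr_induct)
  case (Op f args)
  obtain f' args' where e': "e' = Op f' args'" by (cases e')
  let ?g = "\<lambda>(vs, e). p (list_code p a b vs) (expr_code p a b e)"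
  have ff: "f = f'" and m: "map ?g args = map ?g args'"
    using Op.prems by (simp_all add: e' p_inj list_code_inj)
  have "args = args'"
  proof (rule list.inj_map_strong[OF _ m])
    fix z z' assume z: "z \<in> set args" and eq: "?g z = ?g z'"
    obtain vs c vs' c' where zz: "z = (vs, c)" "z' = (vs', c')" by fastforce
    have "vs = vs'" "expr_code p a b c = expr_code p a b c'" using eq by (simp_all add: zz p_inj list_code_inj)
    then show "z = z'" using Op.IH[of vs c c'] z by (simp add: zz)
  qed
  then show ?case by (simp add: e' ff)
qed

lemma hsym_code_inj: "hsym_code p a b h = hsym_code p a b h' \<Longrightarrow> h = h'"
proof (induction h arbitrary: h' rule: hsym.induct)
  case (Base x)
  then show ?case using ab by (cases h') (auto simp: p_inj)
next
  case (Wit x e)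
  show ?case
  proof (cases h')
    case (Base y)
    then show ?thesis using Wit.prems ab by (simp add: p_inj)
  next
    case h': (Wit y e')
    then have "x = y" and m: "map_expr (hsym_code p a b) e = map_expr (hsym_code p a b) e'"
      using Wit.prems expr_code_inj by (auto simp: p_inj)
    moreover have "e = e'" by (rule expr.inj_map_strong[OF _ m]) (rule Wit.IH)
    ultimately show ?thesis by (simp add: h')
  qed
qed

end

text \<open>An infinite set is equinumerous with its square.\<close>

lemma pairing_exists:
  assumes "infinite (UNIV :: 'u set)"
  shows "\<exists>p a b. pairing p a (b :: 'u)"
proof -
  have "\<exists>f. bij_betw f ((UNIV :: 'u set) \<times> (UNIV :: 'u set)) (UNIV :: 'u set)"
    using iffD2[OF card_of_ordIso card_of_Times_same_infinite[OF assms]] .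
  then obtain f where f: "bij_betw f ((UNIV :: 'u set) \<times> (UNIV :: 'u set)) (UNIV :: 'u set)" ..
  have inj: "inj f" using f by (simp add: bij_betw_def)
  obtain b :: 'u where b: "b \<notin> {undefined}" using ex_new_if_finite[OF assms, of "{undefined}"] by auto
  then have "pairing (\<lambda>x y. f (x, y)) undefined b" by unfold_locales (auto dest: injD[OF inj])
  then show ?thesis by blast
qed

text \<open>\<open>i\<close> is injective on the symbols of \<open>S\<close> only. That suffices,
  because in a well-formed expression the base symbols nested inside witness constants, at any
  depth, are symbols of \<open>S\<close>.\<close>

lemma (in sgn_ext) code_exists:
  fixes i :: "'s \<Rightarrow> 'u"
  assumes "infinite (UNIV :: 'u set)" "inj_on i (SOP S \<union> VAR S)"
  shows "\<exists>code :: 's hsym expr \<Rightarrow> 'u. inj_on code (\<Union>\<gamma>. Exprs H \<gamma>)"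
proof -
  obtain p a and b :: 'u where "pairing p a b" using pairing_exists[OF assms(1)] by blast
  then interpret pairing p a b .
  have "inj_on (\<lambda>e. expr_code p a b (map_expr (\<lambda>h. hsym_code p a b (map_hsym i h)) e)) (\<Union>\<gamma>. Exprs H \<gamma>)"
  proof (rule inj_onI)
    fix e e' assume e: "e \<in> (\<Union>\<gamma>. Exprs H \<gamma>)" "e' \<in> (\<Union>\<gamma>. Exprs H \<gamma>)"
      and eq: "expr_code p a b (map_expr (\<lambda>h. hsym_code p a b (map_hsym i h)) e) =
        expr_code p a b (map_expr (\<lambda>h. hsym_code p a b (map_hsym i h)) e')"
    show "e = e'"
    proof (rule expr.inj_map_strong[OF _ expr_code_inj[OF eq]])
      fix z z' assume z: "z \<in> set_expr e" "z' \<in> set_expr e'"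
        and "hsym_code p a b (map_hsym i z) = hsym_code p a b (map_hsym i z')"
      then have m: "map_hsym i z = map_hsym i z'" using hsym_code_inj by blast
      have sub: "set_hsym z \<subseteq> SOP S \<union> VAR S" "set_hsym z' \<subseteq> SOP S \<union> VAR S"
        using set_hsym_syms z e by blast+
      show "z = z'"
        by (rule hsym.inj_map_strong[OF _ m]) (use sub assms(2) in \<open>blast dest: inj_onD\<close>)
    qed
  qed
  then show ?thesis by blast
qed


section \<open>Completeness\<close>

theorem mainTheorem2:
  fixes S :: "('srt, 's) signature"
    and T :: "'s expr set"
    and \<phi> :: "'s expr"
  assumes "is_signature S"
    and "T \<subseteq> Formulas S"
    and "\<phi> \<in> Formulas S"
    (* HOL cannot quantify over types inside a formula: the structures below range over all those
       whose domains are sets over one arbitrary type 'u that is large enough for the language. *)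
    and "infinite (UNIV :: 'u set)"
    and "\<exists>i :: 's \<Rightarrow> 'u. inj_on i (SOP S \<union> VAR S)"
    and "\<forall>M :: ('srt, 's, 'u) struct.
           is_structure S M \<longrightarrow> (\<forall>\<psi> \<in> T. satisfies S M \<psi>) \<longrightarrow> satisfies S M \<phi>"
  shows "derivable S T \<phi>"
proof (rule ccontr)
  assume nd: "\<not> derivable S T \<phi>"
  interpret sgn S by (rule sgn.intro) (rule assms(1))
  interpret sgn_ext S by (rule sgn_ext)
  interpret B: renaming S H Base by (rule renaming_Base)
  have "finite (fv S \<phi>)" using frs_subset_set_expr[of \<phi>] by (auto simp: fv_eq_frs intro: finite_subset)
  then obtain us where us: "set us = fv S \<phi>" using finite_list by blast
  then have V: "set us \<subseteq> VAR S" by (auto simp: fv_eq_frs)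
  \<comment> \<open>\<open>henkin_extension\<close> wants a closed formula. The closure is
    underivable too, since the quantifiers could be stripped from it.\<close>
  have nd': "\<not> derivable S T (Foralls S us \<phi>)"
    using nd derivable_Foralls_elim[OF _ V assms(3)] by blast
  obtain \<Gamma> where \<Gamma>: "henkin H \<Gamma>" "map_expr Base ` T \<subseteq> \<Gamma>" "\<not> derivable H \<Gamma> (map_expr Base (Foralls S us \<phi>))"
    using henkin_extension[OF assms(2) _ _ nd'] assms(3) V us by auto
  obtain i :: "'s \<Rightarrow> 'u" where "inj_on i (SOP S \<union> VAR S)" using assms(5) by blast
  then obtain code :: "'s hsym expr \<Rightarrow> 'u" where code: "inj_on code (\<Union>\<gamma>. Exprs H \<gamma>)"
    using code_exists[OF assms(4)] by blast
  interpret K: henkin H \<Gamma> by (rule \<Gamma>(1))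
  interpret N: term_model H \<Gamma> code by unfold_locales (rule code)
  have RF: "map_expr Base \<psi> \<in> H.F" if "\<psi> \<in> F" for \<psi> using B.R_Exprs[OF that] by (simp add: hext_form)
  have "satisfies S (reduct N.M) \<psi>" if "\<psi> \<in> T" for \<psi>
    unfolding satisfies_reduct
    using N.satisfies_iff[OF RF] that assms(2) \<Gamma>(2) derivable.Assumption[of "map_expr Base \<psi>" \<Gamma> H] by blast
  then have "satisfies S (reduct N.M) \<phi>"
    using assms(6) reduct_structure[OF N.M_structure] by blast
  then have "derivable H \<Gamma> (map_expr Base \<phi>)"
    unfolding satisfies_reduct using N.satisfies_iff[OF RF[OF assms(3)]] by blast
  \<comment> \<open>The model yields \<open>\<phi>\<close> itself; generalization brings back the
    closure, which \<open>\<Gamma>\<close> was built not to derive.\<close>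
  then have "derivable H \<Gamma> (Foralls H (map Base us) (map_expr Base \<phi>))"
    using V by (intro H.derivable_Foralls) auto
  then show False using \<Gamma>(3) B.R_Foralls[OF V] by simp
qed

end
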